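(* Let $A$ be a quasi-Hopf (super)algebra and suppose $c_2\in A$ is even and pseudo-invariant. Set $$C_2=\sum_\nu S(X_\nu)\,c_2\,Y_\nu\,\beta\, S(Z_\nu).$$ Then: (i) $aC_2=C_2a$ for all $a\in A$, i.e. $C_2$ is central; (ii) $c_2=C_2\alpha=\alpha C_2$; (iii) $C_2=\sum_\nu\bar X_\nu\,\beta\, S(\bar Y_\nu)\,c_2\,\bar Z_\nu$.
   Context: A quasi-Hopf (super)algebra $(A,\Delta,\epsilon,\Phi)$ is a unital associative $\mathbb Z_2$-graded algebra $A$ over a field $K$ (the ungraded case being $A$ concentrated in degree $0$; $[a]\in\mathbb Z_2$ is the degree of a homogeneous $a$; sign formulas are stated for homogeneous elements and extended linearly), with grading-preserving algebra homomorphisms $\epsilon:A\to K$, $\Delta:A\to A\otimes A$, an invertible homogeneous $\Phi\in A\otimes A\otimes A$, a graded algebra anti-homomorphism $S:A\to A$ (grading preserving, $S(ab)=(-1)^{[a][b]}S(b)S(a)$) and homogeneous $\alpha,\beta\in A$. Tensor products are multiplied by $(a\otimes b)(a'\otimes b')=(-1)^{[b][a']}aa'\otimes bb'$. Write $\Phi=\sum_\nu X_\nu\otimes Y_\nu\otimes Z_\nu$, $\Phi^{-1}=\sum_\nu\bar X_\nu\otimes\bar Y_\nu\otimes\bar Z_\nu$, $\Delta(a)=\sum a_{(1)}\otimes a_{(2)}$ (homogeneous components). The axioms are, for all $a\in A$: $(1\otimes\Delta)\Delta(a)=\Phi^{-1}(\Delta\otimes1)\Delta(a)\Phi$; $(\Delta\otimes1\otimes1)\Phi\cdot(1\otimes1\otimes\Delta)\Phi=(\Phi\otimes1)\cdot(1\otimes\Delta\otimes1)\Phi\cdot(1\otimes\Phi)$;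 $(\epsilon\otimes1)\Delta=1=(1\otimes\epsilon)\Delta$; $(1\otimes\epsilon\otimes1)\Phi=1$; $\sum S(a_{(1)})\alpha a_{(2)}=\epsilon(a)\alpha$; $\sum a_{(1)}\beta S(a_{(2)})=\epsilon(a)\beta$; $\sum\bar X_\nu\beta S(\bar Y_\nu)\alpha\bar Z_\nu=1$; $\sum S(X_\nu)\alpha Y_\nu\beta S(Z_\nu)=1$. These imply that $\Phi,\alpha,\beta$ are even. An element $c\in A$ is called pseudo-invariant if $\sum S(a_{(1)})\,c\,a_{(2)}(-1)^{[c][a_{(1)}]}=\epsilon(a)c$ for all $a\in A$. *)

theory Defs
  imports Complex_Main "HOL-Library.Z2" "HOL-Library.Poly_Mapping"
begin

text \<open>
  The \<open>n\<close>-fold tensor power of a vector space is the free vector space on the words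
  (lists) of length \<open>n\<close>, divided by the subspace spanned by the multilinearity relations.
  The word \<open>[x\<^sub>1, \<dots>, x\<^sub>n]\<close> stands for the pure tensor \<open>x\<^sub>1 \<otimes> \<dots> \<otimes> x\<^sub>n\<close>.
  Tensors are cosets. Operations on tensors are computed on an arbitrary representative; the lemmas
  named \<open>\<dots>_cls\<close> below show that the choice does not matter.
\<close>

definition free_scale :: "'k::field \<Rightarrow> ('w \<Rightarrow>\<^sub>0 'k) \<Rightarrow> ('w \<Rightarrow>\<^sub>0 'k)" where
  "free_scale c u = Poly_Mapping.map ((*) c) u"

definition lin_ext :: "('k::field \<Rightarrow> 'b::ab_group_add \<Rightarrow> 'b) \<Rightarrow> ('w \<Rightarrow> 'b) \<Rightarrow> ('w \<Rightarrow>\<^sub>0 'k) \<Rightarrow> 'b" where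
  "lin_ext s f u = (\<Sum>w\<in>Poly_Mapping.keys u. s (Poly_Mapping.lookup u w) (f w))"

lemma lookup_free_scale [simp]:
  "Poly_Mapping.lookup (free_scale c u) w = c * Poly_Mapping.lookup u w"
  by (simp add: free_scale_def Poly_Mapping.map.rep_eq when_def)

lemma vector_space_free_scale: "vector_space free_scale"
  by unfold_locales (auto intro!: poly_mapping_eqI simp: lookup_add algebra_simps)

interpretation free: vector_space free_scale
  by (rule vector_space_free_scale)

lemma free_scale_single [simp]:
  "free_scale c (Poly_Mapping.single w d) = Poly_Mapping.single w (c * d)"
  by (rule poly_mapping_eqI) (simp add: lookup_single when_def)

lemma lin_ext_superset:
  assumes "vector_space s" "finite B" "Poly_Mapping.keys u \<subseteq> B"
  shows "lin_ext s f u = (\<Sum>w\<in>B. s (Poly_Mapping.lookup u w) (f w))"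
proof -
  interpret vector_space s by fact
  show ?thesis
    unfolding lin_ext_def using assms(2,3)
    by (intro sum.mono_neutral_left) (auto simp: in_keys_iff)
qed

lemma linear_lin_ext:
  fixes s :: "'k::field \<Rightarrow> 'b::ab_group_add \<Rightarrow> 'b" and f :: "'w \<Rightarrow> 'b"
  assumes "vector_space s"
  shows "Vector_Spaces.linear free_scale s (lin_ext s f)"
proof -
  interpret vector_space s by fact
  show ?thesis
    unfolding Vector_Spaces.linear_iff
  proof (intro conjI allI vector_space_free_scale assms)
    fix u v :: "'w \<Rightarrow>\<^sub>0 'k"
    let ?B = "Poly_Mapping.keys u \<union> Poly_Mapping.keys v"
    have "lin_ext s f (u + v) = (\<Sum>w\<in>?B. s (Poly_Mapping.lookup (u + v) w) (f w))"
      by (rule lin_ext_superset[OF assms]) (use keys_add[of u v] in auto)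
    moreover have "lin_ext s f u = (\<Sum>w\<in>?B. s (Poly_Mapping.lookup u w) (f w))"
      "lin_ext s f v = (\<Sum>w\<in>?B. s (Poly_Mapping.lookup v w) (f w))"
      by (rule lin_ext_superset[OF assms]; auto)+
    ultimately show "lin_ext s f (u + v) = lin_ext s f u + lin_ext s f v"
      by (simp add: lookup_add scale_left_distrib sum.distrib)
  next
    fix c and u :: "'w \<Rightarrow>\<^sub>0 'k"
    have "Poly_Mapping.keys (free_scale c u) \<subseteq> Poly_Mapping.keys u"
      by (auto simp: in_keys_iff)
    then have "lin_ext s f (free_scale c u) =
        (\<Sum>w\<in>Poly_Mapping.keys u. s (Poly_Mapping.lookup (free_scale c u) w) (f w))"
      by (intro lin_ext_superset[OF assms]) auto
    then show "lin_ext s f (free_scale c u) = s c (lin_ext s f u)"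
      by (simp add: lin_ext_def scale_sum_right)
  qed
qed

lemma lin_ext_add: "vector_space s \<Longrightarrow> lin_ext s f (u + v) = lin_ext s f u + lin_ext s f v"
  using linear_lin_ext[of s f] by (simp add: Vector_Spaces.linear_iff)

lemma lin_ext_scale: "vector_space s \<Longrightarrow> lin_ext s f (free_scale c u) = s c (lin_ext s f u)"
  using linear_lin_ext[of s f] by (simp add: Vector_Spaces.linear_iff)

lemma lin_ext_diff: "vector_space s \<Longrightarrow> lin_ext s f (u - v) = lin_ext s f u - lin_ext s f v"
  using lin_ext_add[of s f "u - v" v] by simp

lemma lin_ext_single:
  assumes "vector_space s"
  shows "lin_ext s f (Poly_Mapping.single w c) = s c (f w)"
proof -
  interpret vector_space s by fact
  show ?thesis by (simp add: lin_ext_def)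
qed

lemma lin_ext_fun_diff:
  assumes "vector_space s"
  shows "lin_ext s (\<lambda>w. f w - g w) u = lin_ext s f u - lin_ext s g u"
proof -
  interpret vector_space s by fact
  show ?thesis by (simp add: lin_ext_def scale_right_diff_distrib sum_subtractf)
qed

lemma lin_ext_fun_scale:
  assumes "vector_space s"
  shows "lin_ext s (\<lambda>w. s c (f w)) u = s c (lin_ext s f u)"
proof -
  interpret vector_space s by fact
  show ?thesis by (simp add: lin_ext_def scale_sum_right mult.commute)
qed

lemma lin_ext_in_subspace:
  assumes "vector_space s" "module.subspace s N" "\<And>w. w \<in> Poly_Mapping.keys u \<Longrightarrow> f w \<in> N"
  shows "lin_ext s f u \<in> N"
proof -
  interpret vector_space s by fact
  show ?thesis unfolding lin_ext_def
    using assms(2,3) by (intro subspace_sum subspace_scale) auto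
qed

definition words :: "nat \<Rightarrow> ('a list \<Rightarrow>\<^sub>0 'k::field) set" where
  "words n = {u. \<forall>w\<in>Poly_Mapping.keys u. length w = n}"

definition multilin_rels :: "('k::field \<Rightarrow> 'a::ab_group_add \<Rightarrow> 'a) \<Rightarrow> nat \<Rightarrow> ('a list \<Rightarrow>\<^sub>0 'k) set" where
  "multilin_rels s n =
     {Poly_Mapping.single (p @ [x + y] @ q) 1
        - Poly_Mapping.single (p @ [x] @ q) 1 - Poly_Mapping.single (p @ [y] @ q) 1
      | p q x y. length p + 1 + length q = n}
   \<union> {Poly_Mapping.single (p @ [s c x] @ q) 1 - Poly_Mapping.single (p @ [x] @ q) c
      | p q c x. length p + 1 + length q = n}"

definition tensor_null :: "('k::field \<Rightarrow> 'a::ab_group_add \<Rightarrow> 'a) \<Rightarrow> nat \<Rightarrow> ('a list \<Rightarrow>\<^sub>0 'k) set" where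
  "tensor_null s n = module.span free_scale (multilin_rels s n)"

definition tensor_cls ::
    "('k::field \<Rightarrow> 'a::ab_group_add \<Rightarrow> 'a) \<Rightarrow> nat \<Rightarrow> ('a list \<Rightarrow>\<^sub>0 'k) \<Rightarrow> ('a list \<Rightarrow>\<^sub>0 'k) set" where
  "tensor_cls s n u = {v. v - u \<in> tensor_null s n}"

definition tensor_power ::
    "('k::field \<Rightarrow> 'a::ab_group_add \<Rightarrow> 'a) \<Rightarrow> nat \<Rightarrow> ('a list \<Rightarrow>\<^sub>0 'k) set set" where
  "tensor_power s n = tensor_cls s n ` words n"

definition rep :: "('a list \<Rightarrow>\<^sub>0 'k) set \<Rightarrow> ('a list \<Rightarrow>\<^sub>0 'k::field)" where
  "rep U = (SOME u. u \<in> U)"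

definition pure_tensor ::
    "('k::field \<Rightarrow> 'a::ab_group_add \<Rightarrow> 'a) \<Rightarrow> 'a list \<Rightarrow> ('a list \<Rightarrow>\<^sub>0 'k) set" where
  "pure_tensor s w = tensor_cls s (length w) (Poly_Mapping.single w 1)"

definition tensor_add ::
    "('k::field \<Rightarrow> 'a::ab_group_add \<Rightarrow> 'a) \<Rightarrow> nat \<Rightarrow>
     ('a list \<Rightarrow>\<^sub>0 'k) set \<Rightarrow> ('a list \<Rightarrow>\<^sub>0 'k) set \<Rightarrow> ('a list \<Rightarrow>\<^sub>0 'k) set" where
  "tensor_add s n U V = tensor_cls s n (rep U + rep V)"

definition tensor_scale ::
    "('k::field \<Rightarrow> 'a::ab_group_add \<Rightarrow> 'a) \<Rightarrow> nat \<Rightarrow>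
     'k \<Rightarrow> ('a list \<Rightarrow>\<^sub>0 'k) set \<Rightarrow> ('a list \<Rightarrow>\<^sub>0 'k) set" where
  "tensor_scale s n c U = tensor_cls s n (free_scale c (rep U))"

lemma subspace_tensor_null: "free.subspace (tensor_null s n)"
  unfolding tensor_null_def by (rule free.subspace_span)

lemma tensor_null_add:
  assumes "length p + 1 + length q = n"
  shows "Poly_Mapping.single (p @ [x + y] @ q) c - Poly_Mapping.single (p @ [x] @ q) c
           - Poly_Mapping.single (p @ [y] @ q) c \<in> tensor_null s n"
proof -
  have "free_scale c (Poly_Mapping.single (p @ [x + y] @ q) 1 - Poly_Mapping.single (p @ [x] @ q) 1
           - Poly_Mapping.single (p @ [y] @ q) 1) \<in> tensor_null s n"
    unfolding tensor_null_def
    by (intro free.span_scale free.span_base) (use assms in \<open>auto simp: multilin_rels_def\<close>)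
  then show ?thesis by (simp add: free.scale_right_diff_distrib)
qed

lemma tensor_null_scale:
  assumes "length p + 1 + length q = n"
  shows "Poly_Mapping.single (p @ [s a x] @ q) c - Poly_Mapping.single (p @ [x] @ q) (a * c)
           \<in> tensor_null s n"
proof -
  have "Poly_Mapping.single (p @ [s a x] @ q) 1 - Poly_Mapping.single (p @ [x] @ q) a
           \<in> multilin_rels s n"
    unfolding multilin_rels_def using assms by blast
  then have "free_scale c (Poly_Mapping.single (p @ [s a x] @ q) 1 - Poly_Mapping.single (p @ [x] @ q) a)
           \<in> tensor_null s n"
    unfolding tensor_null_def by (intro free.span_scale free.span_base)
  then show ?thesis by (simp add: free.scale_right_diff_distrib mult.commute)
qed

lemma subspace_words: "free.subspace (words n :: ('a list \<Rightarrow>\<^sub>0 'k::field) set)"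
proof (rule free.subspaceI)
  show "u + v \<in> words n" if "u \<in> words n" "v \<in> words n" for u v :: "'a list \<Rightarrow>\<^sub>0 'k"
    using that keys_add[of u v] by (auto simp: words_def)
qed (auto simp: words_def in_keys_iff)

lemma tensor_null_words:
  fixes s :: "'k::field \<Rightarrow> 'a::ab_group_add \<Rightarrow> 'a"
  shows "tensor_null s n \<subseteq> words n"
proof -
  have "Poly_Mapping.single w c \<in> words n" if "length w = n" for w :: "'a list" and c :: 'k
    using that by (auto simp: words_def)
  then show ?thesis
    unfolding tensor_null_def
    by (intro free.span_minimal subspace_words)
       (auto simp: multilin_rels_def intro!: free.subspace_diff subspace_words)
qed

lemma rep_in: "u \<in> U \<Longrightarrow> rep U \<in> U"
  unfolding rep_def by (rule someI)

lemma tensor_cls_eq_iff: "tensor_cls s n u = tensor_cls s n v \<longleftrightarrow> u - v \<in> tensor_null s n"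
proof -
  have "u \<in> tensor_cls s n u"
    by (simp add: tensor_cls_def tensor_null_def free.span_zero)
  then have "u - v \<in> tensor_null s n" if "tensor_cls s n u = tensor_cls s n v"
    using that by (auto simp: tensor_cls_def)
  moreover have "tensor_cls s n u = tensor_cls s n v" if "u - v \<in> tensor_null s n"
  proof -
    have "x - u \<in> tensor_null s n \<longleftrightarrow> x - v \<in> tensor_null s n" for x
      using free.span_add[of "x - u" "multilin_rels s n" "u - v"]
        free.span_diff[of "x - v" "multilin_rels s n" "u - v"] that
      by (auto simp: tensor_null_def)
    then show ?thesis by (simp add: tensor_cls_def)
  qed
  ultimately show ?thesis by blast
qed

lemma rep_tensor_cls: "rep (tensor_cls s n u) - u \<in> tensor_null s n"
proof -
  have "u \<in> tensor_cls s n u"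
    by (simp add: tensor_cls_def tensor_null_def free.span_zero)
  from rep_in[OF this] show ?thesis by (simp add: tensor_cls_def)
qed

lemma lin_ext_null:
  assumes "vector_space t" "module.subspace t N"
    and "\<And>p q x y. length p + 1 + length q = n \<Longrightarrow>
           f (p @ [x + y] @ q) - f (p @ [x] @ q) - f (p @ [y] @ q) \<in> N"
    and "\<And>p q x c. length p + 1 + length q = n \<Longrightarrow> f (p @ [s c x] @ q) - t c (f (p @ [x] @ q)) \<in> N"
    and "u \<in> tensor_null s n"
  shows "lin_ext t f u \<in> N"
proof -
  interpret t: vector_space t by fact
  interpret vector_space_pair free_scale t by unfold_locales
  have "lin_ext t f r \<in> N" if "r \<in> multilin_rels s n" for r
    using that assms(3,4)
    by (auto simp: multilin_rels_def lin_ext_diff[OF assms(1)] lin_ext_single[OF assms(1)])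
  moreover have "free.subspace {u. lin_ext t f u \<in> N}"
    by (rule linear_subspace_vimage[OF linear_lin_ext[OF assms(1)] assms(2), unfolded vimage_def])
  ultimately have "free.span (multilin_rels s n) \<subseteq> {u. lin_ext t f u \<in> N}"
    by (intro free.span_minimal) auto
  with assms(5) show ?thesis by (auto simp: tensor_null_def)
qed

lemma tensor_add_cls:
  "tensor_add s n (tensor_cls s n u) (tensor_cls s n v) = tensor_cls s n (u + v)"
proof -
  have "(rep (tensor_cls s n u) - u) + (rep (tensor_cls s n v) - v) \<in> tensor_null s n"
    using rep_tensor_cls[of s n u] rep_tensor_cls[of s n v] unfolding tensor_null_def
    by (rule free.span_add)
  then show ?thesis by (simp add: tensor_add_def tensor_cls_eq_iff algebra_simps)
qed

lemma tensor_scale_cls: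
  "tensor_scale s n c (tensor_cls s n u) = tensor_cls s n (free_scale c u)"
proof -
  have "free_scale c (rep (tensor_cls s n u) - u) \<in> tensor_null s n"
    using rep_tensor_cls[of s n u] unfolding tensor_null_def by (rule free.span_scale)
  then show ?thesis
    by (simp add: tensor_scale_def tensor_cls_eq_iff free.scale_right_diff_distrib)
qed

definition free_cat :: "('a list \<Rightarrow>\<^sub>0 'k::field) \<Rightarrow> ('a list \<Rightarrow>\<^sub>0 'k) \<Rightarrow> ('a list \<Rightarrow>\<^sub>0 'k)" where
  "free_cat u v =
     lin_ext free_scale (\<lambda>p. lin_ext free_scale (\<lambda>q. Poly_Mapping.single (p @ q) 1) v) u"

text \<open>The canonical map from the \<open>m\<close>-th and the \<open>n\<close>-th to the \<open>(m + n)\<close>-th tensor power.\<close>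

definition tensor_cat ::
    "('k::field \<Rightarrow> 'a::ab_group_add \<Rightarrow> 'a) \<Rightarrow> nat \<Rightarrow> nat \<Rightarrow>
     ('a list \<Rightarrow>\<^sub>0 'k) set \<Rightarrow> ('a list \<Rightarrow>\<^sub>0 'k) set \<Rightarrow> ('a list \<Rightarrow>\<^sub>0 'k) set" where
  "tensor_cat s m n U V = tensor_cls s (m + n) (free_cat (rep U) (rep V))"

lemma free_cat_diff_left: "free_cat (u - u') v = free_cat u v - free_cat u' v"
  by (simp add: free_cat_def lin_ext_diff vector_space_free_scale)

lemma free_cat_diff_right: "free_cat u (v - v') = free_cat u v - free_cat u v'"
  by (simp add: free_cat_def lin_ext_diff lin_ext_fun_diff vector_space_free_scale)

lemma free_cat_scale_left: "free_cat (free_scale c u) v = free_scale c (free_cat u v)"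
  by (simp add: free_cat_def lin_ext_scale vector_space_free_scale)

lemma free_cat_scale_right: "free_cat u (free_scale c v) = free_scale c (free_cat u v)"
  by (simp add: free_cat_def lin_ext_scale lin_ext_fun_scale[OF vector_space_free_scale]
      vector_space_free_scale)

lemma free_cat_null_left:
  fixes s :: "'k::field \<Rightarrow> 'a::ab_group_add \<Rightarrow> 'a"
  assumes "u \<in> tensor_null s m" "v \<in> words n"
  shows "free_cat u v \<in> tensor_null s (m + n)"
  unfolding free_cat_def
proof (rule lin_ext_null[OF vector_space_free_scale subspace_tensor_null _ _ assms(1)])
  let ?f = "\<lambda>p. lin_ext free_scale (\<lambda>q. Poly_Mapping.single (p @ q) 1) v"
  fix p q :: "'a list" and x assume l: "length p + 1 + length q = m"
  show "?f (p @ [x + y] @ q) - ?f (p @ [x] @ q) - ?f (p @ [y] @ q) \<in> tensor_null s (m + n)" for y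
    unfolding lin_ext_fun_diff[OF vector_space_free_scale, symmetric]
    using assms(2) l tensor_null_add[of p "q @ _" "m + n" x y 1 s]
    by (intro lin_ext_in_subspace vector_space_free_scale subspace_tensor_null)
       (auto simp: words_def)
  show "?f (p @ [s c x] @ q) - free_scale c (?f (p @ [x] @ q)) \<in> tensor_null s (m + n)" for c
    unfolding lin_ext_fun_diff[OF vector_space_free_scale, symmetric]
      lin_ext_fun_scale[OF vector_space_free_scale, symmetric]
    using assms(2) l tensor_null_scale[of p "q @ _" "m + n" s c x 1]
    by (intro lin_ext_in_subspace vector_space_free_scale subspace_tensor_null)
       (auto simp: words_def)
qed

lemma free_cat_null_right:
  fixes s :: "'k::field \<Rightarrow> 'a::ab_group_add \<Rightarrow> 'a"
  assumes "u \<in> words m" "v \<in> tensor_null s n"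
  shows "free_cat u v \<in> tensor_null s (m + n)"
  unfolding free_cat_def
proof (rule lin_ext_in_subspace[OF vector_space_free_scale subspace_tensor_null])
  fix p assume "p \<in> Poly_Mapping.keys u"
  then have p: "length p = m" using assms(1) by (auto simp: words_def)
  show "lin_ext free_scale (\<lambda>q. Poly_Mapping.single (p @ q) 1) v \<in> tensor_null s (m + n)"
  proof (rule lin_ext_null[OF vector_space_free_scale subspace_tensor_null _ _ assms(2)])
    fix p' q :: "'a list" and x y c
    assume "length p' + 1 + length q = n"
    then show "Poly_Mapping.single (p @ p' @ [x + y] @ q) 1 - Poly_Mapping.single (p @ p' @ [x] @ q) 1
        - Poly_Mapping.single (p @ p' @ [y] @ q) 1 \<in> tensor_null s (m + n)"
      and "Poly_Mapping.single (p @ p' @ [s c x] @ q) 1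
        - free_scale c (Poly_Mapping.single (p @ p' @ [x] @ q) 1) \<in> tensor_null s (m + n)"
      using p tensor_null_add[of "p @ p'" q "m + n" x y 1 s]
        tensor_null_scale[of "p @ p'" q "m + n" s c x 1] by auto
  qed
qed

lemma tensor_cat_cls:
  assumes "u \<in> words m" "v \<in> words n"
  shows "tensor_cat s m n (tensor_cls s m u) (tensor_cls s n v) = tensor_cls s (m + n) (free_cat u v)"
proof -
  let ?u = "rep (tensor_cls s m u)" and ?v = "rep (tensor_cls s n v)"
  have "?v \<in> words n"
    using free.subspace_add[OF subspace_words assms(2), of "?v - v"]
      rep_tensor_cls[of s n v] tensor_null_words[of s n] by auto
  then have "free_cat (?u - u) ?v + free_cat u (?v - v) \<in> tensor_null s (m + n)"
    by (intro free.subspace_add subspace_tensor_null free_cat_null_left free_cat_null_right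
        rep_tensor_cls assms)
  then show ?thesis
    by (simp add: tensor_cat_def tensor_cls_eq_iff free_cat_diff_left free_cat_diff_right)
qed

text \<open>
  For a multilinear \<open>f\<close>, \<open>tensor_sum s f U\<close> is the Sweedler-type sum
  \<open>\<Sum>\<^sub>\<nu> f [X\<^sub>\<nu>, Y\<^sub>\<nu>, \<dots>]\<close> where \<open>U = \<Sum>\<^sub>\<nu> X\<^sub>\<nu> \<otimes> Y\<^sub>\<nu> \<otimes> \<dots>\<close>.
\<close>

definition tensor_sum ::
    "('k::field \<Rightarrow> 'a::ab_group_add \<Rightarrow> 'a) \<Rightarrow> ('a list \<Rightarrow> 'a) \<Rightarrow> ('a list \<Rightarrow>\<^sub>0 'k) set \<Rightarrow> 'a" where
  "tensor_sum s f U = lin_ext s f (rep U)"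

definition multilinear_words ::
    "('k::field \<Rightarrow> 'a::ab_group_add \<Rightarrow> 'a) \<Rightarrow> nat \<Rightarrow> ('a list \<Rightarrow> 'a) \<Rightarrow> bool" where
  "multilinear_words s n f \<longleftrightarrow>
     (\<forall>p q x y c. length p + 1 + length q = n \<longrightarrow>
        f (p @ [x + y] @ q) = f (p @ [x] @ q) + f (p @ [y] @ q) \<and>
        f (p @ [s c x] @ q) = s c (f (p @ [x] @ q)))"

lemma tensor_sum_cls:
  assumes "vector_space s" "multilinear_words s n f"
  shows "tensor_sum s f (tensor_cls s n u) = lin_ext s f u"
proof -
  interpret vector_space s by fact
  have "lin_ext s f (rep (tensor_cls s n u) - u) \<in> {0}"
    using assms(2)
    by (intro lin_ext_null[OF assms(1) _ _ _ rep_tensor_cls])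
       (auto simp: multilinear_words_def)
  then show ?thesis by (simp add: tensor_sum_def lin_ext_diff[OF assms(1)])
qed

text \<open>For a linear map \<open>D\<close> into the tensor square: \<open>1 \<otimes> \<dots> \<otimes> D \<otimes> \<dots> \<otimes> 1\<close> with \<open>D\<close> at
  position \<open>i\<close>, counting from \<open>0\<close>.\<close>

definition free_comult_at ::
    "('a \<Rightarrow> ('a list \<Rightarrow>\<^sub>0 'k) set) \<Rightarrow> nat \<Rightarrow> ('a list \<Rightarrow>\<^sub>0 'k) \<Rightarrow> ('a list \<Rightarrow>\<^sub>0 'k::field)" where
  "free_comult_at D i u =
     lin_ext free_scale
       (\<lambda>w. free_cat (Poly_Mapping.single (take i w) 1)
              (free_cat (rep (D (w ! i))) (Poly_Mapping.single (drop (Suc i) w) 1))) u"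

definition comult_at ::
    "('k::field \<Rightarrow> 'a::ab_group_add \<Rightarrow> 'a) \<Rightarrow> ('a \<Rightarrow> ('a list \<Rightarrow>\<^sub>0 'k) set) \<Rightarrow> nat \<Rightarrow> nat \<Rightarrow>
     ('a list \<Rightarrow>\<^sub>0 'k) set \<Rightarrow> ('a list \<Rightarrow>\<^sub>0 'k) set" where
  "comult_at s D n i U = tensor_cls s (Suc n) (free_comult_at D i (rep U))"

lemma word_position_cases:
  assumes "i < length p + 1 + length q"
  obtains (left) p1 z p2 where "p = p1 @ [z] @ p2" "i = length p1"
    | (mid) "i = length p"
    | (right) q1 z q2 where "q = q1 @ [z] @ q2" "i = length p + 1 + length q1"
proof -
  consider "i < length p" | "i = length p" | "i > length p" by linarith
  then show thesis
  proof cases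
    case 1
    then show thesis using left[of "take i p" "p ! i" "drop (Suc i) p"] by (simp add: id_take_nth_drop)
  next
    case 2
    then show thesis by (rule mid)
  next
    case 3
    let ?j = "i - length p - 1"
    have "?j < length q" using 3 assms by linarith
    then show thesis
      using right[of "take ?j q" "q ! ?j" "drop (Suc ?j) q"] 3 by (simp add: id_take_nth_drop)
  qed
qed

lemma comult_at_cls:
  assumes D_in: "\<And>x. D x \<in> tensor_power s 2"
    and D_add: "\<And>x y. D (x + y) = tensor_add s 2 (D x) (D y)"
    and D_scale: "\<And>c x. D (s c x) = tensor_scale s 2 c (D x)"
    and "i < n" "u \<in> words n"
  shows "comult_at s D n i (tensor_cls s n u) = tensor_cls s (Suc n) (free_comult_at D i u)"
proof -
  have rep_D: "rep (D x) \<in> words 2 \<and> D x = tensor_cls s 2 (rep (D x))" for x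
  proof -
    obtain v where v: "v \<in> words 2" "D x = tensor_cls s 2 v"
      using D_in[of x] by (auto simp: tensor_power_def)
    have "rep (D x) - v \<in> tensor_null s 2" using rep_tensor_cls[of s 2 v] v by simp
    then show ?thesis
      using v free.subspace_add[OF subspace_words v(1), of "rep (D x) - v"]
        tensor_null_words[of s 2] tensor_cls_eq_iff[of s 2 "rep (D x)" v] by auto
  qed
  have add: "rep (D (x + y)) - (rep (D x) + rep (D y)) \<in> tensor_null s 2" for x y
    using D_add[of x y] rep_D[of "x + y"]
    by (simp add: tensor_add_def flip: tensor_cls_eq_iff)
  have scale: "rep (D (s c x)) - free_scale c (rep (D x)) \<in> tensor_null s 2" for c x
    using D_scale[of c x] rep_D[of "s c x"]
    by (simp add: tensor_scale_def flip: tensor_cls_eq_iff)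
  have single_words: "Poly_Mapping.single w 1 \<in> words (length w)" for w :: "'a list"
    by (simp add: words_def)
  let ?F = "\<lambda>p z q. free_cat p (free_cat z q)"
  have cat: "?F a b c \<in> tensor_null s (k + (l + m))"
    if "a \<in> words k \<and> b \<in> words l \<and> c \<in> words m" and
      "a \<in> tensor_null s k \<or> b \<in> tensor_null s l \<or> c \<in> tensor_null s m" for a b c k l m
  proof -
    have "free_cat b c \<in> words (l + m)"
      using that(1) keys_add
      unfolding free_cat_def
      by (intro lin_ext_in_subspace vector_space_free_scale subspace_words) (auto simp: words_def)
    then show ?thesis
      using that by (auto intro: free_cat_null_left free_cat_null_right)
  qed
  let ?f = "\<lambda>w. ?F (Poly_Mapping.single (take i w) 1) (rep (D (w ! i)))
                   (Poly_Mapping.single (drop (Suc i) w) 1)"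
  have "lin_ext free_scale ?f v \<in> tensor_null s (Suc n)" if "v \<in> tensor_null s n" for v
  proof (rule lin_ext_null[OF vector_space_free_scale subspace_tensor_null _ _ that])
    fix p q :: "'a list" and x
    assume l: "length p + 1 + length q = n"
    then have "i < length p + 1 + length q" using assms by simp
    then have "(\<forall>y. ?f (p @ [x + y] @ q) - ?f (p @ [x] @ q) - ?f (p @ [y] @ q) \<in> tensor_null s (Suc n))
      \<and> (\<forall>c. ?f (p @ [s c x] @ q) - free_scale c (?f (p @ [x] @ q)) \<in> tensor_null s (Suc n))"
    proof (cases rule: word_position_cases)
      case (left p1 z p2)
      have w: "rep (D z) \<in> words 2" "Poly_Mapping.single p1 1 \<in> words (length p1)"
        using rep_D single_words by auto
      have N: "Suc n = length p1 + (2 + (length p2 + 1 + length q))" using l left by simp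
      have *: "Poly_Mapping.single (p2 @ [x + y] @ q) 1 - Poly_Mapping.single (p2 @ [x] @ q) 1
          - Poly_Mapping.single (p2 @ [y] @ q) 1 \<in> tensor_null s (length p2 + 1 + length q)" for y
        by (rule tensor_null_add) simp
      have **: "Poly_Mapping.single (p2 @ [s c x] @ q) 1
          - free_scale c (Poly_Mapping.single (p2 @ [x] @ q) 1)
          \<in> tensor_null s (length p2 + 1 + length q)" for c
        using tensor_null_scale[of p2 q _ s c x 1] by simp
      show ?thesis
        using cat[of _ "length p1" _ 2 _ "length p2 + 1 + length q", OF _ disjI2[OF disjI2[OF *]]]
          cat[of _ "length p1" _ 2 _ "length p2 + 1 + length q", OF _ disjI2[OF disjI2[OF **]]]
          w * ** tensor_null_words[of s "length p2 + 1 + length q"] unfolding N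
        by (auto simp: left free_cat_diff_left free_cat_diff_right free_cat_scale_left
              free_cat_scale_right subset_iff simp del: free_scale_single)
    next
      case mid
      have w: "Poly_Mapping.single p 1 \<in> words (length p)" "Poly_Mapping.single q 1 \<in> words (length q)"
        using single_words by auto
      have N: "Suc n = length p + (2 + length q)" using l by simp
      have *: "rep (D (x + y)) - rep (D x) - rep (D y) \<in> tensor_null s 2" for y
        using add[of x y] by (simp add: diff_diff_eq)
      show ?thesis
        using cat[of _ "length p" _ 2 _ "length q", OF _ disjI2[OF disjI1[OF *]]]
          cat[of _ "length p" _ 2 _ "length q", OF _ disjI2[OF disjI1[OF scale]]]
          w * scale tensor_null_words[of s 2] unfolding N
        by (auto simp: mid free_cat_diff_left free_cat_diff_right free_cat_scale_left
              free_cat_scale_right subset_iff)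
    next
      case (right q1 z q2)
      have w: "rep (D z) \<in> words 2" "Poly_Mapping.single q2 1 \<in> words (length q2)"
        using rep_D single_words by auto
      have N: "Suc n = (length p + 1 + length q1) + (2 + length q2)" using l right by simp
      have *: "Poly_Mapping.single (p @ [x + y] @ q1) 1 - Poly_Mapping.single (p @ [x] @ q1) 1
          - Poly_Mapping.single (p @ [y] @ q1) 1 \<in> tensor_null s (length p + 1 + length q1)" for y
        by (rule tensor_null_add) simp
      have **: "Poly_Mapping.single (p @ [s c x] @ q1) 1
          - free_scale c (Poly_Mapping.single (p @ [x] @ q1) 1)
          \<in> tensor_null s (length p + 1 + length q1)" for c
        using tensor_null_scale[of p q1 _ s c x 1] by simp
      show ?thesis
        using cat[of _ "length p + 1 + length q1" _ 2 _ "length q2", OF _ disjI1[OF *]]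
          cat[of _ "length p + 1 + length q1" _ 2 _ "length q2", OF _ disjI1[OF **]]
          w * ** tensor_null_words[of s "length p + 1 + length q1"] unfolding N
        by (auto simp: right nth_append free_cat_diff_left free_cat_diff_right free_cat_scale_left
              free_cat_scale_right subset_iff simp del: free_scale_single)
    qed
    then show "?f (p @ [x + y] @ q) - ?f (p @ [x] @ q) - ?f (p @ [y] @ q) \<in> tensor_null s (Suc n)"
      and "?f (p @ [s c x] @ q) - free_scale c (?f (p @ [x] @ q)) \<in> tensor_null s (Suc n)" for y c
      by blast+
  qed
  from this[OF rep_tensor_cls[of s n u]] show ?thesis
    by (simp add: comult_at_def free_comult_at_def tensor_cls_eq_iff lin_ext_diff vector_space_free_scale)
qed

text \<open>For a linear form \<open>e\<close>: \<open>1 \<otimes> \<dots> \<otimes> e \<otimes> \<dots> \<otimes> 1\<close> with \<open>e\<close> at position \<open>i\<close>, followed by the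
  identification of \<open>\<dots> \<otimes> K \<otimes> \<dots>\<close> with the tensor power with one factor less.\<close>

definition free_counit_at ::
    "('a \<Rightarrow> 'k) \<Rightarrow> nat \<Rightarrow> ('a list \<Rightarrow>\<^sub>0 'k) \<Rightarrow> ('a list \<Rightarrow>\<^sub>0 'k::field)" where
  "free_counit_at e i u =
     lin_ext free_scale (\<lambda>w. Poly_Mapping.single (take i w @ drop (Suc i) w) (e (w ! i))) u"

definition counit_at ::
    "('k::field \<Rightarrow> 'a::ab_group_add \<Rightarrow> 'a) \<Rightarrow> ('a \<Rightarrow> 'k) \<Rightarrow> nat \<Rightarrow> nat \<Rightarrow>
     ('a list \<Rightarrow>\<^sub>0 'k) set \<Rightarrow> ('a list \<Rightarrow>\<^sub>0 'k) set" where
  "counit_at s e n i U = tensor_cls s (n - 1) (free_counit_at e i (rep U))"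

lemma counit_at_cls:
  assumes e_add: "\<And>x y. e (x + y) = e x + e y" and e_scale: "\<And>c x. e (s c x) = c * e x" and "i < n"
  shows "counit_at s e n i (tensor_cls s n u) = tensor_cls s (n - 1) (free_counit_at e i u)"
proof -
  let ?f = "\<lambda>w. Poly_Mapping.single (take i w @ drop (Suc i) w) (e (w ! i))"
  have "lin_ext free_scale ?f v \<in> tensor_null s (n - 1)" if "v \<in> tensor_null s n" for v
  proof (rule lin_ext_null[OF vector_space_free_scale subspace_tensor_null _ _ that])
    fix p q :: "'a list" and x
    assume l: "length p + 1 + length q = n"
    then have "i < length p + 1 + length q" using assms by simp
    then have "(\<forall>y. ?f (p @ [x + y] @ q) - ?f (p @ [x] @ q) - ?f (p @ [y] @ q) \<in> tensor_null s (n - 1))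
      \<and> (\<forall>c. ?f (p @ [s c x] @ q) - free_scale c (?f (p @ [x] @ q)) \<in> tensor_null s (n - 1))"
    proof (cases rule: word_position_cases)
      case (left p1 z p2)
      then show ?thesis
        using l tensor_null_add[of "p1 @ p2" q "n - 1" x _ "e z" s]
          tensor_null_scale[of "p1 @ p2" q "n - 1" s _ x "e z"] by auto
    next
      case mid
      then show ?thesis
        using free.subspace_0[OF subspace_tensor_null, of s "n - 1"]
        by (auto simp: e_add e_scale single_add)
    next
      case (right q1 z q2)
      then show ?thesis
        using l tensor_null_add[of p "q1 @ q2" "n - 1" x _ "e z" s]
          tensor_null_scale[of p "q1 @ q2" "n - 1" s _ x "e z"] by (auto simp: nth_append)
    qed
    then show "?f (p @ [x + y] @ q) - ?f (p @ [x] @ q) - ?f (p @ [y] @ q) \<in> tensor_null s (n - 1)"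
      and "?f (p @ [s c x] @ q) - free_scale c (?f (p @ [x] @ q)) \<in> tensor_null s (n - 1)" for y c
      by blast+
  qed
  from this[OF rep_tensor_cls[of s n u]] show ?thesis
    by (simp add: counit_at_def free_counit_at_def tensor_cls_eq_iff lin_ext_diff vector_space_free_scale)
qed

definition koszul :: "bit \<Rightarrow> 'r::ring_1" where
  "koszul d = (if d = 0 then 1 else - 1)"

text \<open>
  \<open>grade_decomp\<close> says that the algebra is the direct sum of \<open>G 0\<close> and \<open>G 1\<close>; ungraded algebras are
  the case \<open>G 1 = {0}\<close>.
\<close>

locale superalgebra = vector_space scale
  for scale :: "'k::field \<Rightarrow> 'a::ring_1 \<Rightarrow> 'a" +
  fixes G :: "bit \<Rightarrow> 'a set"
  assumes scale_mult_left: "scale c x * y = scale c (x * y)"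
    and scale_mult_right: "x * scale c y = scale c (x * y)"
    and grade_subspace: "subspace (G d)"
    and grade_decomp: "\<exists>!x. x \<in> G d \<and> a - x \<in> G (d + 1)"
    and grade_one: "1 \<in> G 0"
    and grade_mult: "x \<in> G d \<Longrightarrow> y \<in> G e \<Longrightarrow> x * y \<in> G (d + e)"

text \<open>The component of degree \<open>d\<close> of \<open>a\<close>.\<close>

definition hpart :: "(bit \<Rightarrow> 'a::ab_group_add set) \<Rightarrow> bit \<Rightarrow> 'a \<Rightarrow> 'a" where
  "hpart G d a = (THE x. x \<in> G d \<and> a - x \<in> G (d + 1))"

text \<open>
  Product of two words, \<open>(a\<^sub>1 \<otimes> \<dots> \<otimes> a\<^sub>n)(b\<^sub>1 \<otimes> \<dots> \<otimes> b\<^sub>n) = \<plusminus> a\<^sub>1b\<^sub>1 \<otimes> \<dots> \<otimes> a\<^sub>nb\<^sub>n\<close>: for homogeneous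
  entries, \<open>b\<^sub>j\<close> has to be moved past every \<open>a\<^sub>i\<close> with \<open>i > j\<close>; arbitrary entries are first decomposed
  into their homogeneous components.
\<close>

definition degs :: "nat \<Rightarrow> bit list set" where
  "degs n = {d. length d = n}"

definition mult_sign :: "nat \<Rightarrow> bit list \<Rightarrow> bit list \<Rightarrow> 'k::field" where
  "mult_sign n d e = koszul (\<Sum>i<n. \<Sum>j<i. d ! i * e ! j)"

definition word_mult ::
    "(bit \<Rightarrow> 'a::ring_1 set) \<Rightarrow> nat \<Rightarrow> 'a list \<Rightarrow> 'a list \<Rightarrow> ('a list \<Rightarrow>\<^sub>0 'k::field)" where
  "word_mult G n v w =
     (\<Sum>d\<in>degs n. \<Sum>e\<in>degs n.
        Poly_Mapping.single
          (map (\<lambda>i. hpart G (d ! i) (v ! i) * hpart G (e ! i) (w ! i)) [0..<n]) (mult_sign n d e))"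

definition free_mult ::
    "(bit \<Rightarrow> 'a::ring_1 set) \<Rightarrow> nat \<Rightarrow> ('a list \<Rightarrow>\<^sub>0 'k) \<Rightarrow> ('a list \<Rightarrow>\<^sub>0 'k) \<Rightarrow> ('a list \<Rightarrow>\<^sub>0 'k::field)" where
  "free_mult G n u v = lin_ext free_scale (\<lambda>p. lin_ext free_scale (\<lambda>q. word_mult G n p q) v) u"

definition tensor_mult ::
    "('k::field \<Rightarrow> 'a::ring_1 \<Rightarrow> 'a) \<Rightarrow> (bit \<Rightarrow> 'a set) \<Rightarrow> nat \<Rightarrow>
     ('a list \<Rightarrow>\<^sub>0 'k) set \<Rightarrow> ('a list \<Rightarrow>\<^sub>0 'k) set \<Rightarrow> ('a list \<Rightarrow>\<^sub>0 'k) set" where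
  "tensor_mult s G n U V = tensor_cls s n (free_mult G n (rep U) (rep V))"

context superalgebra
begin

lemma hpart_eqI: "x \<in> G d \<Longrightarrow> a - x \<in> G (d + 1) \<Longrightarrow> hpart G d a = x"
  unfolding hpart_def using grade_decomp[of d a] by (intro the1_equality) auto

lemma hpart_in: "hpart G d a \<in> G d" and hpart_compl: "a - hpart G d a \<in> G (d + 1)"
  using theI'[OF grade_decomp[of d a]] by (auto simp: hpart_def)

lemma hpart_add: "hpart G d (a + b) = hpart G d a + hpart G d b"
proof (rule hpart_eqI)
  show "hpart G d a + hpart G d b \<in> G d"
    by (intro subspace_add grade_subspace hpart_in)
  have "(a - hpart G d a) + (b - hpart G d b) \<in> G (d + 1)"
    by (intro subspace_add grade_subspace hpart_compl)
  then show "a + b - (hpart G d a + hpart G d b) \<in> G (d + 1)"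
    by (simp add: algebra_simps)
qed

lemma hpart_scale: "hpart G d (scale c a) = scale c (hpart G d a)"
proof (rule hpart_eqI)
  show "scale c (hpart G d a) \<in> G d"
    by (intro subspace_scale grade_subspace hpart_in)
  have "scale c (a - hpart G d a) \<in> G (d + 1)"
    by (intro subspace_scale grade_subspace hpart_compl)
  then show "scale c a - scale c (hpart G d a) \<in> G (d + 1)"
    by (simp add: scale_right_diff_distrib)
qed

lemma hpart_homogeneous: "a \<in> G e \<Longrightarrow> hpart G d a = (if d = e then a else 0)"
proof (rule hpart_eqI)
  assume a: "a \<in> G e"
  then show "(if d = e then a else 0) \<in> G d"
    using subspace_0[OF grade_subspace] by auto
  have "e = d + 1" if "d \<noteq> e"
    using that by (cases d; cases e) auto
  then show "a - (if d = e then a else 0) \<in> G (d + 1)"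
    using a subspace_0[OF grade_subspace] by auto
qed

lemma map_upt_split:
  assumes "length p + 1 + length q = n"
  shows "map (\<lambda>i. f i ((p @ [x] @ q) ! i)) [0..<n] =
    map (\<lambda>i. f i (p ! i)) [0..<length p] @ [f (length p) x] @
    map (\<lambda>i. f i (q ! (i - Suc (length p)))) [Suc (length p)..<n]"
proof -
  have "[0..<n] = [0..<length p] @ [length p] @ [Suc (length p)..<n]"
    using assms upt_add_eq_append[of 0 "length p" "1 + length q"] by (auto simp: upt_conv_Cons)
  then show ?thesis by (auto simp: nth_append)
qed

lemma word_mult_linear_left:
  assumes "length p + 1 + length q = n"
  shows "word_mult G n (p @ [x + y] @ q) w - word_mult G n (p @ [x] @ q) w
           - word_mult G n (p @ [y] @ q) w \<in> tensor_null scale n" (is ?add)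
    and "word_mult G n (p @ [scale c x] @ q) w - free_scale c (word_mult G n (p @ [x] @ q) w)
           \<in> tensor_null scale n" (is ?scale)
proof -
  note split = map_upt_split[OF assms, of "\<lambda>i z. hpart G (_ ! i) z * hpart G (_ ! i) (w ! i)"]
  show ?add
    unfolding word_mult_def split sum_subtractf[symmetric] hpart_add distrib_right
    by (intro free.subspace_sum subspace_tensor_null tensor_null_add) (use assms in auto)
  show ?scale
    unfolding word_mult_def split sum_subtractf[symmetric] free.scale_sum_right hpart_scale
      scale_mult_left free_scale_single
    by (intro free.subspace_sum subspace_tensor_null tensor_null_scale) (use assms in auto)
qed

lemma word_mult_linear_right:
  assumes "length p + 1 + length q = n"
  shows "word_mult G n w (p @ [x + y] @ q) - word_mult G n w (p @ [x] @ q)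
           - word_mult G n w (p @ [y] @ q) \<in> tensor_null scale n" (is ?add)
    and "word_mult G n w (p @ [scale c x] @ q) - free_scale c (word_mult G n w (p @ [x] @ q))
           \<in> tensor_null scale n" (is ?scale)
proof -
  note split = map_upt_split[OF assms, of "\<lambda>i z. hpart G (_ ! i) (w ! i) * hpart G (_ ! i) z"]
  show ?add
    unfolding word_mult_def split sum_subtractf[symmetric] hpart_add distrib_left
    by (intro free.subspace_sum subspace_tensor_null tensor_null_add) (use assms in auto)
  show ?scale
    unfolding word_mult_def split sum_subtractf[symmetric] free.scale_sum_right hpart_scale
      scale_mult_right free_scale_single
    by (intro free.subspace_sum subspace_tensor_null tensor_null_scale) (use assms in auto)
qed

lemma tensor_mult_cls:
  "tensor_mult scale G n (tensor_cls scale n u) (tensor_cls scale n v) =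
     tensor_cls scale n (free_mult G n u v)"
proof -
  have left: "free_mult G n u v \<in> tensor_null scale n" if "u \<in> tensor_null scale n" for u v
    unfolding free_mult_def
  proof (rule lin_ext_null[OF vector_space_free_scale subspace_tensor_null _ _ that])
    let ?f = "\<lambda>p. lin_ext free_scale (word_mult G n p) v"
    fix p q :: "'a list" and x y c assume l: "length p + 1 + length q = n"
    show "?f (p @ [x + y] @ q) - ?f (p @ [x] @ q) - ?f (p @ [y] @ q) \<in> tensor_null scale n"
      unfolding lin_ext_fun_diff[OF vector_space_free_scale, symmetric]
      by (intro lin_ext_in_subspace vector_space_free_scale subspace_tensor_null
          word_mult_linear_left l)
    show "?f (p @ [scale c x] @ q) - free_scale c (?f (p @ [x] @ q)) \<in> tensor_null scale n"
      unfolding lin_ext_fun_diff[OF vector_space_free_scale, symmetric]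
        lin_ext_fun_scale[OF vector_space_free_scale, symmetric]
      by (intro lin_ext_in_subspace vector_space_free_scale subspace_tensor_null
          word_mult_linear_left l)
  qed
  have right: "free_mult G n u v \<in> tensor_null scale n" if "v \<in> tensor_null scale n" for u v
    unfolding free_mult_def
    by (intro lin_ext_in_subspace vector_space_free_scale subspace_tensor_null
        lin_ext_null[OF vector_space_free_scale subspace_tensor_null _ _ that]
        word_mult_linear_right)
  let ?u = "rep (tensor_cls scale n u)" and ?v = "rep (tensor_cls scale n v)"
  have "free_mult G n (?u - u) ?v + free_mult G n u (?v - v) \<in> tensor_null scale n"
    by (intro free.subspace_add subspace_tensor_null left right rep_tensor_cls)
  then show ?thesis
    by (simp add: tensor_mult_def tensor_cls_eq_iff free_mult_def lin_ext_diff
        lin_ext_fun_diff[OF vector_space_free_scale] vector_space_free_scale)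
qed

lemma single_zero_entry:
  assumes "0 \<in> set w"
  shows "Poly_Mapping.single w c \<in> tensor_null scale (length w)"
proof -
  obtain p q where w: "w = p @ [0] @ q" using split_list[OF assms] by auto
  then show ?thesis using tensor_null_scale[of p q "length w" scale 0 0 c] by simp
qed

lemma tensor_mult_pure:
  assumes "list_all2 (\<lambda>x d. x \<in> G d) v ds" "list_all2 (\<lambda>x e. x \<in> G e) w es"
    and "length v = n" "length w = n"
  shows "tensor_mult scale G n (pure_tensor scale v) (pure_tensor scale w) =
    tensor_scale scale n (mult_sign n ds es) (pure_tensor scale (map2 (*) v w))"
proof -
  let ?t = "\<lambda>d e. Poly_Mapping.single
          (map (\<lambda>i. hpart G (d ! i) (v ! i) * hpart G (e ! i) (w ! i)) [0..<n]) (mult_sign n d e) :: _ \<Rightarrow>\<^sub>0 'k"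
  let ?m = "Poly_Mapping.single (map2 (*) v w) (mult_sign n ds es) :: _ \<Rightarrow>\<^sub>0 'k"
  have "(UNIV :: bit set) = {0, 1}"
    using bit.exhaust by auto
  then have "finite (UNIV :: bit set)"
    by (metis finite.emptyI finite_insert)
  then have fin: "finite (degs n)"
    using finite_lists_length_eq[of "UNIV :: bit set" n] by (simp add: degs_def)
  have ds: "length ds = n" "length es = n" "ds \<in> degs n" "es \<in> degs n"
    and v: "\<And>i. i < n \<Longrightarrow> v ! i \<in> G (ds ! i)" and w: "\<And>i. i < n \<Longrightarrow> w ! i \<in> G (es ! i)"
    using assms by (auto simp: list_all2_conv_all_nth degs_def)
  have t: "?t d e - (if d = ds then if e = es then ?m else 0 else 0) \<in> tensor_null scale n"
    if de: "d \<in> degs n" "e \<in> degs n" for d e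
  proof (cases "d = ds \<and> e = es")
    case True
    have "map (\<lambda>i. hpart G (ds ! i) (v ! i) * hpart G (es ! i) (w ! i)) [0..<n] = map2 (*) v w"
      using assms(3,4)
      by (intro nth_equalityI) (simp_all add: hpart_homogeneous[OF v] hpart_homogeneous[OF w])
    then show ?thesis using True free.subspace_0[OF subspace_tensor_null] by simp
  next
    case False
    then obtain i where i: "i < n" "d ! i \<noteq> ds ! i \<or> e ! i \<noteq> es ! i"
      using de[unfolded degs_def] ds(1,2) by (auto simp: list_eq_iff_nth_eq)
    then have "hpart G (d ! i) (v ! i) * hpart G (e ! i) (w ! i) = 0"
      by (auto simp: hpart_homogeneous[OF v] hpart_homogeneous[OF w])
    then have "0 \<in> set (map (\<lambda>i. hpart G (d ! i) (v ! i) * hpart G (e ! i) (w ! i)) [0..<n])"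
      using i(1) by (force simp: image_iff)
    from single_zero_entry[OF this] show ?thesis using False by auto
  qed
  have "word_mult G n v w - ?m =
      (\<Sum>d\<in>degs n. \<Sum>e\<in>degs n. ?t d e - (if d = ds then if e = es then ?m else 0 else 0))"
  proof -
    have "(\<Sum>d\<in>degs n. \<Sum>e\<in>degs n. (if d = ds then if e = es then ?m else 0 else 0)) = ?m"
    proof -
      have "(\<Sum>e\<in>degs n. (if d = ds then if e = es then ?m else 0 else 0)) =
          (if d = ds then ?m else 0)" for d
        using fin ds by simp
      then show ?thesis using fin ds by simp
    qed
    then show ?thesis by (simp add: word_mult_def sum_subtractf)
  qed
  also have "\<dots> \<in> tensor_null scale n"
    by (intro free.subspace_sum subspace_tensor_null t)
  finally show ?thesis
    using assms(3,4)
    by (simp add: pure_tensor_def tensor_mult_cls tensor_scale_cls tensor_cls_eq_iff free_mult_def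
        lin_ext_single vector_space_free_scale)
qed

end

definition tensor_one :: "('k::field \<Rightarrow> 'a::ring_1 \<Rightarrow> 'a) \<Rightarrow> nat \<Rightarrow> ('a list \<Rightarrow>\<^sub>0 'k) set" where
  "tensor_one s n = pure_tensor s (replicate n 1)"

definition tensor_grade ::
    "('k::field \<Rightarrow> 'a::ring_1 \<Rightarrow> 'a) \<Rightarrow> (bit \<Rightarrow> 'a set) \<Rightarrow> nat \<Rightarrow> bit \<Rightarrow> ('a list \<Rightarrow>\<^sub>0 'k) set set" where
  "tensor_grade s G n d =
     tensor_cls s n ` {u. \<forall>w\<in>Poly_Mapping.keys u.
        length w = n \<and> (\<exists>ds. list_all2 (\<lambda>x e. x \<in> G e) w ds \<and> sum_list ds = d)}"

text \<open>
  \<open>\<Phi>inv\<close> is determined by \<open>\<Phi>\<close> as its two-sided inverse. The first tensor power is identified with the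
  algebra via \<open>a \<mapsto> pure_tensor scale [a]\<close>. The class \<open>ring_1\<close> excludes only the zero ring, on which
  there is no unital \<open>\<epsilon>\<close>.
\<close>

locale quasi_hopf_superalgebra = superalgebra scale G
  for scale :: "'k::field \<Rightarrow> 'a::ring_1 \<Rightarrow> 'a" and G :: "bit \<Rightarrow> 'a set" +
  fixes \<Delta> :: "'a \<Rightarrow> ('a list \<Rightarrow>\<^sub>0 'k) set"
    and \<epsilon> :: "'a \<Rightarrow> 'k"
    and \<Phi> \<Phi>inv :: "('a list \<Rightarrow>\<^sub>0 'k) set"
    and S :: "'a \<Rightarrow> 'a"
    and \<alpha> \<beta> :: 'a
  assumes counit_add: "\<epsilon> (a + b) = \<epsilon> a + \<epsilon> b"
    and counit_scale: "\<epsilon> (scale c a) = c * \<epsilon> a"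
    and counit_mult: "\<epsilon> (a * b) = \<epsilon> a * \<epsilon> b"
    and counit_one: "\<epsilon> 1 = 1"
    and counit_grade: "a \<in> G 1 \<Longrightarrow> \<epsilon> a = 0"
    and comult_in: "\<Delta> a \<in> tensor_power scale 2"
    and comult_add: "\<Delta> (a + b) = tensor_add scale 2 (\<Delta> a) (\<Delta> b)"
    and comult_scale: "\<Delta> (scale c a) = tensor_scale scale 2 c (\<Delta> a)"
    and comult_mult: "\<Delta> (a * b) = tensor_mult scale G 2 (\<Delta> a) (\<Delta> b)"
    and comult_one: "\<Delta> 1 = tensor_one scale 2"
    and comult_grade: "a \<in> G d \<Longrightarrow> \<Delta> a \<in> tensor_grade scale G 2 d"
    and Phi_in: "\<Phi> \<in> tensor_power scale 3"
    and Phi_homogeneous: "\<exists>d. \<Phi> \<in> tensor_grade scale G 3 d"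
    and Phiinv_in: "\<Phi>inv \<in> tensor_power scale 3"
    and Phi_Phiinv: "tensor_mult scale G 3 \<Phi> \<Phi>inv = tensor_one scale 3"
    and Phiinv_Phi: "tensor_mult scale G 3 \<Phi>inv \<Phi> = tensor_one scale 3"
    and antipode_add: "S (a + b) = S a + S b"
    and antipode_scale: "S (scale c a) = scale c (S a)"
    and antipode_one: "S 1 = 1"
    and antipode_mult: "a \<in> G d \<Longrightarrow> b \<in> G e \<Longrightarrow> S (a * b) = koszul (d * e) * (S b * S a)"
    and antipode_grade: "a \<in> G d \<Longrightarrow> S a \<in> G d"
    and alpha_homogeneous: "\<exists>d. \<alpha> \<in> G d"
    and beta_homogeneous: "\<exists>d. \<beta> \<in> G d"
    and quasi_coassoc:
      "comult_at scale \<Delta> 2 1 (\<Delta> a) =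
         tensor_mult scale G 3 (tensor_mult scale G 3 \<Phi>inv (comult_at scale \<Delta> 2 0 (\<Delta> a))) \<Phi>"
    and pentagon:
      "tensor_mult scale G 4 (comult_at scale \<Delta> 3 0 \<Phi>) (comult_at scale \<Delta> 3 2 \<Phi>) =
         tensor_mult scale G 4
           (tensor_mult scale G 4
              (tensor_cat scale 3 1 \<Phi> (pure_tensor scale [1])) (comult_at scale \<Delta> 3 1 \<Phi>))
           (tensor_cat scale 1 3 (pure_tensor scale [1]) \<Phi>)"
    and counit_left: "counit_at scale \<epsilon> 2 0 (\<Delta> a) = pure_tensor scale [a]"
    and counit_right: "counit_at scale \<epsilon> 2 1 (\<Delta> a) = pure_tensor scale [a]"
    and counit_Phi: "counit_at scale \<epsilon> 3 1 \<Phi> = tensor_one scale 2"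
    and antipode_alpha:
      "tensor_sum scale (\<lambda>w. S (w ! 0) * \<alpha> * w ! 1) (\<Delta> a) = scale (\<epsilon> a) \<alpha>"
    and antipode_beta:
      "tensor_sum scale (\<lambda>w. w ! 0 * \<beta> * S (w ! 1)) (\<Delta> a) = scale (\<epsilon> a) \<beta>"
    and antipode_Phiinv:
      "tensor_sum scale (\<lambda>w. w ! 0 * \<beta> * S (w ! 1) * \<alpha> * w ! 2) \<Phi>inv = 1"
    and antipode_Phi:
      "tensor_sum scale (\<lambda>w. S (w ! 0) * \<alpha> * w ! 1 * \<beta> * S (w ! 2)) \<Phi> = 1"

text \<open>\<open>\<Sum> (-1)\<^bsup>[c][a\<^sub>1]\<^esup> S(a\<^sub>1) c a\<^sub>2 = \<epsilon>(a) c\<close>, extended linearly to non-homogeneous \<open>c\<close> and \<open>a\<^sub>1\<close>.\<close>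

definition pseudo_invariant ::
    "('k::field \<Rightarrow> 'a::ring_1 \<Rightarrow> 'a) \<Rightarrow> (bit \<Rightarrow> 'a set) \<Rightarrow> ('a \<Rightarrow> ('a list \<Rightarrow>\<^sub>0 'k) set) \<Rightarrow>
     ('a \<Rightarrow> 'k) \<Rightarrow> ('a \<Rightarrow> 'a) \<Rightarrow> 'a \<Rightarrow> bool" where
  "pseudo_invariant s G \<Delta> \<epsilon> S c \<longleftrightarrow>
     (\<forall>a. tensor_sum s
            (\<lambda>w. \<Sum>d\<in>{0, 1}. \<Sum>e\<in>{0, 1}.
               koszul (d * e) * (S (hpart G e (w ! 0)) * hpart G d c * w ! 1)) (\<Delta> a)
          = s (\<epsilon> a) c)"

end

theory Submission
  imports Defs
begin

text \<open>
  Write \<open>D = \<Sum> Xb \<beta> S(Yb) c\<^sub>2 Zb\<close> with \<open>\<Phi>\<inverse> = \<Sum> Xb \<otimes> Yb \<otimes> Zb\<close>. Three facts about \<open>D\<close> give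
  everything.

  First, \<open>D\<close> is central. Quasi-coassociativity says \<open>\<Phi>\<inverse> (\<Delta> \<otimes> 1)\<Delta>(a) = (1 \<otimes> \<Delta>)\<Delta>(a) \<Phi>\<inverse>\<close>. Under the
  linear map \<open>x \<otimes> y \<otimes> z \<mapsto> x \<beta> S(y) c\<^sub>2 z\<close> the left side becomes \<open>D a\<close>, since
  \<open>a\<^sub>1 \<beta> S(a\<^sub>2) = \<epsilon>(a) \<beta>\<close>, and the right side becomes \<open>a D\<close>, since \<open>c\<^sub>2\<close> is pseudo-invariant
  (\<open>central_form_Phiinv_central\<close>). The analogous computation with \<open>\<Phi>\<close> and
  \<open>x \<otimes> y \<otimes> z \<mapsto> S(x) c\<^sub>2 y \<beta> S(z)\<close> would only show that \<open>C\<^sub>2\<close> commutes with the image of \<open>S\<close>, and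
  \<open>S\<close> need not be surjective.

  Second, \<open>\<alpha> D = c\<^sub>2\<close>. Write the pentagon identity as
  \<open>(\<Delta> \<otimes> 1 \<otimes> 1)\<Phi> \<cdot> (1 \<otimes> 1 \<otimes> \<Delta>)\<Phi> \<cdot> (1 \<otimes> \<Phi>\<inverse>) = (\<Phi> \<otimes> 1) \<cdot> (1 \<otimes> \<Delta> \<otimes> 1)\<Phi>\<close> and apply
  \<open>x \<otimes> y \<otimes> z \<otimes> w \<mapsto> S(x) \<alpha> y \<beta> S(z) c\<^sub>2 w\<close>. This map cannot see the factors \<open>(\<Delta> \<otimes> 1 \<otimes> 1)\<Phi>\<close> and
  \<open>(1 \<otimes> 1 \<otimes> \<Delta>)\<Phi>\<close> on the left, so the left side is \<open>\<alpha> D\<close>; nor can it see \<open>(1 \<otimes> \<Delta> \<otimes> 1)\<Phi>\<close> on the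
  right, so the right side is \<open>(\<Sum> S(X) \<alpha> Y \<beta> S(Z)) c\<^sub>2 = c\<^sub>2\<close> (\<open>alpha_central_form_Phiinv\<close>).

  Third, \<open>C\<^sub>2 = \<Sum> S(X) \<alpha> D Y \<beta> S(Z) = D \<Sum> S(X) \<alpha> Y \<beta> S(Z) = D\<close>, because \<open>D\<close> is central.

  The second step needs \<open>(\<epsilon> \<otimes> 1 \<otimes> 1)\<Phi> = 1\<close> and \<open>(1 \<otimes> 1 \<otimes> \<epsilon>)\<Phi> = 1\<close>, in the weak form
  \<open>\<Sum> \<epsilon>(X) S(Y) m Z = m\<close> and \<open>\<Sum> \<epsilon>(Z) S(X) m Y = m\<close> (\<open>left_counit_Phi\<close>, \<open>right_counit_Phi\<close>). Both
  come from the same form of the pentagon identity, with two of the four factors paired with \<open>\<epsilon>\<close>.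

  Koszul signs. All sums run over representatives whose words have homogeneous entries. When a
  coproduct is absorbed, the signs produced by the tensor product and by \<open>S\<close> combine to \<open>(-1)\<close> to
  the power \<open>[a] t\<close>, where \<open>a\<close> is the element whose coproduct disappears and leaves the scalar
  \<open>\<epsilon>(a)\<close> behind; as \<open>\<epsilon>\<close> kills odd elements, the sign disappears with it (\<open>coproduct_absorbed\<close>).
  The only other input is that \<open>\<Phi>\<close> is even (\<open>Phi_even\<close>).
\<close>

section \<open>Linear extensions and multilinear maps\<close>

lemma lin_ext_cong:
  "(\<And>w. w \<in> Poly_Mapping.keys u \<Longrightarrow> f w = g w) \<Longrightarrow> lin_ext s f u = lin_ext s g u"
  unfolding lin_ext_def by (rule sum.cong) auto

lemma lin_ext_lin_ext:
  assumes "vector_space s"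
  shows "lin_ext s f (lin_ext free_scale g u) = lin_ext s (\<lambda>w. lin_ext s f (g w)) u"
proof -
  interpret L: Vector_Spaces.linear free_scale s "lin_ext s f"
    by (rule linear_lin_ext[OF assms])
  show ?thesis
    by (simp add: lin_ext_def[of free_scale] lin_ext_def[of s _ u] L.sum L.scale)
qed

lemma lin_ext_swap:
  assumes "vector_space s"
  shows "lin_ext s (\<lambda>p. lin_ext s (\<lambda>q. f p q) v) u = lin_ext s (\<lambda>q. lin_ext s (\<lambda>p. f p q) u) v"
proof -
  interpret vector_space s by fact
  show ?thesis
    unfolding lin_ext_def scale_sum_right
    by (subst sum.swap) (simp add: mult.commute)
qed

lemma lin_ext_single_id: "lin_ext free_scale (\<lambda>w. Poly_Mapping.single w 1) u = u"
  by (rule poly_mapping_eqI)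
     (simp add: lin_ext_def lookup_sum lookup_single when_def in_keys_iff sum.delta')

text \<open>
  Updating one entry of a word of length \<open>n\<close> covers all contexts \<open>p @ [x] @ q\<close> at once, and after
  the substitution the simplifier can evaluate the entries of the word.
\<close>

lemma multilinear_wordsI:
  assumes "\<And>i w x y. i < n \<Longrightarrow> length w = n \<Longrightarrow> f (w[i := x + y]) = f (w[i := x]) + f (w[i := y])"
    and "\<And>i w c x. i < n \<Longrightarrow> length w = n \<Longrightarrow> f (w[i := s c x]) = s c (f (w[i := x]))"
  shows "multilinear_words s n f"
  unfolding multilinear_words_def
proof (intro allI impI)
  fix p q :: "'a list" and x y c
  assume "length p + 1 + length q = n"
  then show "f (p @ [x + y] @ q) = f (p @ [x] @ q) + f (p @ [y] @ q) \<and>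
        f (p @ [s c x] @ q) = s c (f (p @ [x] @ q))"
    using assms(1)[of "length p" "p @ [x] @ q" x y] assms(2)[of "length p" "p @ [x] @ q" c x] by simp
qed

lemma koszul_add: "koszul (a + b) = (koszul a * koszul b :: 'r::ring_1)"
  by (cases a; cases b) (auto simp: koszul_def)

lemma koszul_0 [simp]: "koszul 0 = 1"
  by (simp add: koszul_def)

text \<open>
  Parities are added and multiplied as elements of the field with two elements, so these
  operations have to stay visible to the ring laws instead of being turned into bit operations.
\<close>

declare add_bit_eq_xor [simp del] mult_bit_eq_and [simp del]

lemma bit_add_self [simp]: "(x::bit) + x = 0"
  by (cases x) auto

lemma bit_add_left_self [simp]: "(x::bit) + (x + y) = y"
  by (cases x; cases y) auto

context superalgebra
begin

abbreviation sweedler :: "('a list \<Rightarrow> 'a) \<Rightarrow> ('a list \<Rightarrow>\<^sub>0 'k) \<Rightarrow> 'a" where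
  "sweedler \<equiv> lin_ext scale"

abbreviation cls :: "nat \<Rightarrow> ('a list \<Rightarrow>\<^sub>0 'k) \<Rightarrow> ('a list \<Rightarrow>\<^sub>0 'k) set" where
  "cls \<equiv> tensor_cls scale"

lemmas vector_space_scale = vector_space_axioms
lemmas tensor_sum_rep = tensor_sum_cls[OF vector_space_scale]
lemmas sweedler_single = lin_ext_single[OF vector_space_scale]
lemmas sweedler_lin_ext = lin_ext_lin_ext[OF vector_space_scale]
lemmas sweedler_scale = lin_ext_fun_scale[OF vector_space_scale]
lemmas sweedler_swap = lin_ext_swap[OF vector_space_scale]

section \<open>Homogeneous representatives of tensors\<close>

definition homogeneous :: "'a \<Rightarrow> bool" where
  "homogeneous x \<longleftrightarrow> (\<exists>d. x \<in> G d)"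

text \<open>
  As \<open>0\<close> lies in both degrees, parity is additive only on products that do not vanish.
\<close>

definition parity :: "'a \<Rightarrow> bit" where
  "parity x = (if x \<in> G 0 then 0 else 1)"

lemma in_parity: "homogeneous x \<Longrightarrow> x \<in> G (parity x)"
proof -
  assume "homogeneous x"
  then obtain d where "x \<in> G d" by (auto simp: homogeneous_def)
  then show ?thesis by (cases d) (auto simp: parity_def)
qed

lemma parity_eq:
  assumes "x \<in> G d" "x \<noteq> 0"
  shows "parity x = d"
proof -
  have "x \<in> G (parity x)"
    using assms(1) in_parity by (auto simp: homogeneous_def)
  then show ?thesis
    using hpart_homogeneous[of x d d] hpart_homogeneous[of x "parity x" d] assms
    by (auto split: if_splits)
qed

lemma homogeneousI: "x \<in> G d \<Longrightarrow> homogeneous x"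
  by (auto simp: homogeneous_def)

lemma homogeneous_mult: "homogeneous x \<Longrightarrow> homogeneous y \<Longrightarrow> homogeneous (x * y)"
  unfolding homogeneous_def using grade_mult by blast

lemma homogeneous_one [simp]: "homogeneous 1" and parity_one [simp]: "parity 1 = 0"
  using grade_one by (auto simp: homogeneous_def parity_def)

lemma hpart_sum: "hpart G 0 x + hpart G 1 x = x"
  using hpart_eqI[of "x - hpart G 0 x" 1 x] hpart_compl[of x 0] hpart_in[of 0 x] by simp

definition homogeneous_words :: "nat \<Rightarrow> ('a list \<Rightarrow>\<^sub>0 'k) set" where
  "homogeneous_words n = {u. \<forall>w\<in>Poly_Mapping.keys u. length w = n \<and> (\<forall>x\<in>set w. homogeneous x)}"

definition graded_words :: "nat \<Rightarrow> bit \<Rightarrow> ('a list \<Rightarrow>\<^sub>0 'k) set" where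
  "graded_words n d =
     {u \<in> homogeneous_words n. \<forall>w\<in>Poly_Mapping.keys u. sum_list (map parity w) = d}"

lemma subspace_homogeneous_words: "free.subspace (homogeneous_words n)"
proof (rule free.subspaceI)
  show "u + v \<in> homogeneous_words n" if "u \<in> homogeneous_words n" "v \<in> homogeneous_words n" for u v
    using that keys_add[of u v] by (auto simp: homogeneous_words_def)
qed (auto simp: homogeneous_words_def in_keys_iff)

lemma subspace_graded_words: "free.subspace (graded_words n d)"
proof (rule free.subspaceI)
  show "u + v \<in> graded_words n d" if "u \<in> graded_words n d" "v \<in> graded_words n d" for u v
    using that keys_add[of u v] by (auto simp: graded_words_def homogeneous_words_def)
qed (auto simp: graded_words_def homogeneous_words_def in_keys_iff)

lemma single_homogeneous_words:
  "length w = n \<Longrightarrow> (\<And>x. x \<in> set w \<Longrightarrow> homogeneous x) \<Longrightarrow> Poly_Mapping.single w c \<in> homogeneous_words n"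
  by (auto simp: homogeneous_words_def)

lemma homogeneous_words_words: "u \<in> homogeneous_words n \<Longrightarrow> u \<in> words n"
  by (auto simp: homogeneous_words_def words_def)

lemma graded_words_homogeneous: "u \<in> graded_words n d \<Longrightarrow> u \<in> homogeneous_words n"
  by (auto simp: graded_words_def)

text \<open>
  Split the entries of \<open>w\<close> into their homogeneous components one after the other; \<open>p\<close> is the part
  that has already been split.
\<close>

lemma single_homogeneous_decomp:
  assumes "\<forall>x\<in>set p. homogeneous x"
  shows "\<exists>v\<in>homogeneous_words (length (p @ w)).
     Poly_Mapping.single (p @ w) c - v \<in> tensor_null scale (length (p @ w))"
  using assms
proof (induction w arbitrary: p)
  case Nil
  then show ?case
    by (intro bexI[of _ "Poly_Mapping.single p c"])
       (auto simp: free.subspace_0[OF subspace_tensor_null] intro: single_homogeneous_words)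
next
  case (Cons x w)
  let ?n = "length (p @ x # w)"
  have h: "homogeneous (hpart G d x)" for d
    using hpart_in homogeneousI by blast
  have "\<exists>v\<in>homogeneous_words ?n.
      Poly_Mapping.single (p @ [hpart G d x] @ w) c - v \<in> tensor_null scale ?n" for d
    using Cons.IH[of "p @ [hpart G d x]"] Cons.prems h[of d] by auto
  then obtain v where v: "\<And>d. v d \<in> homogeneous_words ?n"
     "\<And>d. Poly_Mapping.single (p @ [hpart G d x] @ w) c - v d \<in> tensor_null scale ?n"
    by metis
  have "Poly_Mapping.single (p @ [hpart G 0 x + hpart G 1 x] @ w) c
      - Poly_Mapping.single (p @ [hpart G 0 x] @ w) c - Poly_Mapping.single (p @ [hpart G 1 x] @ w) c
      \<in> tensor_null scale ?n"
    by (rule tensor_null_add) simp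
  from free.subspace_add[OF subspace_tensor_null this
      free.subspace_add[OF subspace_tensor_null v(2)[of 0] v(2)[of 1]]]
  have "Poly_Mapping.single (p @ x # w) c - (v 0 + v 1) \<in> tensor_null scale ?n"
    by (simp only: hpart_sum) (simp add: algebra_simps)
  then show ?case
    using free.subspace_add[OF subspace_homogeneous_words v(1)[of 0] v(1)[of 1]] by blast
qed

lemma tensor_power_homogeneous:
  assumes "U \<in> tensor_power scale n"
  obtains u where "u \<in> homogeneous_words n" "U = cls n u"
proof -
  obtain u where u: "u \<in> words n" "U = cls n u"
    using assms by (auto simp: tensor_power_def)
  have "\<exists>v\<in>homogeneous_words (length w). Poly_Mapping.single w 1 - v \<in> tensor_null scale (length w)"
    for w
    using single_homogeneous_decomp[of "[]" w 1] by simp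
  then obtain h where h: "\<And>w. h w \<in> homogeneous_words (length w)"
     "\<And>w. Poly_Mapping.single w 1 - h w \<in> tensor_null scale (length w)"
    by metis
  let ?v = "lin_ext free_scale h u"
  have "lin_ext free_scale (\<lambda>w. Poly_Mapping.single w 1 - h w) u \<in> tensor_null scale n"
    using u(1) h(2)
    by (intro lin_ext_in_subspace vector_space_free_scale subspace_tensor_null) (auto simp: words_def)
  then have "U = cls n ?v"
    unfolding u(2) tensor_cls_eq_iff lin_ext_fun_diff[OF vector_space_free_scale] lin_ext_single_id .
  moreover have "?v \<in> homogeneous_words n"
    using u(1) h(1)
    by (intro lin_ext_in_subspace vector_space_free_scale subspace_homogeneous_words)
      (auto simp: words_def)
  ultimately show thesis using that by blast
qed

text \<open>
  The degrees that witness membership in a graded component may differ from the parities only at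
  entries \<open>0\<close>, and words with such an entry represent the zero tensor and can be dropped.
\<close>

lemma tensor_grade_graded:
  assumes "U \<in> tensor_grade scale G n d"
  obtains u where "u \<in> graded_words n d" "U = cls n u"
proof -
  obtain u where u: "U = cls n u" and k: "\<And>w. w \<in> Poly_Mapping.keys u \<Longrightarrow>
        length w = n \<and> (\<exists>ds. list_all2 (\<lambda>x e. x \<in> G e) w ds \<and> sum_list ds = d)"
    using assms by (auto simp: tensor_grade_def)
  let ?h = "\<lambda>w. if 0 \<in> set w then 0 else Poly_Mapping.single w 1 :: _ \<Rightarrow>\<^sub>0 'k"
  have "lin_ext free_scale (\<lambda>w. Poly_Mapping.single w 1 - ?h w) u \<in> tensor_null scale n"
    using k single_zero_entry free.subspace_0[OF subspace_tensor_null]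
    by (intro lin_ext_in_subspace vector_space_free_scale subspace_tensor_null) auto
  then have "U = cls n (lin_ext free_scale ?h u)"
    unfolding u tensor_cls_eq_iff lin_ext_fun_diff[OF vector_space_free_scale] lin_ext_single_id .
  moreover have "lin_ext free_scale ?h u \<in> graded_words n d"
  proof (intro lin_ext_in_subspace vector_space_free_scale subspace_graded_words)
    fix w assume "w \<in> Poly_Mapping.keys u"
    then obtain ds where ds: "length w = n" "list_all2 (\<lambda>x e. x \<in> G e) w ds" "sum_list ds = d"
      using k by blast
    show "?h w \<in> graded_words n d"
    proof (cases "0 \<in> set w")
      case False
      then have "map parity w = ds"
        using ds(2) by (intro nth_equalityI) (auto simp: list_all2_conv_all_nth in_set_conv_nth
          intro!: parity_eq)
      moreover have "homogeneous x" if "x \<in> set w" for x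
        using that ds(2) by (auto simp: list_all2_conv_all_nth in_set_conv_nth homogeneous_def)
      ultimately show ?thesis using ds False by (auto simp: graded_words_def homogeneous_words_def)
    qed (simp add: free.subspace_0[OF subspace_graded_words])
  qed
  ultimately show thesis using that by blast
qed

lemma homogeneous_list: "(\<And>x. x \<in> set w \<Longrightarrow> homogeneous x) \<Longrightarrow> list_all2 (\<lambda>x d. x \<in> G d) w (map parity w)"
  by (auto simp: list_all2_conv_all_nth intro!: in_parity)

section \<open>The algebra structure of tensor powers\<close>

definition word_prod :: "nat \<Rightarrow> 'a list \<Rightarrow> 'a list \<Rightarrow> ('a list \<Rightarrow>\<^sub>0 'k)" where
  "word_prod n v w = Poly_Mapping.single (map2 (*) v w) (mult_sign n (map parity v) (map parity w))"

text \<open>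
  On homogeneous words the sum over all degrees in the definition of the product has only one
  non-zero summand.
\<close>

lemma tensor_mult_homogeneous:
  assumes "u \<in> homogeneous_words n" "v \<in> homogeneous_words n"
  shows "tensor_mult scale G n (cls n u) (cls n v) =
    cls n (lin_ext free_scale (\<lambda>p. lin_ext free_scale (word_prod n p) v) u)"
proof -
  have "word_mult G n p q - word_prod n p q \<in> tensor_null scale n"
    if "p \<in> Poly_Mapping.keys u" "q \<in> Poly_Mapping.keys v" for p q
  proof -
    have l: "length p = n" "length q = n" and h: "\<And>x. x \<in> set p \<Longrightarrow> homogeneous x"
      "\<And>x. x \<in> set q \<Longrightarrow> homogeneous x"
      using that assms by (auto simp: homogeneous_words_def)
    have "tensor_mult scale G n (pure_tensor scale p) (pure_tensor scale q) =
      tensor_scale scale n (mult_sign n (map parity p) (map parity q))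
        (pure_tensor scale (map2 (*) p q))"
      by (intro tensor_mult_pure homogeneous_list h l)
    then show ?thesis
      by (simp add: pure_tensor_def tensor_mult_cls l tensor_scale_cls tensor_cls_eq_iff word_prod_def
        free_mult_def lin_ext_single vector_space_free_scale)
  qed
  then have "lin_ext free_scale (\<lambda>p. lin_ext free_scale (\<lambda>q. word_mult G n p q - word_prod n p q) v) u
      \<in> tensor_null scale n"
    by (intro lin_ext_in_subspace vector_space_free_scale subspace_tensor_null)
  then show ?thesis
    by (simp add: tensor_mult_cls tensor_cls_eq_iff free_mult_def
      lin_ext_fun_diff[OF vector_space_free_scale])
qed

lemma word_prod_homogeneous:
  assumes "length p = n" "length q = n" "\<And>x. x \<in> set p \<union> set q \<Longrightarrow> homogeneous x"
  shows "word_prod n p q \<in> homogeneous_words n"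
  unfolding word_prod_def using assms
  by (intro single_homogeneous_words) (auto simp: set_zip intro!: homogeneous_mult)

lemma tensor_mult_in:
  assumes "U \<in> tensor_power scale n" "V \<in> tensor_power scale n"
  shows "tensor_mult scale G n U V \<in> tensor_power scale n"
proof -
  obtain u v where uv: "u \<in> homogeneous_words n" "U = cls n u" "v \<in> homogeneous_words n" "V = cls n v"
    using assms tensor_power_homogeneous by metis
  have "lin_ext free_scale (\<lambda>p. lin_ext free_scale (word_prod n p) v) u \<in> homogeneous_words n"
    using uv by (intro lin_ext_in_subspace vector_space_free_scale subspace_homogeneous_words
        word_prod_homogeneous) (auto simp: homogeneous_words_def)
  then show ?thesis
    by (auto simp: uv tensor_mult_homogeneous tensor_power_def intro: homogeneous_words_words)
qed

lemma tensor_sum_mult: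
  assumes "u \<in> homogeneous_words n" "v \<in> homogeneous_words n" "multilinear_words scale n f"
  shows "tensor_sum scale f (tensor_mult scale G n (cls n u) (cls n v)) =
    sweedler (\<lambda>p. sweedler (\<lambda>q. scale (mult_sign n (map parity p) (map parity q))
      (f (map2 (*) p q))) v) u"
  by (simp add: tensor_mult_homogeneous assms tensor_sum_rep sweedler_lin_ext word_prod_def
     sweedler_single)

text \<open>
  Together with its mirror image below, this bimultiplicativity makes the sign a 2-cocycle, whence
  the associativity of the product.
\<close>

lemma mult_sign_add_left: "length d = n \<Longrightarrow> length e = n \<Longrightarrow>
   mult_sign n (map2 (+) d e) h = (mult_sign n d h * mult_sign n e h :: 'k)"
  unfolding mult_sign_def koszul_add[symmetric] sum.distrib[symmetric] distrib_right[symmetric]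
  by (intro arg_cong[where f = koszul] sum.cong) auto

lemma mult_sign_add_right: "length d = n \<Longrightarrow> length e = n \<Longrightarrow>
   mult_sign n h (map2 (+) d e) = (mult_sign n h d * mult_sign n h e :: 'k)"
  unfolding mult_sign_def koszul_add[symmetric] sum.distrib[symmetric] distrib_left[symmetric]
  by (intro arg_cong[where f = koszul] sum.cong) auto

lemma mult_sign_zero_right: "mult_sign n d (replicate n 0) = (1 :: 'k)"
  by (simp add: mult_sign_def)

lemma list_all2_mult:
  assumes "list_all2 (\<lambda>x d. x \<in> G d) v ds" "list_all2 (\<lambda>x d. x \<in> G d) w es" "length v = n" "length w = n"
  shows "list_all2 (\<lambda>x d. x \<in> G d) (map2 (*) v w) (map2 (+) ds es)"
  using assms by (auto simp: list_all2_conv_all_nth intro!: grade_mult)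

lemma tensor_mult_scale_left:
  "tensor_mult scale G n (tensor_scale scale n c (cls n u)) (cls n v) =
     tensor_scale scale n c (tensor_mult scale G n (cls n u) (cls n v))"
  by (simp add: tensor_scale_cls tensor_mult_cls free_mult_def lin_ext_scale vector_space_free_scale)

lemma tensor_mult_scale_right:
  "tensor_mult scale G n (cls n u) (tensor_scale scale n c (cls n v)) =
     tensor_scale scale n c (tensor_mult scale G n (cls n u) (cls n v))"
  by (simp add: tensor_scale_cls tensor_mult_cls free_mult_def lin_ext_scale vector_space_free_scale
     lin_ext_fun_scale[OF vector_space_free_scale])

text \<open>
  The degrees of a product are taken to be the sums of the degrees of the factors. The parity
  function would not be additive here, as a product of homogeneous elements can be zero.
\<close>

lemma tensor_mult_assoc_pure:
  assumes l: "length p = n" "length q = n" "length r = n"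
    and h: "\<And>x. x \<in> set p \<union> set q \<union> set r \<Longrightarrow> homogeneous x"
  shows "tensor_mult scale G n (tensor_mult scale G n (pure_tensor scale p) (pure_tensor scale q))
    (pure_tensor scale r)
    = tensor_mult scale G n (pure_tensor scale p) (tensor_mult scale G n (pure_tensor scale q)
      (pure_tensor scale r))"
proof -
  have L: "list_all2 (\<lambda>x d. x \<in> G d) p (map parity p)" "list_all2 (\<lambda>x d. x \<in> G d) q (map parity q)"
    "list_all2 (\<lambda>x d. x \<in> G d) r (map parity r)"
    using h by (auto intro: homogeneous_list)
  have scale: "tensor_mult scale G n (tensor_scale scale n c (pure_tensor scale a))
    (pure_tensor scale b) =
     tensor_scale scale n c (tensor_mult scale G n (pure_tensor scale a) (pure_tensor scale b))"
    "tensor_mult scale G n (pure_tensor scale a) (tensor_scale scale n c (pure_tensor scale b)) =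
     tensor_scale scale n c (tensor_mult scale G n (pure_tensor scale a) (pure_tensor scale b))"
    if "length a = n" "length b = n" for a b c
    using that by (auto simp: pure_tensor_def tensor_mult_scale_left tensor_mult_scale_right)
  have mm: "tensor_scale scale n c (tensor_scale scale n d (pure_tensor scale a)) =
     tensor_scale scale n (c * d) (pure_tensor scale a)" if "length a = n" for a c d
    using that by (simp add: pure_tensor_def tensor_scale_cls)
  have assoc: "map2 (*) (map2 (*) p q) r = map2 (*) p (map2 (*) q r)"
    using l by (intro nth_equalityI) (auto simp: mult.assoc)
  show ?thesis
    using l by (simp add: tensor_mult_pure[OF L(1,2) l(1,2)] tensor_mult_pure[OF L(2,3) l(2,3)] scale mm
        tensor_mult_pure[OF list_all2_mult[OF L(1,2) l(1,2)] L(3)]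
        tensor_mult_pure[OF L(1) list_all2_mult[OF L(2,3) l(2,3)]]
        mult_sign_add_left mult_sign_add_right assoc mult.commute mult.left_commute)
qed

lemma tensor_mult_assoc:
  assumes "U \<in> tensor_power scale n" "V \<in> tensor_power scale n" "W \<in> tensor_power scale n"
  shows "tensor_mult scale G n (tensor_mult scale G n U V) W =
    tensor_mult scale G n U (tensor_mult scale G n V W)"
proof -
  obtain u v w where u: "u \<in> homogeneous_words n" "U = cls n u" and v: "v \<in> homogeneous_words n"
    "V = cls n v"
    and w: "w \<in> homogeneous_words n" "W = cls n w"
    using assms tensor_power_homogeneous by metis
  let ?l = "\<lambda>p q r. lin_ext free_scale (\<lambda>x. word_mult G n x r) (word_mult G n p q) :: _ \<Rightarrow>\<^sub>0 'k"
  let ?r = "\<lambda>p q r. lin_ext free_scale (word_mult G n p) (word_mult G n q r) :: _ \<Rightarrow>\<^sub>0 'k"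
  have "?l p q r - ?r p q r \<in> tensor_null scale n"
    if "p \<in> Poly_Mapping.keys u" "q \<in> Poly_Mapping.keys v" "r \<in> Poly_Mapping.keys w" for p q r
  proof -
    have l: "length p = n" "length q = n" "length r = n" and h:
      "\<And>x. x \<in> set p \<union> set q \<union> set r \<Longrightarrow> homogeneous x"
      using that u v w by (auto simp: homogeneous_words_def)
    show ?thesis
      using tensor_mult_assoc_pure[OF l h] l
      by (simp add: pure_tensor_def tensor_mult_cls tensor_cls_eq_iff free_mult_def lin_ext_single
        vector_space_free_scale)
  qed
  then have "lin_ext free_scale (\<lambda>p. lin_ext free_scale (\<lambda>q. lin_ext free_scale
       (\<lambda>r. ?l p q r - ?r p q r) w) v) u \<in> tensor_null scale n"
    by (intro lin_ext_in_subspace vector_space_free_scale subspace_tensor_null)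
  moreover have "free_mult G n (free_mult G n u v) w =
     lin_ext free_scale (\<lambda>p. lin_ext free_scale (\<lambda>q. lin_ext free_scale (?l p q) w) v) u"
    unfolding free_mult_def lin_ext_lin_ext[OF vector_space_free_scale]
    by (subst lin_ext_swap[OF vector_space_free_scale]) simp
  moreover have "free_mult G n u (free_mult G n v w) =
     lin_ext free_scale (\<lambda>p. lin_ext free_scale (\<lambda>q. lin_ext free_scale (?r p q) w) v) u"
    unfolding free_mult_def lin_ext_lin_ext[OF vector_space_free_scale] by simp
  ultimately show ?thesis
    unfolding u v w tensor_mult_cls tensor_cls_eq_iff by
      (simp add: lin_ext_fun_diff[OF vector_space_free_scale])
qed

lemma tensor_mult_one_right:
  assumes "U \<in> tensor_power scale n"
  shows "tensor_mult scale G n U (tensor_one scale n) = U"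
proof -
  obtain u where u: "u \<in> homogeneous_words n" "U = cls n u"
    using assms tensor_power_homogeneous by metis
  have one: "Poly_Mapping.single (replicate n 1) 1 \<in> homogeneous_words n"
    by (rule single_homogeneous_words) auto
  have "word_prod n p (replicate n 1) = Poly_Mapping.single p 1" if "p \<in> Poly_Mapping.keys u" for p
  proof -
    have "length p = n" using that u by (auto simp: homogeneous_words_def)
    then have "map2 (*) p (replicate n 1) = p"
      by (intro nth_equalityI) auto
    then show ?thesis by (simp add: word_prod_def map_replicate mult_sign_zero_right)
  qed
  then have "lin_ext free_scale (\<lambda>p. word_prod n p (replicate n 1)) u = u"
    using lin_ext_cong[of u "\<lambda>p. word_prod n p (replicate n 1)" "\<lambda>p. Poly_Mapping.single p 1" free_scale]
    by (simp add: lin_ext_single_id)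
  then show ?thesis
    by (simp add: tensor_one_def pure_tensor_def u tensor_mult_homogeneous one lin_ext_single
      vector_space_free_scale)
qed

text \<open>
  Constant factors are pulled out on both sides at once. Where one side has none, the summand is
  first written with a factor \<open>1\<close>, so that this rule applies.
\<close>

lemma sweedler_sandwich: "sweedler (\<lambda>w. x * f w * y) u = x * sweedler f u * y"
  by (simp add: lin_ext_def sum_distrib_left sum_distrib_right scale_mult_left scale_mult_right)

lemma koszul_mult: "koszul d * x = scale (koszul d) x"
  by (simp add: koszul_def)

section \<open>Short words and padding with the unit\<close>

lemma graded_words_2E:
  assumes "u \<in> graded_words 2 d" "w \<in> Poly_Mapping.keys u"
  obtains x y where "w = [x, y]" "homogeneous x" "homogeneous y" "d = parity x + parity y"
proof -
  have "length w = 2" "\<forall>x\<in>set w. homogeneous x" "sum_list (map parity w) = d"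
    using assms by (auto simp: graded_words_def homogeneous_words_def)
  then show thesis
    using that by (auto simp: numeral_eq_Suc length_Suc_conv)
qed

lemma homogeneous_words_3E:
  assumes "u \<in> homogeneous_words 3" "w \<in> Poly_Mapping.keys u"
  obtains x y z where "w = [x, y, z]" "homogeneous x" "homogeneous y" "homogeneous z"
  using assms by (auto simp: homogeneous_words_def numeral_eq_Suc length_Suc_conv)

lemma even_words_3E:
  assumes "u \<in> graded_words 3 0" "w \<in> Poly_Mapping.keys u"
  obtains x y z where "w = [x, y, z]" "homogeneous x" "homogeneous y" "homogeneous z"
    "parity z = parity x + parity y"
proof -
  obtain x y z where w: "w = [x, y, z]" "homogeneous x" "homogeneous y" "homogeneous z"
    using homogeneous_words_3E[OF graded_words_homogeneous[OF assms(1)] assms(2)] .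
  moreover have "sum_list (map parity w) = 0"
    using assms by (auto simp: graded_words_def)
  ultimately have "parity x + (parity y + parity z) = 0"
    by simp
  then have "parity x + (parity x + (parity y + parity z)) + parity y = parity x + parity y"
    by simp
  then have "parity z = parity x + parity y"
    by (simp add: ac_simps)
  then show thesis using that w by blast
qed

lemma homogeneous_words_4E:
  assumes "u \<in> homogeneous_words 4" "w \<in> Poly_Mapping.keys u"
  obtains a b c d where "w = [a, b, c, d]" "homogeneous a" "homogeneous b" "homogeneous c"
    "homogeneous d"
  using assms by (auto simp: homogeneous_words_def numeral_eq_Suc length_Suc_conv)

lemma mult_sign_3: "mult_sign 3 [a, b, c] [d, e, f] = koszul (b * d + c * (d + e))"
  by (simp add: mult_sign_def numeral_eq_Suc lessThan_Suc algebra_simps)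

lemma mult_sign_4:
  "mult_sign 4 [a, b, c, d] [e, f, g, h] = koszul (b * e + c * (e + f) + d * (e + f + g))"
  by (simp add: mult_sign_def numeral_eq_Suc lessThan_Suc algebra_simps)

lemma pure_tensor_1: "pure_tensor scale [a] = cls 1 (Poly_Mapping.single [a] 1)"
  by (simp add: pure_tensor_def)

lemma tensor_cat_one_left:
  assumes "u \<in> words n"
  shows "tensor_cat scale 1 n (pure_tensor scale [1]) (cls n u) =
    cls (Suc n) (lin_ext free_scale (\<lambda>w. Poly_Mapping.single (1 # w) 1) u)"
  using tensor_cat_cls[of "Poly_Mapping.single [1] 1" 1 u n scale] assms
  by (simp add: pure_tensor_def free_cat_def lin_ext_single vector_space_free_scale words_def)

lemma tensor_cat_one_right:
  assumes "u \<in> words n"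
  shows "tensor_cat scale n 1 (cls n u) (pure_tensor scale [1]) =
    cls (Suc n) (lin_ext free_scale (\<lambda>w. Poly_Mapping.single (w @ [1]) 1) u)"
  using tensor_cat_cls[of u n "Poly_Mapping.single [1] 1" 1 scale] assms
  by (simp add: pure_tensor_def free_cat_def lin_ext_single vector_space_free_scale words_def)

lemma homogeneous_words_one_left:
  "u \<in> homogeneous_words n \<Longrightarrow>
    lin_ext free_scale (\<lambda>w. Poly_Mapping.single (1 # w) 1) u \<in> homogeneous_words (Suc n)"
  by (intro lin_ext_in_subspace vector_space_free_scale subspace_homogeneous_words)
     (auto simp: homogeneous_words_def)

lemma homogeneous_words_one_right:
  "u \<in> homogeneous_words n \<Longrightarrow>
    lin_ext free_scale (\<lambda>w. Poly_Mapping.single (w @ [1]) 1) u \<in> homogeneous_words (Suc n)"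
  by (intro lin_ext_in_subspace vector_space_free_scale subspace_homogeneous_words)
     (auto simp: homogeneous_words_def)

lemma mult_sign_Cons_0: "mult_sign (Suc n) (0 # d) (0 # e) = mult_sign n d e"
  unfolding mult_sign_def by (simp add: sum.lessThan_Suc_shift del: sum.lessThan_Suc)

text \<open>
  The leading \<open>1\<close> is even and so contributes no sign.
\<close>

lemma tensor_cat_one_left_mult:
  assumes "U \<in> tensor_power scale n" "V \<in> tensor_power scale n"
  shows "tensor_mult scale G (Suc n) (tensor_cat scale 1 n (pure_tensor scale [1]) U)
      (tensor_cat scale 1 n (pure_tensor scale [1]) V) =
    tensor_cat scale 1 n (pure_tensor scale [1]) (tensor_mult scale G n U V)"
proof -
  obtain u v where uv: "u \<in> homogeneous_words n" "U = cls n u" "v \<in> homogeneous_words n" "V = cls n v"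
    using assms tensor_power_homogeneous by metis
  have p: "lin_ext free_scale (\<lambda>p. lin_ext free_scale (word_prod n p) v) u \<in> words n"
    using uv by (intro lin_ext_in_subspace vector_space_free_scale subspace_words homogeneous_words_words
        word_prod_homogeneous) (auto simp: homogeneous_words_def)
  have "word_prod (Suc n) (1 # p) (1 # q) =
      lin_ext free_scale (\<lambda>w. Poly_Mapping.single (1 # w) 1) (word_prod n p q)" for p q
    by (simp add: word_prod_def lin_ext_single vector_space_free_scale mult_sign_Cons_0)
  then show ?thesis
    using uv p
    by (simp add: tensor_cat_one_left homogeneous_words_words homogeneous_words_one_left
      tensor_mult_homogeneous lin_ext_lin_ext[OF vector_space_free_scale] lin_ext_single
        vector_space_free_scale del: One_nat_def)
qed

lemma tensor_cat_one_one:
  "tensor_cat scale 1 n (pure_tensor scale [1]) (tensor_one scale n) = tensor_one scale (Suc n)"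
  unfolding tensor_one_def pure_tensor_def[of _ "replicate n 1"] length_replicate
  by (subst tensor_cat_one_left) (auto simp: words_def lin_ext_single vector_space_free_scale
    pure_tensor_def)

lemma tensor_cat_one_in:
  assumes "U \<in> tensor_power scale n"
  shows "tensor_cat scale 1 n (pure_tensor scale [1]) U \<in> tensor_power scale (Suc n)"
    "tensor_cat scale n 1 U (pure_tensor scale [1]) \<in> tensor_power scale (Suc n)"
proof -
  obtain u where u: "u \<in> homogeneous_words n" "U = cls n u"
    using assms tensor_power_homogeneous by metis
  then show "tensor_cat scale 1 n (pure_tensor scale [1]) U \<in> tensor_power scale (Suc n)"
    "tensor_cat scale n 1 U (pure_tensor scale [1]) \<in> tensor_power scale (Suc n)"
    by (auto simp: tensor_power_def tensor_cat_one_left tensor_cat_one_right homogeneous_words_words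
        intro!: imageI homogeneous_words_words[OF homogeneous_words_one_left]
         homogeneous_words_words[OF homogeneous_words_one_right] simp del: One_nat_def)
qed

end

context quasi_hopf_superalgebra
begin

section \<open>Quasi-Hopf superalgebras: the associator is even\<close>

lemma counit_even: "homogeneous a \<Longrightarrow> \<epsilon> a = 0 \<or> parity a = 0"
  using in_parity[of a] counit_grade[of a] by (cases "parity a") auto

lemma counit_koszul: "homogeneous a \<Longrightarrow> koszul (parity a * t) * \<epsilon> a = \<epsilon> a"
  using counit_even[of a] by auto

lemma antipode_prod:
  "homogeneous a \<Longrightarrow> homogeneous b \<Longrightarrow> S (a * b) = scale (koszul (parity a * parity b)) (S b * S a)"
  using antipode_mult[of a "parity a" b "parity b"] by (simp add: in_parity koszul_mult)

lemmas multilinear_simps = nth_list_update antipode_add antipode_scale counit_add counit_scale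
  scale_mult_left scale_mult_right scale_left_distrib scale_right_distrib

lemma multilinear_alpha: "multilinear_words scale 2 (\<lambda>w. S (w ! 0) * x * w ! 1)"
  by (rule multilinear_wordsI) (auto simp: numeral_eq_Suc less_Suc_eq multilinear_simps algebra_simps)

lemma multilinear_beta: "multilinear_words scale 2 (\<lambda>w. w ! 0 * x * S (w ! 1))"
  by (rule multilinear_wordsI) (auto simp: numeral_eq_Suc less_Suc_eq multilinear_simps algebra_simps)

lemma counit_Phi_rep:
  assumes "u \<in> homogeneous_words 3" "\<Phi> = cls 3 u" "multilinear_words scale 2 (\<lambda>w. g (w ! 0) (w ! 1))"
  shows "sweedler (\<lambda>w. scale (\<epsilon> (w ! 1)) (g (w ! 0) (w ! 2))) u = g 1 1"
proof -
  have "g 1 1 = tensor_sum scale (\<lambda>w. g (w ! 0) (w ! 1)) (counit_at scale \<epsilon> 3 1 \<Phi>)"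
    using assms(3)
    by (simp add: counit_Phi tensor_one_def pure_tensor_def tensor_sum_rep sweedler_single
        numeral_2_eq_2 del: One_nat_def)
  also have "\<dots> = sweedler (\<lambda>w. g (w ! 0) (w ! 1)) (free_counit_at \<epsilon> 1 u)"
    using assms(3)
    by (simp add: assms(2) counit_at_cls counit_add counit_scale tensor_sum_rep)
  also have "\<dots> = sweedler (\<lambda>w. scale (\<epsilon> (w ! 1)) (g (w ! 0) (w ! 2))) u"
    unfolding free_counit_at_def sweedler_lin_ext
    by (rule lin_ext_cong) (auto elim!: homogeneous_words_3E[OF assms(1)] simp: sweedler_single)
  finally show ?thesis ..
qed

text \<open>
  Otherwise some entry of every word of \<open>\<Phi>\<close> is odd, hence \<open>\<epsilon> \<otimes> \<epsilon> \<otimes> \<epsilon>\<close> kills \<open>\<Phi>\<close>. But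
  \<open>(1 \<otimes> \<epsilon> \<otimes> 1)\<Phi> = 1\<close> shows that its value is \<open>1\<close>.
\<close>

lemma Phi_even: "\<Phi> \<in> tensor_grade scale G 3 0"
proof (rule ccontr)
  assume "\<Phi> \<notin> tensor_grade scale G 3 0"
  then have "\<Phi> \<in> tensor_grade scale G 3 1"
    using Phi_homogeneous by (metis bit_not_zero_iff)
  then obtain u where u: "u \<in> graded_words 3 1" "\<Phi> = cls 3 u"
    by (rule tensor_grade_graded)
  have "sweedler (\<lambda>w. scale (\<epsilon> (w ! 1)) (scale (\<epsilon> (w ! 0)) (scale (\<epsilon> (w ! 2)) 1))) u = sweedler
    (\<lambda>w. 0) u"
  proof (rule lin_ext_cong)
    fix w assume "w \<in> Poly_Mapping.keys u"
    note k = this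
    obtain x y z where w: "w = [x, y, z]" "homogeneous x" "homogeneous y" "homogeneous z"
      using homogeneous_words_3E[OF graded_words_homogeneous[OF u(1)] k] .
    have "sum_list (map parity w) = 1"
      using u(1) k by (auto simp: graded_words_def)
    then have d: "parity x + (parity y + parity z) = 1"
      by (simp add: w(1))
    show "scale (\<epsilon> (w ! 1)) (scale (\<epsilon> (w ! 0)) (scale (\<epsilon> (w ! 2)) 1)) = 0"
      using d counit_even[OF w(2)] counit_even[OF w(3)] counit_even[OF w(4)] by (auto simp: w(1))
  qed
  moreover have "sweedler (\<lambda>w. scale (\<epsilon> (w ! 1)) (scale (\<epsilon> (w ! 0)) (scale (\<epsilon> (w ! 2)) 1))) u
      = scale (\<epsilon> 1) (scale (\<epsilon> 1) 1)"
    by (rule counit_Phi_rep[OF graded_words_homogeneous[OF u(1)] u(2)], rule multilinear_wordsI)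
      (auto simp: numeral_eq_Suc less_Suc_eq multilinear_simps algebra_simps)
  ultimately show False by (simp add: counit_one lin_ext_def)
qed

end

section \<open>Sums over representatives of the structure maps\<close>

text \<open>
  Fixed homogeneous representatives of \<open>\<Delta>(a)\<close>, \<open>\<Phi>\<close> and \<open>\<Phi>\<inverse>\<close>. They are parameters and not defined
  by choice: a definition would mention \<open>\<Delta>\<close> and \<open>\<Phi>\<close>, so that rewriting with \<open>\<Phi> = cls 3 phi\<close> would
  loop.
\<close>

locale quasi_hopf_representatives =
  quasi_hopf_superalgebra scale G \<Delta> \<epsilon> \<Phi> \<Phi>inv S \<alpha> \<beta>
  for scale :: "'k::field \<Rightarrow> 'a::ring_1 \<Rightarrow> 'a" and G and \<Delta> and \<epsilon> and \<Phi> \<Phi>inv and S and \<alpha> \<beta> +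
  fixes copr :: "'a \<Rightarrow> ('a list \<Rightarrow>\<^sub>0 'k)" and phi phi_inv :: "'a list \<Rightarrow>\<^sub>0 'k"
  assumes copr: "homogeneous a \<Longrightarrow> copr a \<in> graded_words 2 (parity a)"
      "homogeneous a \<Longrightarrow> \<Delta> a = cls 2 (copr a)"
    and phi: "phi \<in> graded_words 3 0" "\<Phi> = cls 3 phi"
    and phi_inv: "phi_inv \<in> homogeneous_words 3" "\<Phi>inv = cls 3 phi_inv"

lemma (in quasi_hopf_superalgebra) representatives_exist:
  obtains copr phi phi_inv
  where "quasi_hopf_representatives scale G \<Delta> \<epsilon> \<Phi> \<Phi>inv S \<alpha> \<beta> copr phi phi_inv"
proof -
  have "\<exists>u. homogeneous a \<longrightarrow> u \<in> graded_words 2 (parity a) \<and> \<Delta> a = cls 2 u" for a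
    using tensor_grade_graded[OF comult_grade[OF in_parity]] by metis
  then obtain copr where "\<And>a. homogeneous a \<Longrightarrow> copr a \<in> graded_words 2 (parity a) \<and> \<Delta> a = cls 2 (copr a)"
    by metis
  moreover obtain phi where "phi \<in> graded_words 3 0" "\<Phi> = cls 3 phi"
    using tensor_grade_graded[OF Phi_even] .
  moreover obtain phi_inv where "phi_inv \<in> homogeneous_words 3" "\<Phi>inv = cls 3 phi_inv"
    using tensor_power_homogeneous[OF Phiinv_in] .
  ultimately have "quasi_hopf_representatives scale G \<Delta> \<epsilon> \<Phi> \<Phi>inv S \<alpha> \<beta> copr phi phi_inv"
    by unfold_locales auto
  then show thesis by (rule that)
qed

context quasi_hopf_representatives
begin

lemmas phi_homogeneous = graded_words_homogeneous[OF phi(1)]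

lemma tensor_sum_comult:
  "homogeneous a \<Longrightarrow> multilinear_words scale 2 f \<Longrightarrow> tensor_sum scale f (\<Delta> a) = sweedler f (copr a)"
  by (simp add: copr(2) tensor_sum_rep)

lemma copr_alpha: "homogeneous a \<Longrightarrow> sweedler (\<lambda>w. S (w ! 0) * \<alpha> * w ! 1) (copr a) = scale (\<epsilon> a) \<alpha>"
  using antipode_alpha[of a] tensor_sum_comult[OF _ multilinear_alpha] by simp

lemma copr_beta: "homogeneous a \<Longrightarrow> sweedler (\<lambda>w. w ! 0 * \<beta> * S (w ! 1)) (copr a) = scale (\<epsilon> a) \<beta>"
  using antipode_beta[of a] tensor_sum_comult[OF _ multilinear_beta] by simp

text \<open>
  For even \<open>c\<close> all signs in the definition are trivial and the two components of the first tensor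
  factor recombine.
\<close>

lemma copr_pseudo_invariant:
  assumes "pseudo_invariant scale G \<Delta> \<epsilon> S c" "c \<in> G 0" "homogeneous a"
  shows "sweedler (\<lambda>w. S (w ! 0) * c * w ! 1) (copr a) = scale (\<epsilon> a) c"
proof -
  have "(\<Sum>d\<in>{0, 1}. \<Sum>e\<in>{0, 1}. koszul (d * e) * (S (hpart G e x) * hpart G d c * y)) = S x * c * y"
    for x y
  proof -
    have "S (hpart G 0 x) + S (hpart G 1 x) = S x"
      using hpart_sum[of x] antipode_add by metis
    then show ?thesis
      by (simp add: hpart_homogeneous[OF assms(2)] flip: distrib_right)
  qed
  then have "tensor_sum scale (\<lambda>w. S (w ! 0) * c * w ! 1) (\<Delta> a) = scale (\<epsilon> a) c"
    using assms(1) unfolding pseudo_invariant_def by presburger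
  then show ?thesis
    using tensor_sum_comult[OF assms(3) multilinear_alpha] by simp
qed

lemma copr_counit_left:
  assumes "homogeneous a" "multilinear_words scale 1 (\<lambda>w. k (w ! 0))"
  shows "sweedler (\<lambda>w. scale (\<epsilon> (w ! 0)) (k (w ! 1))) (copr a) = k a"
proof -
  have "k a = tensor_sum scale (\<lambda>w. k (w ! 0)) (counit_at scale \<epsilon> 2 0 (\<Delta> a))"
    unfolding counit_left pure_tensor_1 tensor_sum_rep[OF assms(2)]
    by (simp add: sweedler_single)
  also have "\<dots> = sweedler (\<lambda>w. k (w ! 0)) (free_counit_at \<epsilon> 0 (copr a))"
    using assms(2)
    by (simp add: copr(2)[OF assms(1)] counit_at_cls counit_add counit_scale tensor_sum_rep)
  also have "\<dots> = sweedler (\<lambda>w. scale (\<epsilon> (w ! 0)) (k (w ! 1))) (copr a)"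
    unfolding free_counit_at_def sweedler_lin_ext
    by (rule lin_ext_cong) (auto elim!: graded_words_2E[OF copr(1)[OF assms(1)]] simp: sweedler_single)
  finally show ?thesis ..
qed

lemma copr_counit_right:
  assumes "homogeneous a" "multilinear_words scale 1 (\<lambda>w. k (w ! 0))"
  shows "sweedler (\<lambda>w. scale (\<epsilon> (w ! 1)) (k (w ! 0))) (copr a) = k a"
proof -
  have "k a = tensor_sum scale (\<lambda>w. k (w ! 0)) (counit_at scale \<epsilon> 2 1 (\<Delta> a))"
    unfolding counit_right pure_tensor_1 tensor_sum_rep[OF assms(2)]
    by (simp add: sweedler_single)
  also have "\<dots> = sweedler (\<lambda>w. k (w ! 0)) (free_counit_at \<epsilon> 1 (copr a))"
    using assms(2)
    by (simp add: copr(2)[OF assms(1)] counit_at_cls counit_add counit_scale tensor_sum_rep)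
  also have "\<dots> = sweedler (\<lambda>w. scale (\<epsilon> (w ! 1)) (k (w ! 0))) (copr a)"
    unfolding free_counit_at_def sweedler_lin_ext
    by (rule lin_ext_cong) (auto elim!: graded_words_2E[OF copr(1)[OF assms(1)]] simp: sweedler_single)
  finally show ?thesis ..
qed

lemmas phi_counit_mid = counit_Phi_rep[OF phi_homogeneous phi(2)]

definition coprod_at :: "nat \<Rightarrow> ('a list \<Rightarrow>\<^sub>0 'k) \<Rightarrow> ('a list \<Rightarrow>\<^sub>0 'k)" where
  "coprod_at i u = lin_ext free_scale (\<lambda>w. lin_ext free_scale
     (\<lambda>x. Poly_Mapping.single (take i w @ x @ drop (Suc i) w) 1) (copr (w ! i))) u"

lemma sweedler_coprod_at:
  "sweedler f (coprod_at i u) = sweedler (\<lambda>w. sweedler (\<lambda>x. f (take i w @ x @ drop (Suc i) w))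
    (copr (w ! i))) u"
  by (simp add: coprod_at_def sweedler_lin_ext sweedler_single)

lemma coprod_at_homogeneous:
  assumes "u \<in> homogeneous_words n" "i < n"
  shows "coprod_at i u \<in> homogeneous_words (Suc n)"
  unfolding coprod_at_def
proof (intro lin_ext_in_subspace vector_space_free_scale subspace_homogeneous_words)
  fix w x assume w: "w \<in> Poly_Mapping.keys u" and x: "x \<in> Poly_Mapping.keys (copr (w ! i))"
  have h: "length w = n" "\<And>y. y \<in> set w \<Longrightarrow> homogeneous y"
    using assms w by (auto simp: homogeneous_words_def)
  then have "copr (w ! i) \<in> homogeneous_words 2"
    using assms graded_words_homogeneous[OF copr(1)[of "w ! i"]] by auto
  then have "length x = 2" "\<And>y. y \<in> set x \<Longrightarrow> homogeneous y"
    using x by (auto simp: homogeneous_words_def)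
  then show "Poly_Mapping.single (take i w @ x @ drop (Suc i) w) 1 \<in> homogeneous_words (Suc n)"
    using h assms by (intro single_homogeneous_words) (auto dest: in_set_takeD in_set_dropD)
qed

lemma comult_at_homogeneous:
  assumes "u \<in> homogeneous_words n" "i < n"
  shows "comult_at scale \<Delta> n i (cls n u) = cls (Suc n) (coprod_at i u)"
proof -
  let ?c = "\<lambda>w y. free_cat (Poly_Mapping.single (take i w) 1)
     (free_cat y (Poly_Mapping.single (drop (Suc i) w) 1)) :: 'a list \<Rightarrow>\<^sub>0 'k"
  have c: "lin_ext free_scale (\<lambda>x. Poly_Mapping.single (take i w @ x @ drop (Suc i) w) 1) y = ?c w
    y" for w y
    by (simp add: free_cat_def lin_ext_lin_ext[OF vector_space_free_scale] lin_ext_single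
      vector_space_free_scale)
  have "lin_ext free_scale (\<lambda>w. ?c w (rep (\<Delta> (w ! i))) - ?c w (copr (w ! i))) u \<in> tensor_null scale
    (Suc n)"
  proof (intro lin_ext_in_subspace vector_space_free_scale subspace_tensor_null)
    fix w assume w: "w \<in> Poly_Mapping.keys u"
    have h: "length w = n" "homogeneous (w ! i)"
      using assms w by (auto simp: homogeneous_words_def)
    have "rep (\<Delta> (w ! i)) - copr (w ! i) \<in> tensor_null scale 2"
      using rep_tensor_cls[of scale 2 "copr (w ! i)"] copr(2)[OF h(2)] by simp
    then have "?c w (rep (\<Delta> (w ! i)) - copr (w ! i)) \<in> tensor_null scale (i + (2 + (n - Suc i)))"
      using assms(2) h
      by (intro free_cat_null_right free_cat_null_left) (auto simp: words_def)
    moreover have "i + (2 + (n - Suc i)) = Suc n" using assms(2) by simp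
    ultimately show "?c w (rep (\<Delta> (w ! i))) - ?c w (copr (w ! i)) \<in> tensor_null scale (Suc n)"
      by (simp add: free_cat_diff_left free_cat_diff_right)
  qed
  then show ?thesis
    using assms
    by (simp add: comult_at_cls comult_in comult_add comult_scale homogeneous_words_words
      free_comult_at_def coprod_at_def c tensor_cls_eq_iff lin_ext_fun_diff[OF vector_space_free_scale])
qed

lemma comult_at_in:
  "u \<in> homogeneous_words n \<Longrightarrow> i < n \<Longrightarrow> comult_at scale \<Delta> n i (cls n u) \<in> tensor_power scale (Suc n)"
  by (auto simp: comult_at_homogeneous tensor_power_def intro: homogeneous_words_words
    coprod_at_homogeneous)

text \<open>
  The sign depends on the parity of the element \<open>a\<close> whose coproduct is summed. It multiplies
  \<open>\<epsilon>(a)\<close>, which vanishes for odd \<open>a\<close>.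
\<close>

lemma coproduct_absorbed:
  assumes "homogeneous a" "sweedler f (copr a) = scale (\<epsilon> a) m"
  shows "sweedler (\<lambda>x. scale (koszul (parity a * t)) (A * f x * B)) (copr a) = scale (\<epsilon> a) (A * m * B)"
  using counit_koszul[OF assms(1), of t]
  by (simp add: sweedler_scale sweedler_sandwich assms(2) scale_mult_left scale_mult_right)

text \<open>
  Normal forms for signs. The laws are restricted to the type of parities, since commutativity
  must not be applied to products in the algebra.
\<close>

lemmas bit_simps = distrib_left[where 'a = bit] distrib_right[where 'a = bit]
  add.assoc[where 'a = bit] add.commute[where 'a = bit] add.left_commute[where 'a = bit]
  mult.commute[where 'a = bit]

lemmas sign_simps = antipode_prod scale_mult_left scale_mult_right mult.assoc
  koszul_add[symmetric] bit_simps

abbreviation central_form :: "'a \<Rightarrow> 'a list \<Rightarrow> 'a" where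
  "central_form c \<equiv> \<lambda>w. w ! 0 * \<beta> * S (w ! 1) * c * w ! 2"

lemma multilinear_central_form: "multilinear_words scale 3 (central_form c)"
  by (rule multilinear_wordsI) (auto simp: numeral_eq_Suc less_Suc_eq multilinear_simps algebra_simps)

section \<open>The element obtained from the inverse associator is central\<close>

lemma comult_at_copr:
  assumes "homogeneous a" "i < 2"
  shows "comult_at scale \<Delta> 2 i (\<Delta> a) = cls 3 (coprod_at i (copr a))"
    and "coprod_at i (copr a) \<in> homogeneous_words 3"
proof -
  note u = graded_words_homogeneous[OF copr(1)[OF assms(1)]]
  show "comult_at scale \<Delta> 2 i (\<Delta> a) = cls 3 (coprod_at i (copr a))"
    unfolding copr(2)[OF assms(1)] using comult_at_homogeneous[OF u assms(2)] by simp
  show "coprod_at i (copr a) \<in> homogeneous_words 3"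
    using coprod_at_homogeneous[OF u assms(2)] by simp
qed

text \<open>
  The factors of \<open>\<Delta>(a\<^sub>1)\<close> meet around \<open>\<beta>\<close>, because the antipode reverses products, and contract to
  \<open>\<epsilon>(a\<^sub>1)\<close>; what remains of \<open>\<Delta>(a)\<close> is \<open>a\<close> on the far right.
\<close>

lemma central_form_Phiinv_comult:
  assumes "homogeneous a"
  shows "tensor_sum scale (central_form c)
      (tensor_mult scale G 3 \<Phi>inv (comult_at scale \<Delta> 2 0 (\<Delta> a))) =
    sweedler (central_form c) phi_inv * a"
proof -
  note ca = copr[OF assms] graded_words_homogeneous[OF copr(1)[OF assms]]
  let ?f = "central_form c"
  have M: "comult_at scale \<Delta> 2 0 (\<Delta> a) = cls 3 (coprod_at 0 (copr a))"
      "coprod_at 0 (copr a) \<in> homogeneous_words 3"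
    by (rule comult_at_copr[OF assms]; simp)+
  have "tensor_sum scale ?f (tensor_mult scale G 3 \<Phi>inv (comult_at scale \<Delta> 2 0 (\<Delta> a))) =
     sweedler (\<lambda>p. sweedler (\<lambda>q. scale (mult_sign 3 (map parity p) (map parity q)) (?f (map2 (*) p q)))
        (coprod_at 0 (copr a))) phi_inv"
    unfolding M(1) phi_inv(2) by (rule tensor_sum_mult[OF phi_inv(1) M(2) multilinear_central_form])
  also have "\<dots> = sweedler (\<lambda>p. 1 * ?f p * a) phi_inv"
  proof (rule lin_ext_cong)
    fix p assume "p \<in> Poly_Mapping.keys phi_inv"
    then obtain x y z where p: "p = [x, y, z]" "homogeneous x" "homogeneous y" "homogeneous z"
      by (rule homogeneous_words_3E[OF phi_inv(1)])
    have "sweedler (\<lambda>q. scale (mult_sign 3 (map parity p) (map parity q)) (?f (map2 (*) p q)))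
        (coprod_at 0 (copr a)) = sweedler (\<lambda>w. (?f p) * scale (\<epsilon> (w ! 0)) (w ! 1) * 1) (copr a)"
      unfolding sweedler_coprod_at
    proof (rule lin_ext_cong)
      fix w assume "w \<in> Poly_Mapping.keys (copr a)"
      then obtain b1 b2 where w: "w = [b1, b2]" "homogeneous b1" "homogeneous b2"
        by (rule graded_words_2E[OF ca(1)])
      have "sweedler (\<lambda>v. scale (mult_sign 3 (map parity p) (map parity (take 0 w @ v @ drop (Suc 0) w)))
          (?f (map2 (*) p (take 0 w @ v @ drop (Suc 0) w)))) (copr b1) =
        sweedler (\<lambda>v. scale (koszul (parity b1 * (parity y + parity z)))
           (x * (v ! 0 * \<beta> * S (v ! 1)) * (S y * c * z * b2))) (copr b1)"
      proof (rule lin_ext_cong)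
        fix v assume "v \<in> Poly_Mapping.keys (copr b1)"
        then obtain v1 v2 where v: "v = [v1, v2]" "homogeneous v1" "homogeneous v2"
          "parity b1 = parity v1 + parity v2"
          by (rule graded_words_2E[OF copr(1)[OF w(2)]])
        show "scale (mult_sign 3 (map parity p) (map parity (take 0 w @ v @ drop (Suc 0) w)))
          (?f (map2 (*) p (take 0 w @ v @ drop (Suc 0) w))) =
          scale (koszul (parity b1 * (parity y + parity z)))
           (x * (v ! 0 * \<beta> * S (v ! 1)) * (S y * c * z * b2))"
          using p w v by (simp add: mult_sign_3 sign_simps)
      qed
      also have "\<dots> = scale (\<epsilon> b1) (x * \<beta> * (S y * c * z * b2))"
        by (rule coproduct_absorbed[OF w(2) copr_beta[OF w(2)]])
      also have "\<dots> = ?f p * scale (\<epsilon> b1) b2 * 1"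
        by (simp add: p sign_simps)
      finally show "sweedler (\<lambda>v. scale (mult_sign 3 (map parity p)
        (map parity (take 0 w @ v @ drop (Suc 0) w)))
          (?f (map2 (*) p (take 0 w @ v @ drop (Suc 0) w)))) (copr (w ! 0)) =
          ?f p * scale (\<epsilon> (w ! 0)) (w ! 1) * 1"
        by (simp only: w(1) nth_Cons_0 nth_Cons_Suc One_nat_def)
    qed
    also have "\<dots> = ?f p * a * 1"
      unfolding sweedler_sandwich
      by (subst copr_counit_left[OF assms, of "\<lambda>x. x"]) (auto intro!: multilinear_wordsI)
    finally show "sweedler (\<lambda>q. scale (mult_sign 3 (map parity p) (map parity q)) (?f (map2 (*) p q)))
        (coprod_at 0 (copr a)) = 1 * ?f p * a" by simp
  qed
  finally show ?thesis unfolding sweedler_sandwich by simp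
qed

text \<open>
  Here the factors of \<open>\<Delta>(a\<^sub>2)\<close> meet around \<open>c\<close> and contract by pseudo-invariance.
\<close>

lemma central_form_comult_Phiinv:
  assumes "homogeneous a" and inv: "\<And>b. homogeneous b \<Longrightarrow> sweedler (\<lambda>w. S (w ! 0) * c * w ! 1)
    (copr b) = scale (\<epsilon> b) c"
  shows "tensor_sum scale (central_form c)
      (tensor_mult scale G 3 (comult_at scale \<Delta> 2 1 (\<Delta> a)) \<Phi>inv) =
    a * sweedler (central_form c) phi_inv"
proof -
  note ca = copr[OF assms(1)] graded_words_homogeneous[OF copr(1)[OF assms(1)]]
  let ?f = "central_form c"
  let ?s = "\<lambda>q p. scale (mult_sign 3 (map parity q) (map parity p)) (?f (map2 (*) q p))"
  have M: "comult_at scale \<Delta> 2 1 (\<Delta> a) = cls 3 (coprod_at 1 (copr a))"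
      "coprod_at 1 (copr a) \<in> homogeneous_words 3"
    by (rule comult_at_copr[OF assms(1)]; simp)+
  have "tensor_sum scale ?f (tensor_mult scale G 3 (comult_at scale \<Delta> 2 1 (\<Delta> a)) \<Phi>inv) =
     sweedler (\<lambda>p. sweedler (\<lambda>q. ?s q p) (coprod_at 1 (copr a))) phi_inv"
    unfolding M(1) phi_inv(2) sweedler_swap[of _ _ phi_inv]
    by (rule tensor_sum_mult[OF M(2) phi_inv(1) multilinear_central_form])
  also have "\<dots> = sweedler (\<lambda>p. a * ?f p * 1) phi_inv"
  proof (rule lin_ext_cong)
    fix p assume "p \<in> Poly_Mapping.keys phi_inv"
    then obtain x y z where p: "p = [x, y, z]" "homogeneous x" "homogeneous y" "homogeneous z"
      by (rule homogeneous_words_3E[OF phi_inv(1)])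
    have "sweedler (\<lambda>q. ?s q p) (coprod_at 1 (copr a)) = sweedler
      (\<lambda>w. 1 * scale (\<epsilon> (w ! 1)) (w ! 0) * ?f p) (copr a)"
      unfolding sweedler_coprod_at
    proof (rule lin_ext_cong)
      fix w assume "w \<in> Poly_Mapping.keys (copr a)"
      then obtain b1 b2 where w: "w = [b1, b2]" "homogeneous b1" "homogeneous b2"
        by (rule graded_words_2E[OF ca(1)])
      have "sweedler (\<lambda>v. ?s (take 1 w @ v @ drop (Suc 1) w) p) (copr b2) =
        sweedler (\<lambda>v. scale (koszul (parity b2 * (parity x + parity y)))
           ((b1 * x * \<beta> * S y) * (S (v ! 0) * c * v ! 1) * z)) (copr b2)"
      proof (rule lin_ext_cong)
        fix v assume "v \<in> Poly_Mapping.keys (copr b2)"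
        then obtain v1 v2 where v: "v = [v1, v2]" "homogeneous v1" "homogeneous v2"
          "parity b2 = parity v1 + parity v2"
          by (rule graded_words_2E[OF copr(1)[OF w(3)]])
        show "?s (take 1 w @ v @ drop (Suc 1) w) p =
          scale (koszul (parity b2 * (parity x + parity y)))
           ((b1 * x * \<beta> * S y) * (S (v ! 0) * c * v ! 1) * z)"
          using p w v by (simp add: mult_sign_3 sign_simps)
      qed
      also have "\<dots> = scale (\<epsilon> b2) ((b1 * x * \<beta> * S y) * c * z)"
        by (rule coproduct_absorbed[OF w(3) inv[OF w(3)]])
      also have "\<dots> = 1 * scale (\<epsilon> b2) b1 * ?f p"
        by (simp add: p sign_simps)
      finally show "sweedler (\<lambda>v. ?s (take 1 w @ v @ drop (Suc 1) w) p) (copr (w ! 1)) =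
          1 * scale (\<epsilon> (w ! 1)) (w ! 0) * ?f p"
        by (simp only: w(1) nth_Cons_0 nth_Cons_Suc One_nat_def)
    qed
    also have "\<dots> = 1 * a * ?f p"
      unfolding sweedler_sandwich
      by (subst copr_counit_right[OF assms(1), of "\<lambda>x. x"]) (auto intro!: multilinear_wordsI)
    finally show "sweedler (\<lambda>q. ?s q p) (coprod_at 1 (copr a)) = a * ?f p * 1" by simp
  qed
  finally show ?thesis unfolding sweedler_sandwich by simp
qed

lemma comult_at_power_in:
  assumes "U \<in> tensor_power scale n" "i < n"
  shows "comult_at scale \<Delta> n i U \<in> tensor_power scale (Suc n)"
  using assms tensor_power_homogeneous[OF assms(1)] comult_at_in by metis

lemma quasi_coassoc_Phiinv:
  "tensor_mult scale G 3 \<Phi>inv (comult_at scale \<Delta> 2 0 (\<Delta> a)) =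
   tensor_mult scale G 3 (comult_at scale \<Delta> 2 1 (\<Delta> a)) \<Phi>inv"
proof -
  have c: "comult_at scale \<Delta> 2 0 (\<Delta> a) \<in> tensor_power scale 3"
    using comult_at_power_in[OF comult_in[of a], of 0] by simp
  then show ?thesis
    unfolding quasi_coassoc
    by (simp add: tensor_mult_assoc Phi_in Phiinv_in tensor_mult_in Phi_Phiinv tensor_mult_one_right)
qed

lemma central_form_Phiinv_central:
  assumes inv: "\<And>b. homogeneous b \<Longrightarrow> sweedler (\<lambda>w. S (w ! 0) * c * w ! 1) (copr b) = scale (\<epsilon> b) c"
  shows "a * sweedler (central_form c) phi_inv =
    sweedler (central_form c) phi_inv * a" (is "a * ?D = ?D * a")
proof -
  have h: "h * ?D = ?D * h" if "homogeneous h" for h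
    using central_form_Phiinv_comult[OF that, of c] central_form_comult_Phiinv[OF that inv]
      quasi_coassoc_Phiinv[of h] by simp
  have "(hpart G 0 a + hpart G 1 a) * ?D = ?D * (hpart G 0 a + hpart G 1 a)"
    unfolding distrib_left distrib_right
    using h[OF homogeneousI[OF hpart_in]] by simp
  then show ?thesis by (simp add: hpart_sum)
qed

section \<open>Evaluating the pentagon identity\<close>

lemma tensor_power_sweedler:
  assumes "V \<in> tensor_power scale n" "multilinear_words scale n f"
  obtains v where "v \<in> homogeneous_words n" "V = cls n v" "tensor_sum scale f V = sweedler f v"
  using tensor_power_homogeneous[OF assms(1)] tensor_sum_rep[OF assms(2)] by metis

lemma Phi_comult_0:
  "comult_at scale \<Delta> 3 0 \<Phi> = cls 4 (coprod_at 0 phi)" "coprod_at 0 phi \<in> homogeneous_words 4"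
  unfolding phi(2) using comult_at_homogeneous[OF phi_homogeneous, of 0]
    coprod_at_homogeneous[OF phi_homogeneous, of 0]
  by simp_all

lemma Phi_comult_1:
  "comult_at scale \<Delta> 3 1 \<Phi> = cls 4 (coprod_at 1 phi)" "coprod_at 1 phi \<in> homogeneous_words 4"
  unfolding phi(2) using comult_at_homogeneous[OF phi_homogeneous, of 1]
    coprod_at_homogeneous[OF phi_homogeneous, of 1]
  by simp_all

lemma Phi_comult_2:
  "comult_at scale \<Delta> 3 2 \<Phi> = cls 4 (coprod_at 2 phi)" "coprod_at 2 phi \<in> homogeneous_words 4"
  unfolding phi(2) using comult_at_homogeneous[OF phi_homogeneous, of 2]
    coprod_at_homogeneous[OF phi_homogeneous, of 2]
  by simp_all

text \<open>
  The scheme of all computations with a left factor \<open>(\<Delta> \<otimes> 1 \<otimes> 1)\<Phi>\<close>. For fixed homogeneous entries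
  \<open>a\<close>, \<open>b\<close>, \<open>c\<close>, \<open>d\<close> of the right factor, the summand is rewritten with its sign (\<open>k\<close>), then
  summed over \<open>\<Delta>(x)\<close> (\<open>h\<close>), then over \<open>\<Phi>\<close> (\<open>g\<close>).
\<close>

lemma tensor_sum_comult_0_mult:
  assumes f: "multilinear_words scale 4 f"
    and g: "multilinear_words scale 4 (\<lambda>q. g (q ! 0) (q ! 1) (q ! 2) (q ! 3))"
    and V: "V \<in> tensor_power scale 4"
    and step1: "\<And>x y z x1 x2 a b c d. \<lbrakk>homogeneous x; homogeneous y; homogeneous z; parity z =
      parity x + parity y;
       homogeneous x1; homogeneous x2; parity x = parity x1 + parity x2;
       homogeneous a; homogeneous b; homogeneous c; homogeneous d\<rbrakk> \<Longrightarrow>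
       scale (koszul (parity x2 * parity a + parity y * (parity a + parity b)
           + parity z * (parity a + parity b + parity c)))
         (f [x1 * a, x2 * b, y * c, z * d]) = k x y z a b c d x1 x2"
    and step2: "\<And>x y z a b c d. \<lbrakk>homogeneous x; homogeneous y; homogeneous z;
       homogeneous a; homogeneous b; homogeneous c; homogeneous d\<rbrakk> \<Longrightarrow>
       sweedler (\<lambda>v. k x y z a b c d (v ! 0) (v ! 1)) (copr x) = h x y z a b c d"
    and step3: "\<And>a b c d. \<lbrakk>homogeneous a; homogeneous b; homogeneous c; homogeneous d\<rbrakk> \<Longrightarrow>
       sweedler (\<lambda>w. h (w ! 0) (w ! 1) (w ! 2) a b c d) phi = g a b c d"
  shows "tensor_sum scale f (tensor_mult scale G 4 (comult_at scale \<Delta> 3 0 \<Phi>) V) =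
    tensor_sum scale (\<lambda>q. g (q ! 0) (q ! 1) (q ! 2) (q ! 3)) V"
proof -
  obtain v where v: "v \<in> homogeneous_words 4" "V = cls 4 v"
    and T: "tensor_sum scale (\<lambda>q. g (q ! 0) (q ! 1) (q ! 2) (q ! 3)) V = sweedler
      (\<lambda>q. g (q ! 0) (q ! 1) (q ! 2) (q ! 3)) v"
    using tensor_power_sweedler[OF V g] .
  let ?s = "\<lambda>p q. scale (mult_sign 4 (map parity p) (map parity q)) (f (map2 (*) p q))"
  have "tensor_sum scale f (tensor_mult scale G 4 (comult_at scale \<Delta> 3 0 \<Phi>) V) =
      sweedler (\<lambda>q. sweedler (\<lambda>p. ?s p q) (coprod_at 0 phi)) v"
    unfolding Phi_comult_0(1) v(2) sweedler_swap[of _ _ v]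
    by (rule tensor_sum_mult[OF Phi_comult_0(2) v(1) f])
  also have "\<dots> = sweedler (\<lambda>q. g (q ! 0) (q ! 1) (q ! 2) (q ! 3)) v"
  proof (rule lin_ext_cong)
    fix q assume "q \<in> Poly_Mapping.keys v"
    then obtain a b c d where q: "q = [a, b, c, d]" "homogeneous a" "homogeneous b" "homogeneous c"
      "homogeneous d"
      by (rule homogeneous_words_4E[OF v(1)])
    have "sweedler (\<lambda>p. ?s p q) (coprod_at 0 phi) = sweedler (\<lambda>w. h (w ! 0) (w ! 1) (w ! 2) a b c d) phi"
      unfolding sweedler_coprod_at
    proof (rule lin_ext_cong)
      fix w assume "w \<in> Poly_Mapping.keys phi"
      then obtain x y z where w: "w = [x, y, z]" "homogeneous x" "homogeneous y" "homogeneous z"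
        "parity z = parity x + parity y"
        by (rule even_words_3E[OF phi(1)])
      have "sweedler (\<lambda>u. ?s (take 0 w @ u @ drop (Suc 0) w) q) (copr x) = sweedler
        (\<lambda>v. k x y z a b c d (v ! 0) (v ! 1)) (copr x)"
      proof (rule lin_ext_cong)
        fix u assume "u \<in> Poly_Mapping.keys (copr x)"
        then obtain x1 x2 where u: "u = [x1, x2]" "homogeneous x1" "homogeneous x2"
          "parity x = parity x1 + parity x2"
          by (rule graded_words_2E[OF copr(1)[OF w(2)]])
        show "?s (take 0 w @ u @ drop (Suc 0) w) q = k x y z a b c d (u ! 0) (u ! 1)"
          using step1[OF w(2-5) u(2-4) q(2-5)] by (simp add: q(1) w(1) u(1) mult_sign_4)
      qed
      then show "sweedler (\<lambda>u. ?s (take 0 w @ u @ drop (Suc 0) w) q) (copr (w ! 0)) = h (w ! 0)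
        (w ! 1) (w ! 2) a b c d"
        using step2[OF w(2-4) q(2-5)] by (simp add: w(1))
    qed
    then show "sweedler (\<lambda>p. ?s p q) (coprod_at 0 phi) = g (q ! 0) (q ! 1) (q ! 2) (q ! 3)"
      using step3[OF q(2-5)] by (simp add: q(1) numeral_eq_Suc)
  qed
  finally show ?thesis unfolding T .
qed

text \<open>
  The same scheme for a left factor \<open>(1 \<otimes> 1 \<otimes> \<Delta>)\<Phi>\<close>, with the coproduct in the last two places.
\<close>

lemma tensor_sum_comult_2_mult:
  assumes f: "multilinear_words scale 4 f"
    and g: "multilinear_words scale 4 (\<lambda>q. g (q ! 0) (q ! 1) (q ! 2) (q ! 3))"
    and V: "V \<in> tensor_power scale 4"
    and step1: "\<And>x y z z1 z2 a b c d. \<lbrakk>homogeneous x; homogeneous y; homogeneous z; parity z =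
      parity x + parity y;
       homogeneous z1; homogeneous z2; parity z = parity z1 + parity z2;
       homogeneous a; homogeneous b; homogeneous c; homogeneous d\<rbrakk> \<Longrightarrow>
       scale (koszul (parity y * parity a + parity z1 * (parity a + parity b)
           + parity z2 * (parity a + parity b + parity c)))
         (f [x * a, y * b, z1 * c, z2 * d]) = k x y z a b c d z1 z2"
    and step2: "\<And>x y z a b c d. \<lbrakk>homogeneous x; homogeneous y; homogeneous z;
       homogeneous a; homogeneous b; homogeneous c; homogeneous d\<rbrakk> \<Longrightarrow>
       sweedler (\<lambda>v. k x y z a b c d (v ! 0) (v ! 1)) (copr z) = h x y z a b c d"
    and step3: "\<And>a b c d. \<lbrakk>homogeneous a; homogeneous b; homogeneous c; homogeneous d\<rbrakk> \<Longrightarrow>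
       sweedler (\<lambda>w. h (w ! 0) (w ! 1) (w ! 2) a b c d) phi = g a b c d"
  shows "tensor_sum scale f (tensor_mult scale G 4 (comult_at scale \<Delta> 3 2 \<Phi>) V) =
    tensor_sum scale (\<lambda>q. g (q ! 0) (q ! 1) (q ! 2) (q ! 3)) V"
proof -
  obtain v where v: "v \<in> homogeneous_words 4" "V = cls 4 v"
    and T: "tensor_sum scale (\<lambda>q. g (q ! 0) (q ! 1) (q ! 2) (q ! 3)) V = sweedler
      (\<lambda>q. g (q ! 0) (q ! 1) (q ! 2) (q ! 3)) v"
    using tensor_power_sweedler[OF V g] .
  let ?s = "\<lambda>p q. scale (mult_sign 4 (map parity p) (map parity q)) (f (map2 (*) p q))"
  have "tensor_sum scale f (tensor_mult scale G 4 (comult_at scale \<Delta> 3 2 \<Phi>) V) =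
      sweedler (\<lambda>q. sweedler (\<lambda>p. ?s p q) (coprod_at 2 phi)) v"
    unfolding Phi_comult_2(1) v(2) sweedler_swap[of _ _ v]
    by (rule tensor_sum_mult[OF Phi_comult_2(2) v(1) f])
  also have "\<dots> = sweedler (\<lambda>q. g (q ! 0) (q ! 1) (q ! 2) (q ! 3)) v"
  proof (rule lin_ext_cong)
    fix q assume "q \<in> Poly_Mapping.keys v"
    then obtain a b c d where q: "q = [a, b, c, d]" "homogeneous a" "homogeneous b" "homogeneous c"
      "homogeneous d"
      by (rule homogeneous_words_4E[OF v(1)])
    have "sweedler (\<lambda>p. ?s p q) (coprod_at 2 phi) = sweedler (\<lambda>w. h (w ! 0) (w ! 1) (w ! 2) a b c d) phi"
      unfolding sweedler_coprod_at
    proof (rule lin_ext_cong)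
      fix w assume "w \<in> Poly_Mapping.keys phi"
      then obtain x y z where w: "w = [x, y, z]" "homogeneous x" "homogeneous y" "homogeneous z"
        "parity z = parity x + parity y"
        by (rule even_words_3E[OF phi(1)])
      have "sweedler (\<lambda>u. ?s (take 2 w @ u @ drop (Suc 2) w) q) (copr z) = sweedler
        (\<lambda>v. k x y z a b c d (v ! 0) (v ! 1)) (copr z)"
      proof (rule lin_ext_cong)
        fix u assume "u \<in> Poly_Mapping.keys (copr z)"
        then obtain z1 z2 where u: "u = [z1, z2]" "homogeneous z1" "homogeneous z2"
          "parity z = parity z1 + parity z2"
          by (rule graded_words_2E[OF copr(1)[OF w(4)]])
        show "?s (take 2 w @ u @ drop (Suc 2) w) q = k x y z a b c d (u ! 0) (u ! 1)"
          using step1[OF w(2-5) u(2-4) q(2-5)] by (simp add: q(1) w(1) u(1) mult_sign_4)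
      qed
      then show "sweedler (\<lambda>u. ?s (take 2 w @ u @ drop (Suc 2) w) q) (copr (w ! 2)) = h (w ! 0)
        (w ! 1) (w ! 2) a b c d"
        using step2[OF w(2-4) q(2-5)] by (simp add: w(1))
    qed
    then show "sweedler (\<lambda>p. ?s p q) (coprod_at 2 phi) = g (q ! 0) (q ! 1) (q ! 2) (q ! 3)"
      using step3[OF q(2-5)] by (simp add: q(1) numeral_eq_Suc)
  qed
  finally show ?thesis unfolding T .
qed

abbreviation Phi_one :: "('a list \<Rightarrow>\<^sub>0 'k) set" where
  "Phi_one \<equiv> tensor_cat scale 3 1 \<Phi> (pure_tensor scale [1])"

abbreviation one_Phi :: "('a list \<Rightarrow>\<^sub>0 'k) set" where
  "one_Phi \<equiv> tensor_cat scale 1 3 (pure_tensor scale [1]) \<Phi>"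

abbreviation one_Phiinv :: "('a list \<Rightarrow>\<^sub>0 'k) set" where
  "one_Phiinv \<equiv> tensor_cat scale 1 3 (pure_tensor scale [1]) \<Phi>inv"

text \<open>
  Here the coproduct sits in the right factor. The entry \<open>1\<close> of the left factor has parity \<open>0\<close> and
  so contributes no sign.
\<close>

lemma tensor_sum_Phi_one_comult_1:
  assumes f: "multilinear_words scale 4 f"
    and step1: "\<And>x y z a b c b1 b2. \<lbrakk>homogeneous x; homogeneous y; homogeneous z; parity z = parity
      x + parity y;
       homogeneous a; homogeneous b; homogeneous c; parity c = parity a + parity b;
       homogeneous b1; homogeneous b2; parity b = parity b1 + parity b2\<rbrakk> \<Longrightarrow>
       scale (koszul (parity y * parity a + parity z * (parity a + parity b1)))
         (f [x * a, y * b1, z * b2, c]) = k x y z a b c b1 b2"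
    and step2: "\<And>x y z a b c. \<lbrakk>homogeneous x; homogeneous y; homogeneous z;
       homogeneous a; homogeneous b; homogeneous c\<rbrakk> \<Longrightarrow>
       sweedler (\<lambda>v. k x y z a b c (v ! 0) (v ! 1)) (copr b) = h x y z a b c"
  shows "tensor_sum scale f (tensor_mult scale G 4 Phi_one (comult_at scale \<Delta> 3 1 \<Phi>)) =
    sweedler (\<lambda>p. sweedler (\<lambda>q. h (p ! 0) (p ! 1) (p ! 2) (q ! 0) (q ! 1) (q ! 2)) phi) phi"
proof -
  let ?s = "\<lambda>p q. scale (mult_sign 4 (map parity p) (map parity q)) (f (map2 (*) p q))"
  let ?u = "lin_ext free_scale (\<lambda>w. Poly_Mapping.single (w @ [1]) 1) phi"
  have P: "Phi_one = cls 4 ?u" "?u \<in> homogeneous_words 4"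
    using homogeneous_words_one_right[OF phi_homogeneous]
    by (simp_all add: phi(2) tensor_cat_one_right homogeneous_words_words[OF phi_homogeneous] del:
      One_nat_def)
  have "tensor_sum scale f (tensor_mult scale G 4 Phi_one (comult_at scale \<Delta> 3 1 \<Phi>)) =
      sweedler (\<lambda>p. sweedler (\<lambda>q. ?s p q) (coprod_at 1 phi)) ?u"
    unfolding Phi_comult_1(1) P(1) by (rule tensor_sum_mult[OF P(2) Phi_comult_1(2) f])
  also have "\<dots> = sweedler (\<lambda>p. sweedler (\<lambda>q. ?s (p @ [1]) q) (coprod_at 1 phi)) phi"
    by (simp add: sweedler_lin_ext sweedler_single)
  also have "\<dots> = sweedler (\<lambda>p. sweedler (\<lambda>q. h (p ! 0) (p ! 1) (p ! 2) (q ! 0) (q ! 1) (q ! 2)) phi) phi"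
    unfolding sweedler_coprod_at
  proof (intro lin_ext_cong)
    fix p q assume "p \<in> Poly_Mapping.keys phi" "q \<in> Poly_Mapping.keys phi"
    obtain x y z where p: "p = [x, y, z]" "homogeneous x" "homogeneous y" "homogeneous z"
      "parity z = parity x + parity y"
      by (rule even_words_3E[OF phi(1) \<open>p \<in> _\<close>])
    obtain a b c where q: "q = [a, b, c]" "homogeneous a" "homogeneous b" "homogeneous c"
      "parity c = parity a + parity b"
      by (rule even_words_3E[OF phi(1) \<open>q \<in> _\<close>])
    have "sweedler (\<lambda>u. ?s (p @ [1]) (take 1 q @ u @ drop (Suc 1) q)) (copr b) = sweedler
      (\<lambda>v. k x y z a b c (v ! 0) (v ! 1)) (copr b)"
    proof (rule lin_ext_cong)
      fix u assume "u \<in> Poly_Mapping.keys (copr b)"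
      then obtain b1 b2 where u: "u = [b1, b2]" "homogeneous b1" "homogeneous b2"
        "parity b = parity b1 + parity b2"
        by (rule graded_words_2E[OF copr(1)[OF q(3)]])
      show "?s (p @ [1]) (take 1 q @ u @ drop (Suc 1) q) = k x y z a b c (u ! 0) (u ! 1)"
        using step1[OF p(2-5) q(2-5) u(2-4)] by (simp add: p(1) q(1) u(1) mult_sign_4)
    qed
    then show "sweedler (\<lambda>u. ?s (p @ [1]) (take 1 q @ u @ drop (Suc 1) q)) (copr (q ! 1)) =
       h (p ! 0) (p ! 1) (p ! 2) (q ! 0) (q ! 1) (q ! 2)"
      using step2[OF p(2-4) q(2-4)] by (simp add: p(1) q(1))
  qed
  finally show ?thesis .
qed

lemma tensor_sum_one_Phiinv:
  assumes "multilinear_words scale 4 f"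
  shows "tensor_sum scale f one_Phiinv = sweedler (\<lambda>w. f (1 # w)) phi_inv"
proof -
  have "one_Phiinv = cls 4 (lin_ext free_scale (\<lambda>w. Poly_Mapping.single (1 # w) 1) phi_inv)"
    by (simp add: phi_inv(2) tensor_cat_one_left homogeneous_words_words[OF phi_inv(1)] del: One_nat_def)
  then show ?thesis
    by (simp add: tensor_sum_rep[OF assms] sweedler_lin_ext sweedler_single)
qed

text \<open>
  With the factor \<open>1 \<otimes> \<Phi>\<close> of the pentagon identity moved to the other side, the coproducts stand
  where the forms below can contract them: on the far left for the first and third factor of \<open>\<Phi>\<close>,
  on the far right for the second.
\<close>

lemma pentagon_Phiinv:
  "tensor_mult scale G 4 (comult_at scale \<Delta> 3 0 \<Phi>)
      (tensor_mult scale G 4 (comult_at scale \<Delta> 3 2 \<Phi>) one_Phiinv) =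
   tensor_mult scale G 4 Phi_one (comult_at scale \<Delta> 3 1 \<Phi>)"
proof -
  have i: "comult_at scale \<Delta> 3 0 \<Phi> \<in> tensor_power scale 4"
    "comult_at scale \<Delta> 3 1 \<Phi> \<in> tensor_power scale 4"
    "comult_at scale \<Delta> 3 2 \<Phi> \<in> tensor_power scale 4" "one_Phiinv \<in> tensor_power scale 4"
    "one_Phi \<in> tensor_power scale 4" "Phi_one \<in> tensor_power scale 4"
    using comult_at_power_in[OF Phi_in, of 0] comult_at_power_in[OF Phi_in, of 1]
      comult_at_power_in[OF Phi_in, of 2] tensor_cat_one_in[OF Phi_in] tensor_cat_one_in[OF Phiinv_in]
    by (simp_all del: One_nat_def)
  have one: "tensor_mult scale G 4 one_Phi one_Phiinv = tensor_one scale 4"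
    using tensor_cat_one_left_mult[OF Phi_in Phiinv_in] tensor_cat_one_one[of 3]
    by (simp add: Phi_Phiinv del: One_nat_def)
  have "tensor_mult scale G 4 (comult_at scale \<Delta> 3 0 \<Phi>)
      (tensor_mult scale G 4 (comult_at scale \<Delta> 3 2 \<Phi>) one_Phiinv) =
     tensor_mult scale G 4 (tensor_mult scale G 4 (comult_at scale \<Delta> 3 0 \<Phi>)
       (comult_at scale \<Delta> 3 2 \<Phi>)) one_Phiinv"
    using i by (simp add: tensor_mult_assoc)
  also have "\<dots> = tensor_mult scale G 4 (tensor_mult scale G 4 Phi_one (comult_at scale \<Delta> 3 1 \<Phi>))
      (tensor_mult scale G 4 one_Phi one_Phiinv)"
    unfolding pentagon using i by (intro tensor_mult_assoc tensor_mult_in)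
  finally show ?thesis
    unfolding one using i by (simp add: tensor_mult_one_right tensor_mult_in)
qed

section \<open>Counit identities for the outer factors of the associator\<close>

lemmas multilinear_expand = numeral_eq_Suc less_Suc_eq multilinear_simps algebra_simps

text \<open>
  Both operators turn out to be the identity for \<open>u = phi\<close>; this is what is needed of
  \<open>(\<epsilon> \<otimes> 1 \<otimes> 1)\<Phi> = 1\<close> and \<open>(1 \<otimes> 1 \<otimes> \<epsilon>)\<Phi> = 1\<close>. The argument composes the operators of \<open>\<Phi>\<close> and \<open>\<Phi>\<inverse>\<close>,
  which is why \<open>u\<close> is a parameter.
\<close>

definition left_counit :: "('a list \<Rightarrow>\<^sub>0 'k) \<Rightarrow> 'a \<Rightarrow> 'a" where
  "left_counit u m = sweedler (\<lambda>w. scale (\<epsilon> (w ! 0)) (S (w ! 1) * m * w ! 2)) u"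

definition right_counit :: "('a list \<Rightarrow>\<^sub>0 'k) \<Rightarrow> 'a \<Rightarrow> 'a" where
  "right_counit u m = sweedler (\<lambda>w. scale (\<epsilon> (w ! 2)) (S (w ! 0) * m * w ! 1)) u"

text \<open>
  The map is defined through \<open>\<Delta>\<close> itself, not through a representative, and is thus linear in \<open>a\<close>
  on all of the algebra. The normalisation of \<open>\<Phi>\<close> may then be applied to it, and this replaces \<open>a\<close>
  by \<open>1\<close>.
\<close>

definition adjoint_action :: "'a \<Rightarrow> 'a \<Rightarrow> 'a" where
  "adjoint_action m a = tensor_sum scale (\<lambda>v. S (v ! 0) * m * v ! 1) (\<Delta> a)"

lemma adjoint_action_copr: "homogeneous a \<Longrightarrow> sweedler (\<lambda>v. S (v ! 0) * m * v ! 1) (copr a) =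
  adjoint_action m a"
  unfolding adjoint_action_def by (rule tensor_sum_comult[OF _ multilinear_alpha, symmetric])

lemma adjoint_action_one: "adjoint_action m 1 = m"
proof -
  have "\<Delta> 1 = cls 2 (Poly_Mapping.single [1, 1] 1)"
    by (simp add: comult_one tensor_one_def pure_tensor_def numeral_2_eq_2)
  then show ?thesis
    by (simp only: adjoint_action_def tensor_sum_rep[OF multilinear_alpha])
      (simp add: sweedler_single antipode_one)
qed

lemma adjoint_action_add: "adjoint_action m (a + b) = adjoint_action m a + adjoint_action m b"
proof -
  obtain u v where "\<Delta> a = cls 2 u" "\<Delta> b = cls 2 v"
    using comult_in[of a] comult_in[of b] by (auto simp: tensor_power_def)
  then show ?thesis
    by (simp only: adjoint_action_def comult_add tensor_add_cls tensor_sum_rep[OF multilinear_alpha]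
      lin_ext_add[OF vector_space_scale])
qed

lemma adjoint_action_scale: "adjoint_action m (scale k a) = scale k (adjoint_action m a)"
proof -
  obtain u where "\<Delta> a = cls 2 u"
    using comult_in[of a] by (auto simp: tensor_power_def)
  then show ?thesis
    by (simp only: adjoint_action_def comult_scale tensor_scale_cls
      tensor_sum_rep[OF multilinear_alpha] lin_ext_scale[OF vector_space_scale])
qed

text \<open>
  Linear maps from the fourth tensor power to the algebra. The first two pair two factors with the
  counit and serve to prove the counit identities; the third is for the main argument.
\<close>

abbreviation left_form :: "'a \<Rightarrow> 'a list \<Rightarrow> 'a" where
  "left_form m \<equiv> \<lambda>w. scale (\<epsilon> (w ! 0)) (scale (\<epsilon> (w ! 1)) (S (w ! 2) * m * w ! 3))"

abbreviation right_form :: "'a \<Rightarrow> 'a list \<Rightarrow> 'a" where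
  "right_form m \<equiv> \<lambda>w. scale (\<epsilon> (w ! 2)) (scale (\<epsilon> (w ! 3)) (S (w ! 0) * m * w ! 1))"

abbreviation mixed_form :: "'a \<Rightarrow> 'a list \<Rightarrow> 'a" where
  "mixed_form m \<equiv> \<lambda>w. S (w ! 0) * \<alpha> * w ! 1 * \<beta> * S (w ! 2) * m * w ! 3"

lemma multilinear_left_form: "multilinear_words scale 4 (left_form m)"
  by (rule multilinear_wordsI) (auto simp: multilinear_expand)

lemma multilinear_right_form: "multilinear_words scale 4 (right_form m)"
  by (rule multilinear_wordsI) (auto simp: multilinear_expand)

lemma multilinear_mixed_form: "multilinear_words scale 4 (mixed_form m)"
  by (rule multilinear_wordsI) (auto simp: multilinear_expand)

text \<open>
  The counits turn \<open>\<Delta>(X)\<close> into \<open>\<epsilon>(X)\<close>, and the rest of \<open>\<Phi>\<close> is wrapped around \<open>m\<close>.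
\<close>

lemma left_form_comult_0:
  assumes "V \<in> tensor_power scale 4"
  shows "tensor_sum scale (left_form m)
      (tensor_mult scale G 4 (comult_at scale \<Delta> 3 0 \<Phi>) V) =
    tensor_sum scale (left_form (left_counit phi m)) V"
proof (rule tensor_sum_comult_0_mult[OF multilinear_left_form multilinear_left_form assms, where
    k = "\<lambda>x y z a b c d x1 x2. scale (\<epsilon> x1) (scale (\<epsilon> x2)
      (scale (\<epsilon> a) (scale (\<epsilon> b) (S c * (S y * m * z) * d))))"
    and h = "\<lambda>x y z a b c d. scale (\<epsilon> a) (scale (\<epsilon> b) (S c * scale (\<epsilon> x) (S y * m * z) * d))"])
  fix x y z x1 x2 a b c d
  assume h: "homogeneous x" "homogeneous y" "homogeneous z" and z: "parity z = parity x + parity y"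
    and h': "homogeneous x1" "homogeneous x2" and x: "parity x = parity x1 + parity x2"
    and h'': "homogeneous a" "homogeneous b" "homogeneous c" "homogeneous d"
  show "scale (koszul (parity x2 * parity a + parity y * (parity a + parity b) + parity z *
    (parity a + parity b + parity c)))
        (scale (\<epsilon> ([x1 * a, x2 * b, y * c, z * d] ! 0))
          (scale (\<epsilon> ([x1 * a, x2 * b, y * c, z * d] ! 1))
            (S ([x1 * a, x2 * b, y * c, z * d] ! 2) * m * [x1 * a, x2 * b, y * c, z * d] ! 3))) =
       scale (\<epsilon> x1) (scale (\<epsilon> x2) (scale (\<epsilon> a) (scale (\<epsilon> b) (S c * (S y * m * z) * d))))"
    \<comment> \<open>Either a counit vanishes or its argument is even and drops out of the sign.\<close>
    using counit_even[OF h'(1)] counit_even[OF h'(2)] counit_even[OF h''(1)] counit_even[OF h''(2)]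
    by (elim disjE) (use h h' h'' z x in \<open>simp_all add: counit_mult sign_simps\<close>)
next
  fix x y z a b c d
  assume h: "homogeneous x"
  show "sweedler (\<lambda>v. scale (\<epsilon> (v ! 0)) (scale (\<epsilon> (v ! 1))
    (scale (\<epsilon> a) (scale (\<epsilon> b) (S c * (S y * m * z) * d))))) (copr x) =
     scale (\<epsilon> a) (scale (\<epsilon> b) (S c * scale (\<epsilon> x) (S y * m * z) * d))"
    by (subst copr_counit_left[OF h, where k = "\<lambda>x. scale (\<epsilon> x)
      (scale (\<epsilon> a) (scale (\<epsilon> b) (S c * (S y * m * z) * d)))"])
       (auto intro!: multilinear_wordsI simp: multilinear_expand)
next
  fix a b c d
  show "sweedler (\<lambda>w. scale (\<epsilon> a) (scale (\<epsilon> b) (S c * scale (\<epsilon> (w ! 0)) (S (w ! 1) * m * w ! 2) *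
    d))) phi =
     scale (\<epsilon> a) (scale (\<epsilon> b) (S c * left_counit phi m * d))"
    by (simp only: sweedler_scale sweedler_sandwich left_counit_def)
qed

text \<open>
  The counits on the first two factors of \<open>\<Phi>\<close> reduce the third to \<open>1\<close>, and \<open>\<Delta>(1) = 1 \<otimes> 1\<close>.
\<close>

lemma left_form_comult_2:
  assumes "V \<in> tensor_power scale 4"
  shows "tensor_sum scale (left_form m)
      (tensor_mult scale G 4 (comult_at scale \<Delta> 3 2 \<Phi>) V) =
    tensor_sum scale (left_form m) V"
proof (rule tensor_sum_comult_2_mult[OF multilinear_left_form multilinear_left_form assms, where
    k = "\<lambda>x y z a b c d z1 z2. scale (\<epsilon> x) (scale (\<epsilon> y)
      (scale (\<epsilon> a) (scale (\<epsilon> b) (S c * (S z1 * m * z2) * d))))"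
    and h = "\<lambda>x y z a b c d. scale (\<epsilon> y) (scale (\<epsilon> x) (scale (\<epsilon> a)
      (scale (\<epsilon> b) (S c * adjoint_action m z * d))))"])
  fix x y z z1 z2 a b c d
  assume h: "homogeneous x" "homogeneous y" "homogeneous z" and z: "parity z = parity x + parity y"
    and h': "homogeneous z1" "homogeneous z2" and x: "parity z = parity z1 + parity z2"
    and h'': "homogeneous a" "homogeneous b" "homogeneous c" "homogeneous d"
  show "scale (koszul (parity y * parity a + parity z1 * (parity a + parity b) + parity z2 *
    (parity a + parity b + parity c)))
        (scale (\<epsilon> ([x * a, y * b, z1 * c, z2 * d] ! 0))
          (scale (\<epsilon> ([x * a, y * b, z1 * c, z2 * d] ! 1))
            (S ([x * a, y * b, z1 * c, z2 * d] ! 2) * m * [x * a, y * b, z1 * c, z2 * d] ! 3))) =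
       scale (\<epsilon> x) (scale (\<epsilon> y) (scale (\<epsilon> a) (scale (\<epsilon> b) (S c * (S z1 * m * z2) * d))))"
  proof -
    have "parity z2 = parity x + parity y + parity z1"
      using z x by (cases "parity z1"; cases "parity z2") auto
    then show ?thesis
      \<comment> \<open>Either a counit vanishes or its argument is even and drops out of the sign.\<close>
      using counit_even[OF h(1)] counit_even[OF h(2)] counit_even[OF h''(1)] counit_even[OF h''(2)]
        h h' h''
      by (elim disjE) (simp_all add: counit_mult sign_simps)
  qed
next
  fix x y z a b c d
  assume h: "homogeneous z"
  show "sweedler (\<lambda>v. scale (\<epsilon> x) (scale (\<epsilon> y) (scale (\<epsilon> a)
    (scale (\<epsilon> b) (S c * (S (v ! 0) * m * v ! 1) * d))))) (copr z) =
     scale (\<epsilon> y) (scale (\<epsilon> x) (scale (\<epsilon> a) (scale (\<epsilon> b) (S c * adjoint_action m z * d))))"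
    unfolding sweedler_scale sweedler_sandwich adjoint_action_copr[OF h] by (simp add: mult.commute)
next
  fix a b c d
  show "sweedler (\<lambda>w. scale (\<epsilon> (w ! 1)) (scale (\<epsilon> (w ! 0))
    (scale (\<epsilon> a) (scale (\<epsilon> b) (S c * adjoint_action m (w ! 2) * d))))) phi =
     scale (\<epsilon> a) (scale (\<epsilon> b) (S c * m * d))"
    by (subst phi_counit_mid[where g = "\<lambda>x z. scale (\<epsilon> x)
      (scale (\<epsilon> a) (scale (\<epsilon> b) (S c * adjoint_action m z * d)))"])
       (auto intro!: multilinear_wordsI simp: multilinear_expand adjoint_action_add
         adjoint_action_scale adjoint_action_one counit_one)
qed

text \<open>
  The left-hand \<open>\<Phi>\<close> disappears, as two of its factors meet a counit; in the right-hand one the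
  counit recovers the middle factor from its coproduct.
\<close>

lemma left_form_Phi_one_comult_1:
  "tensor_sum scale (left_form m)
      (tensor_mult scale G 4 Phi_one (comult_at scale \<Delta> 3 1 \<Phi>)) = left_counit phi m"
proof -
  have "tensor_sum scale (left_form m)
      (tensor_mult scale G 4 Phi_one (comult_at scale \<Delta> 3 1 \<Phi>)) =
    sweedler (\<lambda>p. sweedler (\<lambda>q. scale (\<epsilon> (p ! 1)) (scale (\<epsilon> (p ! 0))
      (scale (\<epsilon> (q ! 0)) (S (q ! 1) * S (p ! 2) * m * q ! 2)))) phi) phi"
  proof (rule tensor_sum_Phi_one_comult_1[OF multilinear_left_form, where
    k = "\<lambda>x y z a b c b1 b2. scale (\<epsilon> b1) (scale (\<epsilon> y) (scale (\<epsilon> x)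
      (scale (\<epsilon> a) (S b2 * S z * m * c))))"])
    fix x y z a b c b1 b2
    assume h: "homogeneous x" "homogeneous y" "homogeneous z" and z: "parity z = parity x + parity y"
      and h': "homogeneous a" "homogeneous b" "homogeneous c" and c: "parity c = parity a + parity b"
      and h'': "homogeneous b1" "homogeneous b2" and b: "parity b = parity b1 + parity b2"
    show "scale (koszul (parity y * parity a + parity z * (parity a + parity b1)))
        (scale (\<epsilon> ([x * a, y * b1, z * b2, c] ! 0)) (scale (\<epsilon> ([x * a, y * b1, z * b2, c] ! 1))
           (S ([x * a, y * b1, z * b2, c] ! 2) * m * [x * a, y * b1, z * b2, c] ! 3))) =
        scale (\<epsilon> b1) (scale (\<epsilon> y) (scale (\<epsilon> x) (scale (\<epsilon> a) (S b2 * S z * m * c))))"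
      \<comment> \<open>Either a counit vanishes or its argument is even and drops out of the sign.\<close>
      using counit_even[OF h(1)] counit_even[OF h(2)] counit_even[OF h'(1)] counit_even[OF h''(1)]
      by (elim disjE) (use h h' h'' z in \<open>simp_all add: counit_mult mult.commute sign_simps\<close>)
  next
    fix x y z a b c
    assume h: "homogeneous b"
    show "sweedler (\<lambda>v. scale (\<epsilon> (v ! 0)) (scale (\<epsilon> y) (scale (\<epsilon> x)
      (scale (\<epsilon> a) (S (v ! 1) * S z * m * c))))) (copr b) =
      scale (\<epsilon> y) (scale (\<epsilon> x) (scale (\<epsilon> a) (S b * S z * m * c)))"
      by (subst copr_counit_left[OF h, where k = "\<lambda>b. scale (\<epsilon> y)
        (scale (\<epsilon> x) (scale (\<epsilon> a) (S b * S z * m * c)))"])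
       (auto intro!: multilinear_wordsI simp: multilinear_expand)
  qed
  also have "\<dots> = sweedler (\<lambda>q. sweedler (\<lambda>p. scale (\<epsilon> (p ! 1))
    (scale (\<epsilon> (p ! 0)) (scale (\<epsilon> (q ! 0)) (S (q ! 1) * S (p ! 2) * m * q ! 2)))) phi) phi"
    by (rule sweedler_swap)
  also have "\<dots> = sweedler (\<lambda>q. scale (\<epsilon> (q ! 0)) (S (q ! 1) * m * q ! 2)) phi"
  proof (rule lin_ext_cong)
    fix q
    show "sweedler (\<lambda>p. scale (\<epsilon> (p ! 1)) (scale (\<epsilon> (p ! 0))
      (scale (\<epsilon> (q ! 0)) (S (q ! 1) * S (p ! 2) * m * q ! 2)))) phi
      = scale (\<epsilon> (q ! 0)) (S (q ! 1) * m * q ! 2)"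
      by (subst phi_counit_mid[where g = "\<lambda>x z. scale (\<epsilon> x)
        (scale (\<epsilon> (q ! 0)) (S (q ! 1) * S z * m * q ! 2))"])
       (auto intro!: multilinear_wordsI simp: multilinear_expand counit_one antipode_one)
  qed
  finally show ?thesis by (simp add: left_counit_def)
qed

lemma left_form_one_Phiinv:
  "tensor_sum scale (left_form m) one_Phiinv
    = left_counit phi_inv m"
  unfolding tensor_sum_one_Phiinv[OF multilinear_left_form] left_counit_def
  by (rule lin_ext_cong) (auto simp: counit_one elim!: homogeneous_words_3E[OF phi_inv(1)])

lemma tensor_sum_Phi_Phiinv:
  assumes "multilinear_words scale 3 f"
  shows "f [1, 1, 1] = sweedler (\<lambda>q. sweedler (\<lambda>p. scale (mult_sign 3 (map parity p) (map parity q))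
    (f (map2 (*) p q))) phi) phi_inv"
proof -
  have "tensor_one scale 3 = cls 3 (Poly_Mapping.single [1, 1, 1] 1)"
    by (simp add: tensor_one_def pure_tensor_def numeral_3_eq_3)
  then have "tensor_sum scale f (tensor_one scale 3) = f [1, 1, 1]"
    by (simp add: tensor_sum_rep[OF assms] sweedler_single)
  moreover have "tensor_sum scale f (tensor_mult scale G 3 \<Phi> \<Phi>inv) =
    sweedler (\<lambda>q. sweedler (\<lambda>p. scale (mult_sign 3 (map parity p) (map parity q))
      (f (map2 (*) p q))) phi) phi_inv"
    unfolding phi(2) phi_inv(2) sweedler_swap[of _ _ phi_inv]
    by (rule tensor_sum_mult[OF phi_homogeneous phi_inv(1) assms])
  ultimately show ?thesis by (simp only: Phi_Phiinv)
qed

text \<open>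
  This is \<open>\<Phi> \<Phi>\<inverse> = 1\<close> under \<open>x \<otimes> y \<otimes> z \<mapsto> \<epsilon>(x) S(y) m z\<close>. The antipode reverses the order, so the
  operator of \<open>\<Phi>\<close> acts first.
\<close>

lemma left_counit_inverse: "left_counit phi_inv (left_counit phi m) = m"
proof -
  let ?h = "\<lambda>w. scale (\<epsilon> (w ! 0)) (S (w ! 1) * m * w ! 2)"
  have ml: "multilinear_words scale 3 ?h"
    by (rule multilinear_wordsI) (auto simp: multilinear_expand)
  have "m = sweedler (\<lambda>q. sweedler (\<lambda>p. scale (mult_sign 3 (map parity p) (map parity q))
    (?h (map2 (*) p q))) phi) phi_inv"
    using tensor_sum_Phi_Phiinv[OF ml] by (simp add: counit_one antipode_one)
  also have "\<dots> = sweedler (\<lambda>q. sweedler (\<lambda>p. scale (\<epsilon> (q ! 0))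
    (S (q ! 1) * scale (\<epsilon> (p ! 0)) (S (p ! 1) * m * p ! 2) * q ! 2)) phi) phi_inv"
  proof (intro lin_ext_cong)
    fix p q assume "p \<in> Poly_Mapping.keys phi" "q \<in> Poly_Mapping.keys phi_inv"
    obtain x y z where p: "p = [x, y, z]" "homogeneous x" "homogeneous y" "homogeneous z"
      "parity z = parity x + parity y"
      by (rule even_words_3E[OF phi(1) \<open>p \<in> _\<close>])
    obtain a b c where q: "q = [a, b, c]" "homogeneous a" "homogeneous b" "homogeneous c"
      by (rule homogeneous_words_3E[OF phi_inv(1) \<open>q \<in> _\<close>])
    show "scale (mult_sign 3 (map parity p) (map parity q)) (?h (map2 (*) p q)) =
      scale (\<epsilon> (q ! 0)) (S (q ! 1) * scale (\<epsilon> (p ! 0)) (S (p ! 1) * m * p ! 2) * q ! 2)"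
      \<comment> \<open>Either a counit vanishes or its argument is even and drops out of the sign.\<close>
      using counit_even[OF p(2)] counit_even[OF q(2)]
      by (elim disjE) (use p q in \<open>simp_all add: mult_sign_3 counit_mult mult.commute sign_simps\<close>)
  qed
  also have "\<dots> = left_counit phi_inv (left_counit phi m)"
    by (simp only: sweedler_scale sweedler_sandwich left_counit_def)
  finally show ?thesis ..
qed

text \<open>
  With \<open>P\<close> for the operator of \<open>\<Phi>\<close> and \<open>Q\<close> for that of \<open>\<Phi>\<inverse>\<close>, the pentagon identity under
  \<open>\<epsilon> \<otimes> \<epsilon> \<otimes> S(\<cdot>) m (\<cdot>)\<close> reads \<open>Q (P m) = P m\<close>, and \<open>Q (P m) = m\<close>.
\<close>

lemma left_counit_Phi: "left_counit phi m = m"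
proof -
  have i: "one_Phiinv \<in> tensor_power scale 4" "comult_at scale \<Delta> 3 2 \<Phi> \<in> tensor_power scale 4"
    using comult_at_power_in[OF Phi_in, of 2] tensor_cat_one_in[OF Phiinv_in] by
      (simp_all del: One_nat_def)
  show ?thesis
    using left_form_Phi_one_comult_1[of m] left_form_comult_0[OF tensor_mult_in[OF i(2,1)], of m]
    unfolding pentagon_Phiinv left_form_comult_2[OF i(1)] left_form_one_Phiinv left_counit_inverse
      by simp
qed

text \<open>
  The counits on the last two factors of \<open>\<Phi>\<close> reduce the first to \<open>1\<close>, whose coproduct is \<open>1 \<otimes> 1\<close>.
\<close>

lemma right_form_comult_0:
  assumes "V \<in> tensor_power scale 4"
  shows "tensor_sum scale (right_form m)
      (tensor_mult scale G 4 (comult_at scale \<Delta> 3 0 \<Phi>) V) =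
    tensor_sum scale (right_form m) V"
proof (rule tensor_sum_comult_0_mult[OF multilinear_right_form multilinear_right_form assms, where
    k = "\<lambda>x y z a b c d x1 x2. scale (\<epsilon> y) (scale (\<epsilon> z)
      (scale (\<epsilon> c) (scale (\<epsilon> d) (S a * (S x1 * m * x2) * b))))"
    and h = "\<lambda>x y z a b c d. scale (\<epsilon> y) (scale (\<epsilon> z) (scale (\<epsilon> c)
      (scale (\<epsilon> d) (S a * adjoint_action m x * b))))"])
  fix x y z x1 x2 a b c d
  assume h: "homogeneous x" "homogeneous y" "homogeneous z" and z: "parity z = parity x + parity y"
    and h': "homogeneous x1" "homogeneous x2" and x: "parity x = parity x1 + parity x2"
    and h'': "homogeneous a" "homogeneous b" "homogeneous c" "homogeneous d"
  show "scale (koszul (parity x2 * parity a + parity y * (parity a + parity b) + parity z *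
    (parity a + parity b + parity c)))
        (scale (\<epsilon> ([x1 * a, x2 * b, y * c, z * d] ! 2))
          (scale (\<epsilon> ([x1 * a, x2 * b, y * c, z * d] ! 3))
            (S ([x1 * a, x2 * b, y * c, z * d] ! 0) * m * [x1 * a, x2 * b, y * c, z * d] ! 1))) =
       scale (\<epsilon> y) (scale (\<epsilon> z) (scale (\<epsilon> c) (scale (\<epsilon> d) (S a * (S x1 * m * x2) * b))))"
  proof -
    have "parity x2 = parity y + parity z + parity x1"
      using z x by (cases "parity x1"; cases "parity x2"; cases "parity y") auto
    then show ?thesis
      \<comment> \<open>Either a counit vanishes or its argument is even and drops out of the sign.\<close>
      using counit_even[OF h(2)] counit_even[OF h(3)] counit_even[OF h''(3)] counit_even[OF h''(4)]
        h h' h''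
      by (elim disjE) (simp_all add: counit_mult sign_simps)
  qed
next
  fix x y z a b c d
  assume h: "homogeneous x"
  show "sweedler (\<lambda>v. scale (\<epsilon> y) (scale (\<epsilon> z) (scale (\<epsilon> c)
    (scale (\<epsilon> d) (S a * (S (v ! 0) * m * v ! 1) * b))))) (copr x) =
     scale (\<epsilon> y) (scale (\<epsilon> z) (scale (\<epsilon> c) (scale (\<epsilon> d) (S a * adjoint_action m x * b))))"
    unfolding sweedler_scale sweedler_sandwich adjoint_action_copr[OF h] ..
next
  fix a b c d
  show "sweedler (\<lambda>w. scale (\<epsilon> (w ! 1)) (scale (\<epsilon> (w ! 2))
    (scale (\<epsilon> c) (scale (\<epsilon> d) (S a * adjoint_action m (w ! 0) * b))))) phi =
     scale (\<epsilon> c) (scale (\<epsilon> d) (S a * m * b))"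
    by (subst phi_counit_mid[where g = "\<lambda>x z. scale (\<epsilon> z)
      (scale (\<epsilon> c) (scale (\<epsilon> d) (S a * adjoint_action m x * b)))"])
       (auto intro!: multilinear_wordsI simp: multilinear_expand adjoint_action_add
         adjoint_action_scale adjoint_action_one counit_one)
qed

text \<open>
  The counits turn \<open>\<Delta>(Z)\<close> into \<open>\<epsilon>(Z)\<close>, and the rest of \<open>\<Phi>\<close> is wrapped around \<open>m\<close>.
\<close>

lemma right_form_comult_2:
  assumes "V \<in> tensor_power scale 4"
  shows "tensor_sum scale (right_form m)
      (tensor_mult scale G 4 (comult_at scale \<Delta> 3 2 \<Phi>) V) =
    tensor_sum scale (right_form (right_counit phi m)) V"
proof (rule tensor_sum_comult_2_mult[OF multilinear_right_form multilinear_right_form assms, where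
    k = "\<lambda>x y z a b c d z1 z2. scale (\<epsilon> z1) (scale (\<epsilon> z2)
      (scale (\<epsilon> c) (scale (\<epsilon> d) (S a * (S x * m * y) * b))))"
    and h = "\<lambda>x y z a b c d. scale (\<epsilon> c) (scale (\<epsilon> d) (S a * scale (\<epsilon> z) (S x * m * y) * b))"])
  fix x y z z1 z2 a b c d
  assume h: "homogeneous x" "homogeneous y" "homogeneous z" and z: "parity z = parity x + parity y"
    and h': "homogeneous z1" "homogeneous z2" and x: "parity z = parity z1 + parity z2"
    and h'': "homogeneous a" "homogeneous b" "homogeneous c" "homogeneous d"
  show "scale (koszul (parity y * parity a + parity z1 * (parity a + parity b) + parity z2 *
    (parity a + parity b + parity c)))
        (scale (\<epsilon> ([x * a, y * b, z1 * c, z2 * d] ! 2))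
          (scale (\<epsilon> ([x * a, y * b, z1 * c, z2 * d] ! 3))
            (S ([x * a, y * b, z1 * c, z2 * d] ! 0) * m * [x * a, y * b, z1 * c, z2 * d] ! 1))) =
       scale (\<epsilon> z1) (scale (\<epsilon> z2) (scale (\<epsilon> c) (scale (\<epsilon> d) (S a * (S x * m * y) * b))))"
  proof -
    have "parity y = parity x + parity z1 + parity z2"
    proof -
      have "parity y = parity x + parity z"
        using z by simp
      then show ?thesis unfolding x by (simp only: add.assoc)
    qed
    then show ?thesis
      \<comment> \<open>Either a counit vanishes or its argument is even and drops out of the sign.\<close>
      using counit_even[OF h'(1)] counit_even[OF h'(2)] counit_even[OF h''(3)]
        counit_even[OF h''(4)] h h' h''
      by (elim disjE) (simp_all add: counit_mult sign_simps)
  qed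
next
  fix x y z a b c d
  assume h: "homogeneous z"
  show "sweedler (\<lambda>v. scale (\<epsilon> (v ! 0)) (scale (\<epsilon> (v ! 1))
    (scale (\<epsilon> c) (scale (\<epsilon> d) (S a * (S x * m * y) * b))))) (copr z) =
     scale (\<epsilon> c) (scale (\<epsilon> d) (S a * scale (\<epsilon> z) (S x * m * y) * b))"
    by (subst copr_counit_left[OF h, where k = "\<lambda>z. scale (\<epsilon> z)
      (scale (\<epsilon> c) (scale (\<epsilon> d) (S a * (S x * m * y) * b)))"])
       (auto intro!: multilinear_wordsI simp: multilinear_expand)
next
  fix a b c d
  show "sweedler (\<lambda>w. scale (\<epsilon> c) (scale (\<epsilon> d) (S a * scale (\<epsilon> (w ! 2)) (S (w ! 0) * m * w ! 1) *
    b))) phi =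
     scale (\<epsilon> c) (scale (\<epsilon> d) (S a * right_counit phi m * b))"
    by (simp only: sweedler_scale sweedler_sandwich right_counit_def)
qed

text \<open>
  Here each of the two copies of \<open>\<Phi>\<close> keeps one counit, so both are wrapped around \<open>m\<close>.
\<close>

lemma right_form_Phi_one_comult_1:
  "tensor_sum scale (right_form m)
      (tensor_mult scale G 4 Phi_one (comult_at scale \<Delta> 3 1 \<Phi>)) = right_counit phi (right_counit phi m)"
proof -
  have "tensor_sum scale (right_form m)
      (tensor_mult scale G 4 Phi_one (comult_at scale \<Delta> 3 1 \<Phi>)) =
    sweedler (\<lambda>p. sweedler (\<lambda>q. scale (\<epsilon> (q ! 2)) (S (q ! 0) * scale (\<epsilon> (p ! 2))
      (S (p ! 0) * m * p ! 1) * q ! 1)) phi) phi"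
  proof (rule tensor_sum_Phi_one_comult_1[OF multilinear_right_form, where
    k = "\<lambda>x y z a b c b1 b2. scale (\<epsilon> b2) (scale (\<epsilon> c) (S a * scale (\<epsilon> z) (S x * m * y) * b1))"])
    fix x y z a b c b1 b2
    assume h: "homogeneous x" "homogeneous y" "homogeneous z" and z: "parity z = parity x + parity y"
      and h': "homogeneous a" "homogeneous b" "homogeneous c" and c: "parity c = parity a + parity b"
      and h'': "homogeneous b1" "homogeneous b2" and b: "parity b = parity b1 + parity b2"
    show "scale (koszul (parity y * parity a + parity z * (parity a + parity b1)))
        (scale (\<epsilon> ([x * a, y * b1, z * b2, c] ! 2)) (scale (\<epsilon> ([x * a, y * b1, z * b2, c] ! 3))
           (S ([x * a, y * b1, z * b2, c] ! 0) * m * [x * a, y * b1, z * b2, c] ! 1))) =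
        scale (\<epsilon> b2) (scale (\<epsilon> c) (S a * scale (\<epsilon> z) (S x * m * y) * b1))"
    proof -
      have "parity y = parity x + parity z"
        using z by simp
      then show ?thesis
      \<comment> \<open>Either a counit vanishes or its argument is even and drops out of the sign.\<close>
      using counit_even[OF h(3)] h h' h'' by (elim disjE)
        (simp_all add: counit_mult mult.commute sign_simps)
    qed
  next
    fix x y z a b c
    assume h: "homogeneous b"
    show "sweedler (\<lambda>v. scale (\<epsilon> (v ! 1)) (scale (\<epsilon> c) (S a * scale (\<epsilon> z) (S x * m * y) * v ! 0)))
      (copr b) =
      scale (\<epsilon> c) (S a * scale (\<epsilon> z) (S x * m * y) * b)"
      by (subst copr_counit_right[OF h, where k = "\<lambda>b. scale (\<epsilon> c)
        (S a * scale (\<epsilon> z) (S x * m * y) * b)"])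
       (auto intro!: multilinear_wordsI simp: multilinear_expand)
  qed
  also have "\<dots> = right_counit phi (right_counit phi m)"
    by (subst sweedler_swap) (simp only: sweedler_scale sweedler_sandwich right_counit_def)
  finally show ?thesis .
qed

text \<open>
  The claim is \<open>\<Sum> \<epsilon>(Yb) \<epsilon>(Zb) Xb = 1\<close>, which follows from \<open>\<Phi> \<Phi>\<inverse> = 1\<close> since the same sum for \<open>\<Phi>\<close> is
  \<open>1\<close>.
\<close>

lemma right_form_one_Phiinv:
  "tensor_sum scale (right_form m) one_Phiinv = m"
proof -
  let ?e = "sweedler (\<lambda>w. scale (\<epsilon> (w ! 1)) (scale (\<epsilon> (w ! 2)) (w ! 0)))"
  have "tensor_sum scale (right_form m) one_Phiinv
    = sweedler (\<lambda>w. m * scale (\<epsilon> (w ! 1)) (scale (\<epsilon> (w ! 2)) (w ! 0)) * 1) phi_inv"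
    unfolding tensor_sum_one_Phiinv[OF multilinear_right_form]
    by (rule lin_ext_cong) (auto simp: antipode_one scale_mult_right elim!:
      homogeneous_words_3E[OF phi_inv(1)])
  also have "\<dots> = m * ?e phi_inv"
    unfolding sweedler_sandwich by simp
  also have "?e phi_inv = 1"
  proof -
    let ?h = "\<lambda>w. scale (\<epsilon> (w ! 1)) (scale (\<epsilon> (w ! 2)) (w ! 0))"
    have ml: "multilinear_words scale 3 ?h"
      by (rule multilinear_wordsI) (auto simp: multilinear_expand)
    have "1 = sweedler (\<lambda>q. sweedler (\<lambda>p. scale (mult_sign 3 (map parity p) (map parity q))
      (?h (map2 (*) p q))) phi) phi_inv"
      using tensor_sum_Phi_Phiinv[OF ml] by (simp add: counit_one)
    also have "\<dots> = sweedler (\<lambda>q. sweedler (\<lambda>p. 1 * ?h p * ?h q) phi) phi_inv"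
    proof (intro lin_ext_cong)
      fix p q assume "p \<in> Poly_Mapping.keys phi" "q \<in> Poly_Mapping.keys phi_inv"
      obtain x y z where p: "p = [x, y, z]" "homogeneous x" "homogeneous y" "homogeneous z"
        "parity z = parity x + parity y"
        by (rule even_words_3E[OF phi(1) \<open>p \<in> _\<close>])
      obtain a b c where q: "q = [a, b, c]" "homogeneous a" "homogeneous b" "homogeneous c"
        by (rule homogeneous_words_3E[OF phi_inv(1) \<open>q \<in> _\<close>])
      show "scale (mult_sign 3 (map parity p) (map parity q)) (?h (map2 (*) p q)) = 1 * ?h p * ?h q"
        \<comment> \<open>Either a counit vanishes or its argument is even and drops out of the sign.\<close>
        using counit_even[OF p(3)] counit_even[OF p(4)]
        by (elim disjE) (use p q in \<open>simp_all add: mult_sign_3 counit_mult mult_ac scale_mult_left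
          scale_mult_right\<close>)
    qed
    also have "\<dots> = sweedler (\<lambda>q. 1 * ?h q * 1) phi_inv"
      unfolding sweedler_sandwich
      by (subst phi_counit_mid[where g = "\<lambda>x z. scale (\<epsilon> z) x"])
       (auto intro!: multilinear_wordsI simp: multilinear_expand counit_one)
    finally show ?thesis unfolding sweedler_sandwich by simp
  qed
  finally show ?thesis by simp
qed

lemma right_counit_inverse: "right_counit phi_inv (right_counit phi m) = m"
proof -
  let ?h = "\<lambda>w. scale (\<epsilon> (w ! 2)) (S (w ! 0) * m * w ! 1)"
  have ml: "multilinear_words scale 3 ?h"
    by (rule multilinear_wordsI) (auto simp: multilinear_expand)
  have "m = sweedler (\<lambda>q. sweedler (\<lambda>p. scale (mult_sign 3 (map parity p) (map parity q))
    (?h (map2 (*) p q))) phi) phi_inv"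
    using tensor_sum_Phi_Phiinv[OF ml] by (simp add: counit_one antipode_one)
  also have "\<dots> = sweedler (\<lambda>q. sweedler (\<lambda>p. scale (\<epsilon> (q ! 2))
    (S (q ! 0) * scale (\<epsilon> (p ! 2)) (S (p ! 0) * m * p ! 1) * q ! 1)) phi) phi_inv"
  proof (intro lin_ext_cong)
    fix p q assume "p \<in> Poly_Mapping.keys phi" "q \<in> Poly_Mapping.keys phi_inv"
    obtain x y z where p: "p = [x, y, z]" "homogeneous x" "homogeneous y" "homogeneous z"
      "parity z = parity x + parity y"
      by (rule even_words_3E[OF phi(1) \<open>p \<in> _\<close>])
    obtain a b c where q: "q = [a, b, c]" "homogeneous a" "homogeneous b" "homogeneous c"
      by (rule homogeneous_words_3E[OF phi_inv(1) \<open>q \<in> _\<close>])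
    have "parity y = parity x + parity z"
      using p(5) by simp
    then show "scale (mult_sign 3 (map parity p) (map parity q)) (?h (map2 (*) p q)) =
      scale (\<epsilon> (q ! 2)) (S (q ! 0) * scale (\<epsilon> (p ! 2)) (S (p ! 0) * m * p ! 1) * q ! 1)"
      \<comment> \<open>Either a counit vanishes or its argument is even and drops out of the sign.\<close>
      using counit_even[OF p(4)] p(1-4) q
      by (elim disjE) (simp_all add: mult_sign_3 counit_mult mult.commute sign_simps)
  qed
  also have "\<dots> = right_counit phi_inv (right_counit phi m)"
    by (simp only: sweedler_scale sweedler_sandwich right_counit_def)
  finally show ?thesis ..
qed

text \<open>
  In this case the pentagon identity makes the operator of \<open>\<Phi>\<close> idempotent, and it is injective by
  \<open>right_counit_inverse\<close>.
\<close>

lemma right_counit_Phi: "right_counit phi m = m"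
proof -
  have i: "one_Phiinv \<in> tensor_power scale 4" "comult_at scale \<Delta> 3 2 \<Phi> \<in> tensor_power scale 4"
    using comult_at_power_in[OF Phi_in, of 2] tensor_cat_one_in[OF Phiinv_in] by
      (simp_all del: One_nat_def)
  have "right_counit phi (right_counit phi m) = right_counit phi m"
    using right_form_Phi_one_comult_1[of m] right_form_comult_0[OF tensor_mult_in[OF i(2,1)], of m]
    unfolding pentagon_Phiinv right_form_comult_2[OF i(1)] right_form_one_Phiinv by simp
  then show ?thesis
    using right_counit_inverse[of m] right_counit_inverse[of "right_counit phi m"] by simp
qed

section \<open>Pseudo-invariants are central multiples of the canonical element\<close>

text \<open>
  The coproduct around \<open>\<alpha>\<close> contracts to \<open>\<epsilon>(X)\<close>; the remaining sum \<open>\<Sum> \<epsilon>(X) S(Y) m Z\<close> is \<open>m\<close>.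
\<close>

lemma mixed_form_comult_0:
  assumes "V \<in> tensor_power scale 4"
  shows "tensor_sum scale (mixed_form m)
      (tensor_mult scale G 4 (comult_at scale \<Delta> 3 0 \<Phi>) V) =
    tensor_sum scale (mixed_form m) V"
proof (rule tensor_sum_comult_0_mult[OF multilinear_mixed_form multilinear_mixed_form assms, where
    k = "\<lambda>x y z a b c d x1 x2. scale (koszul (parity x * (parity b + parity c)))
      (S a * (S x1 * \<alpha> * x2) * (b * \<beta> * S c * (S y * m * z) * d))"
    and h = "\<lambda>x y z a b c d. (S a * \<alpha> * b * \<beta> * S c) * scale (\<epsilon> x) (S y * m * z) * d"])
  fix x y z x1 x2 a b c d
  assume h: "homogeneous x" "homogeneous y" "homogeneous z" and z: "parity z = parity x + parity y"
    and h': "homogeneous x1" "homogeneous x2" and x: "parity x = parity x1 + parity x2"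
    and h'': "homogeneous a" "homogeneous b" "homogeneous c" "homogeneous d"
  show "scale (koszul (parity x2 * parity a + parity y * (parity a + parity b) + parity z *
    (parity a + parity b + parity c)))
        (S ([x1 * a, x2 * b, y * c, z * d] ! 0) * \<alpha> * [x1 * a, x2 * b, y * c, z * d] ! 1 * \<beta> *
           S ([x1 * a, x2 * b, y * c, z * d] ! 2) * m * [x1 * a, x2 * b, y * c, z * d] ! 3) =
      scale (koszul (parity x * (parity b + parity c)))
        (S a * (S x1 * \<alpha> * x2) * (b * \<beta> * S c * (S y * m * z) * d))"
    using h h' h'' z x by (simp add: sign_simps)
next
  fix x y z a b c d
  assume h: "homogeneous x"
  show "sweedler (\<lambda>v. scale (koszul (parity x * (parity b + parity c)))
       (S a * (S (v ! 0) * \<alpha> * v ! 1) * (b * \<beta> * S c * (S y * m * z) * d))) (copr x) =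
     (S a * \<alpha> * b * \<beta> * S c) * scale (\<epsilon> x) (S y * m * z) * d"
    by (subst coproduct_absorbed[OF h copr_alpha[OF h]])
      (simp add: scale_mult_left scale_mult_right mult.assoc)
next
  fix a b c d
  show "sweedler (\<lambda>w. (S a * \<alpha> * b * \<beta> * S c) * scale (\<epsilon> (w ! 0)) (S (w ! 1) * m * w ! 2) * d) phi =
     S a * \<alpha> * b * \<beta> * S c * m * d"
    using left_counit_Phi[of m] by (simp only: sweedler_sandwich left_counit_def)
qed

text \<open>
  The coproduct around \<open>m\<close> contracts to \<open>\<epsilon>(Z)\<close>; the remaining sum \<open>\<Sum> \<epsilon>(Z) S(X) \<alpha> Y\<close> is \<open>\<alpha>\<close>.
\<close>

lemma mixed_form_comult_2:
  assumes "V \<in> tensor_power scale 4"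
    and inv: "\<And>b. homogeneous b \<Longrightarrow> sweedler (\<lambda>w. S (w ! 0) * m * w ! 1) (copr b) = scale (\<epsilon> b) m"
  shows "tensor_sum scale (mixed_form m)
      (tensor_mult scale G 4 (comult_at scale \<Delta> 3 2 \<Phi>) V) =
    tensor_sum scale (mixed_form m) V"
proof (rule tensor_sum_comult_2_mult[OF multilinear_mixed_form multilinear_mixed_form assms(1), where
    k = "\<lambda>x y z a b c d z1 z2. scale (koszul (parity z * (parity b + parity c)))
      ((S a * (S x * \<alpha> * y) * b * \<beta> * S c) * (S z1 * m * z2) * d)"
    and h = "\<lambda>x y z a b c d. S a * scale (\<epsilon> z) (S x * \<alpha> * y) * (b * \<beta> * S c * m * d)"])
  fix x y z z1 z2 a b c d
  assume h: "homogeneous x" "homogeneous y" "homogeneous z" and z: "parity z = parity x + parity y"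
    and h': "homogeneous z1" "homogeneous z2" and x: "parity z = parity z1 + parity z2"
    and h'': "homogeneous a" "homogeneous b" "homogeneous c" "homogeneous d"
  have "parity y = parity x + parity z1 + parity z2"
  proof -
    have "parity y = parity x + parity z"
      using z by simp
    then show ?thesis unfolding x by (simp only: add.assoc)
  qed
  then show "scale (koszul (parity y * parity a + parity z1 * (parity a + parity b) + parity z2 *
    (parity a + parity b + parity c)))
        (S ([x * a, y * b, z1 * c, z2 * d] ! 0) * \<alpha> * [x * a, y * b, z1 * c, z2 * d] ! 1 * \<beta> *
           S ([x * a, y * b, z1 * c, z2 * d] ! 2) * m * [x * a, y * b, z1 * c, z2 * d] ! 3) =
      scale (koszul (parity z * (parity b + parity c)))
      ((S a * (S x * \<alpha> * y) * b * \<beta> * S c) * (S z1 * m * z2) * d)"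
    using h h' h'' x by (simp add: sign_simps)
next
  fix x y z a b c d
  assume h: "homogeneous z"
  show "sweedler (\<lambda>v. scale (koszul (parity z * (parity b + parity c)))
      ((S a * (S x * \<alpha> * y) * b * \<beta> * S c) * (S (v ! 0) * m * v ! 1) * d)) (copr z) =
     S a * scale (\<epsilon> z) (S x * \<alpha> * y) * (b * \<beta> * S c * m * d)"
    by (subst coproduct_absorbed[OF h inv[OF h]]) (simp add: scale_mult_left scale_mult_right mult.assoc)
next
  fix a b c d
  show "sweedler (\<lambda>w. S a * scale (\<epsilon> (w ! 2)) (S (w ! 0) * \<alpha> * w ! 1) * (b * \<beta> * S c * m * d)) phi =
     S a * \<alpha> * b * \<beta> * S c * m * d"
    unfolding sweedler_sandwich right_counit_Phi[of \<alpha>, unfolded right_counit_def] by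
      (simp only: mult.assoc)
qed

lemma multilinear_antipode_Phi:
  "multilinear_words scale 3 (\<lambda>w. S (w ! 0) * m * w ! 1 * \<beta> * S (w ! 2))"
  by (rule multilinear_wordsI) (auto simp: multilinear_expand)

lemma phi_antipode: "sweedler (\<lambda>w. S (w ! 0) * \<alpha> * w ! 1 * \<beta> * S (w ! 2)) phi = 1"
  using antipode_Phi unfolding phi(2) tensor_sum_rep[OF multilinear_antipode_Phi] .

text \<open>
  The coproduct around \<open>\<beta>\<close> contracts to the counit on the middle factor of the right-hand \<open>\<Phi>\<close>,
  which is thereby replaced by \<open>1 \<otimes> 1\<close>.
\<close>

lemma mixed_form_Phi_one_comult_1:
  "tensor_sum scale (mixed_form m)
      (tensor_mult scale G 4 Phi_one (comult_at scale \<Delta> 3 1 \<Phi>)) = m"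
proof -
  let ?f = "\<lambda>w. S (w ! 0) * \<alpha> * w ! 1 * \<beta> * S (w ! 2)"
  have "tensor_sum scale (mixed_form m)
      (tensor_mult scale G 4 Phi_one (comult_at scale \<Delta> 3 1 \<Phi>)) =
    sweedler (\<lambda>p. sweedler (\<lambda>q. scale (\<epsilon> (q ! 1)) (S (q ! 0) *
       (S (p ! 0) * \<alpha> * p ! 1 * \<beta> * S (p ! 2)) * (m * q ! 2))) phi) phi"
  proof (rule tensor_sum_Phi_one_comult_1[OF multilinear_mixed_form, where
    k = "\<lambda>x y z a b c b1 b2. scale (koszul (parity b * parity z))
      ((S a * S x * \<alpha> * y) * (b1 * \<beta> * S b2) * (S z * m * c))"])
    fix x y z a b c b1 b2
    assume h: "homogeneous x" "homogeneous y" "homogeneous z" and z: "parity z = parity x + parity y"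
      and h': "homogeneous a" "homogeneous b" "homogeneous c" and c: "parity c = parity a + parity b"
      and h'': "homogeneous b1" "homogeneous b2" and b: "parity b = parity b1 + parity b2"
    show "scale (koszul (parity y * parity a + parity z * (parity a + parity b1)))
        (S ([x * a, y * b1, z * b2, c] ! 0) * \<alpha> * [x * a, y * b1, z * b2, c] ! 1 * \<beta> *
           S ([x * a, y * b1, z * b2, c] ! 2) * m * [x * a, y * b1, z * b2, c] ! 3) =
      scale (koszul (parity b * parity z)) ((S a * S x * \<alpha> * y) * (b1 * \<beta> * S b2) * (S z * m * c))"
      using h h' h'' z b by (simp add: sign_simps)
  next
    fix x y z a b c
    assume h: "homogeneous b"
    show "sweedler (\<lambda>v. scale (koszul (parity b * parity z))
        ((S a * S x * \<alpha> * y) * (v ! 0 * \<beta> * S (v ! 1)) * (S z * m * c))) (copr b) =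
      scale (\<epsilon> b) (S a * (S x * \<alpha> * y * \<beta> * S z) * (m * c))"
      by (subst coproduct_absorbed[OF h copr_beta[OF h]]) (simp add: mult.assoc)
  qed
  also have "\<dots> = sweedler (\<lambda>p. 1 * ?f p * m) phi"
  proof (rule lin_ext_cong)
    fix p
    show "sweedler (\<lambda>q. scale (\<epsilon> (q ! 1)) (S (q ! 0) * ?f p * (m * q ! 2))) phi = 1 * ?f p * m"
      by (subst phi_counit_mid[where g = "\<lambda>x z. S x * ?f p * (m * z)"])
       (auto intro!: multilinear_wordsI simp: multilinear_expand antipode_one)
  qed
  finally show ?thesis
    unfolding sweedler_sandwich phi_antipode by simp
qed

lemma mixed_form_one_Phiinv:
  "tensor_sum scale (mixed_form m) one_Phiinv =
    \<alpha> * sweedler (central_form m) phi_inv"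
proof -
  have "tensor_sum scale (mixed_form m) one_Phiinv =
    sweedler (\<lambda>w. \<alpha> * (w ! 0 * \<beta> * S (w ! 1) * m * w ! 2) * 1) phi_inv"
    unfolding tensor_sum_one_Phiinv[OF multilinear_mixed_form]
    by (rule lin_ext_cong) (auto simp: antipode_one mult.assoc elim!:
      homogeneous_words_3E[OF phi_inv(1)])
  then show ?thesis unfolding sweedler_sandwich by simp
qed

text \<open>
  The image of the pentagon identity under \<open>mixed_form m\<close>.
\<close>

lemma alpha_central_form_Phiinv:
  assumes "\<And>b. homogeneous b \<Longrightarrow> sweedler (\<lambda>w. S (w ! 0) * m * w ! 1) (copr b) = scale (\<epsilon> b) m"
  shows "\<alpha> * sweedler (central_form m) phi_inv = m"
proof -
  have i: "one_Phiinv \<in> tensor_power scale 4" "comult_at scale \<Delta> 3 2 \<Phi> \<in> tensor_power scale 4"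
    using comult_at_power_in[OF Phi_in, of 2] tensor_cat_one_in[OF Phiinv_in] by
      (simp_all del: One_nat_def)
  have "m = tensor_sum scale (mixed_form m) (tensor_mult scale G 4 (comult_at scale \<Delta> 3 0 \<Phi>)
      (tensor_mult scale G 4 (comult_at scale \<Delta> 3 2 \<Phi>) one_Phiinv))"
    unfolding pentagon_Phiinv by (rule mixed_form_Phi_one_comult_1[symmetric])
  also have "\<dots> = tensor_sum scale (mixed_form m) (tensor_mult scale G 4 (comult_at scale \<Delta> 3 2 \<Phi>)
    one_Phiinv)"
    by (rule mixed_form_comult_0[OF tensor_mult_in[OF i(2,1)]])
  also have "\<dots> = tensor_sum scale (mixed_form m) one_Phiinv"
    by (rule mixed_form_comult_2[OF i(1) assms])
  also have "\<dots> = \<alpha> * sweedler (central_form m) phi_inv"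
    by (rule mixed_form_one_Phiinv)
  finally show ?thesis ..
qed

lemma pseudo_invariant_central_element:
  assumes "c \<in> G 0" "pseudo_invariant scale G \<Delta> \<epsilon> S c"
    and C: "C = tensor_sum scale (\<lambda>w. S (w ! 0) * c * w ! 1 * \<beta> * S (w ! 2)) \<Phi>"
  shows "(\<forall>a. a * C = C * a) \<and> (c = C * \<alpha> \<and> C * \<alpha> = \<alpha> * C)
    \<and> C = tensor_sum scale (central_form c) \<Phi>inv"
proof -
  define D where "D = sweedler (central_form c) phi_inv"
  note inv = copr_pseudo_invariant[OF assms(2,1)]
  have comm: "a * D = D * a" for a
    unfolding D_def by (rule central_form_Phiinv_central[OF inv])
  have c: "\<alpha> * D = c"
    unfolding D_def by (rule alpha_central_form_Phiinv[OF inv])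
  have "C = sweedler (\<lambda>w. S (w ! 0) * c * w ! 1 * \<beta> * S (w ! 2)) phi"
    unfolding C phi(2) by (rule tensor_sum_rep[OF multilinear_antipode_Phi])
  also have "\<dots> = sweedler (\<lambda>w. D * (S (w ! 0) * \<alpha> * w ! 1 * \<beta> * S (w ! 2)) * 1) phi"
  proof (rule lin_ext_cong)
    fix w
    have "S (w ! 0) * c = D * (S (w ! 0) * \<alpha>)"
      by (metis c comm mult.assoc)
    then show "S (w ! 0) * c * w ! 1 * \<beta> * S (w ! 2) = D * (S (w ! 0) * \<alpha> * w ! 1 * \<beta> * S (w ! 2)) * 1"
      by (simp only: mult.assoc mult_1_right)
  qed
  also have "\<dots> = D"
    unfolding sweedler_sandwich phi_antipode by simp
  finally have "C = D" .
  moreover have "tensor_sum scale (central_form c) \<Phi>inv = D"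
    unfolding D_def phi_inv(2) by (rule tensor_sum_rep[OF multilinear_central_form])
  ultimately show ?thesis
    using comm c by simp
qed

end

theorem proposition2:
  fixes scale :: "'k::field \<Rightarrow> 'a::ring_1 \<Rightarrow> 'a"
    and G :: "bit \<Rightarrow> 'a set"
    and \<Delta> :: "'a \<Rightarrow> ('a list \<Rightarrow>\<^sub>0 'k) set"
    and \<epsilon> :: "'a \<Rightarrow> 'k"
    and \<Phi> \<Phi>inv :: "('a list \<Rightarrow>\<^sub>0 'k) set"
    and S :: "'a \<Rightarrow> 'a"
    and \<alpha> \<beta> c\<^sub>2 C\<^sub>2 :: 'a
  assumes "quasi_hopf_superalgebra scale G \<Delta> \<epsilon> \<Phi> \<Phi>inv S \<alpha> \<beta>"
    and "c\<^sub>2 \<in> G 0"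
    and "pseudo_invariant scale G \<Delta> \<epsilon> S c\<^sub>2"
    and "C\<^sub>2 = tensor_sum scale (\<lambda>w. S (w ! 0) * c\<^sub>2 * w ! 1 * \<beta> * S (w ! 2)) \<Phi>"
  shows "(\<forall>a. a * C\<^sub>2 = C\<^sub>2 * a)
    \<and> (c\<^sub>2 = C\<^sub>2 * \<alpha> \<and> C\<^sub>2 * \<alpha> = \<alpha> * C\<^sub>2)
    \<and> C\<^sub>2 = tensor_sum scale (\<lambda>w. w ! 0 * \<beta> * S (w ! 1) * c\<^sub>2 * w ! 2) \<Phi>inv"
proof -
  interpret quasi_hopf_superalgebra scale G \<Delta> \<epsilon> \<Phi> \<Phi>inv S \<alpha> \<beta>
    by fact
  obtain copr phi phi_inv
    where "quasi_hopf_representatives scale G \<Delta> \<epsilon> \<Phi> \<Phi>inv S \<alpha> \<beta> copr phi phi_inv"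
    by (rule representatives_exist)
  then interpret quasi_hopf_representatives scale G \<Delta> \<epsilon> \<Phi> \<Phi>inv S \<alpha> \<beta> copr phi phi_inv .
  show ?thesis
    by (rule pseudo_invariant_central_element[OF assms(2-4)])
qed

end
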